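(* Let $S=k\oplus S_1\oplus S_2\oplus\cdots$ be a standard graded ring over a field $k$, let $x\in S_1$ be a regular element (a non-zerodivisor) of $S$, and let $R=S/(x)$. Let $$\cdots\longrightarrow R^{b_{i+1}}\xrightarrow{\ \delta_{i+1}\ }R^{b_i}\xrightarrow{\ \delta_i\ }R^{b_{i-1}}\longrightarrow\cdots\qquad(i\in\mathbb Z)$$ be a nonzero doubly infinite minimal totally acyclic complex of $R$-modules. For each $i\in\mathbb Z$ let $\tilde\delta_i:S^{b_i}\to S^{b_{i-1}}$ be a lifting of $\delta_i$ to $S$, viewed as a matrix with entries in $S$, and let $M_{i+1}$ be a matrix with entries in $S$ such that $\tilde\delta_i\tilde\delta_{i+1}=xM_{i+1}$ (such a matrix exists because $\delta_i\delta_{i+1}=0$). Define $\epsilon_i:S^{b_i}\oplus S^{b_{i-1}}\to S^{b_{i-1}}\oplus S^{b_{i-2}}$ by $$\epsilon_i=\begin{bmatrix}\tilde\delta_i & xI_{b_{i-1}}\\ M_i&\tilde\delta_{i-1}\end{bmatrix}\ \text{ if } i \text{ is even},\qquad \epsilon_i=\begin{bmatrix}\tilde\delta_i & -xI_{b_{i-1}}\\ -M_i&\tilde\delta_{i-1}\end{bmatrix}\ \text{ if } i \text{ is odd}.$$ Then $$\cdots\longrightarrow S^{b_{i+1}}\oplus S^{b_i}\xrightarrow{\ \epsilon_{i+1}\ }S^{b_i}\oplus S^{b_{i-1}}\xrightarrow{\ \epsilon_i\ }S^{b_{i-1}}\oplus S^{b_{i-2}}\longrightarrow\cdots$$ is a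 doubly infinite minimal totally acyclic complex of $S$-modules, and the cokernel of each $\epsilon_i$ is a non-free totally reflexive $S$-module.
   Context: All rings are commutative and Noetherian; a standard graded ring over $k$ is generated as a $k$-algebra by its finite-dimensional degree-one component. For a ring $A$, a totally acyclic complex is an infinite complex of finitely generated free $A$-modules $F:\ \cdots\to F_1\to F_0\to F_{-1}\to\cdots$ such that both $F$ and its dual $F^*=\mathrm{Hom}_A(F,A)$ are exact. For a graded ring $A$ it is called minimal if the entries of the matrices representing the differentials lie in the homogeneous maximal ideal. A finitely generated $A$-module is totally reflexive if it is isomorphic to $\mathrm{Coker}(F_1\to F_0)$ for some totally acyclic complex $F$. $I_b$ denotes the $b\times b$ identity matrix. *)

theory Defs
  imports "HOL-Algebra.Algebra" "Jordan_Normal_Form.Matrix"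
begin

text \<open>
  Rings and modules are the carrier-based structures of HOL-Algebra. From Jordan_Normal_Form only
  the containers \<open>'a vec\<close>, \<open>'a mat\<close> and the operations on them that need no arithmetic on the
  entry type are used; addition and multiplication of entries always come from the ring record.
\<close>

section \<open>Graded rings\<close>

locale graded_ring = cring A for A (structure) +
  fixes G :: "nat \<Rightarrow> 'a set"
  assumes comp_subgroup: "additive_subgroup (G n) A"
    and comp_mult: "\<lbrakk> a \<in> G m; b \<in> G n \<rbrakk> \<Longrightarrow> a \<otimes> b \<in> G (m + n)"
    and direct_sum: "a \<in> carrier A \<Longrightarrow>
      \<exists>!f. (\<forall>n. f n \<in> G n) \<and> finite {n. f n \<noteq> \<zero>} \<and> a = (\<Oplus>n\<in>{n. f n \<noteq> \<zero>}. f n)"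

locale standard_graded_ring = graded_ring A G + noetherian_ring A
  for A (structure) and k :: "'a set" and G :: "nat \<Rightarrow> 'a set" +
  assumes subfield_k: "subfield k A"
    and comp_0: "G 0 = k"
    and comp_1_finite_dimension: "finite_dimension k (G 1)"
    and comp_1_generates: "generate_ring A (k \<union> G 1) = carrier A"

definition quotient_grading ::
    "('a, 'm) ring_scheme \<Rightarrow> 'a set \<Rightarrow> (nat \<Rightarrow> 'a set) \<Rightarrow> nat \<Rightarrow> 'a set set" where
  "quotient_grading A I G n = (\<lambda>a. I +>\<^bsub>A\<^esub> a) ` G n"

text \<open>When the degree-zero component is a field, the ideal generated by the elements of positive
  degree is the homogeneous maximal ideal.\<close>

definition homogeneous_max_ideal :: "('a, 'm) ring_scheme \<Rightarrow> (nat \<Rightarrow> 'a set) \<Rightarrow> 'a set" where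
  "homogeneous_max_ideal A G = genideal A (\<Union>n\<in>{1..}. G n)"

section \<open>Modules\<close>

definition mod_homs ::
    "('a, 'm) ring_scheme \<Rightarrow> ('a, 'b) module \<Rightarrow> ('a, 'c) module \<Rightarrow> ('b \<Rightarrow> 'c) set" where
  "mod_homs A M N = {f \<in> carrier M \<rightarrow>\<^sub>E carrier N.
     (\<forall>u\<in>carrier M. \<forall>v\<in>carrier M. f (u \<oplus>\<^bsub>M\<^esub> v) = f u \<oplus>\<^bsub>N\<^esub> f v) \<and>
     (\<forall>a\<in>carrier A. \<forall>v\<in>carrier M. f (a \<odot>\<^bsub>M\<^esub> v) = a \<odot>\<^bsub>N\<^esub> f v)}"

definition module_isomorphic ::
    "('a, 'm) ring_scheme \<Rightarrow> ('a, 'b) module \<Rightarrow> ('a, 'c) module \<Rightarrow> bool" where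
  "module_isomorphic A M N \<longleftrightarrow> (\<exists>f\<in>mod_homs A M N. bij_betw f (carrier M) (carrier N))"

definition finitely_generated_module :: "('a, 'm) ring_scheme \<Rightarrow> ('a, 'b) module \<Rightarrow> bool" where
  "finitely_generated_module A M \<longleftrightarrow> module A M \<and>
     (\<exists>B. finite B \<and> B \<subseteq> carrier M \<and>
       (\<forall>m\<in>carrier M. \<exists>c\<in>B \<rightarrow> carrier A. m = (\<Oplus>\<^bsub>M\<^esub>v\<in>B. c v \<odot>\<^bsub>M\<^esub> v)))"

definition is_module_basis :: "('a, 'm) ring_scheme \<Rightarrow> ('a, 'b) module \<Rightarrow> 'b set \<Rightarrow> bool" where
  "is_module_basis A M B \<longleftrightarrow> B \<subseteq> carrier M \<and>
     (\<forall>m\<in>carrier M. \<exists>!c. c \<in> B \<rightarrow>\<^sub>E carrier A \<and> finite {v\<in>B. c v \<noteq> \<zero>\<^bsub>A\<^esub>} \<and>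
        m = (\<Oplus>\<^bsub>M\<^esub>v\<in>{v\<in>B. c v \<noteq> \<zero>\<^bsub>A\<^esub>}. c v \<odot>\<^bsub>M\<^esub> v))"

definition free_module :: "('a, 'm) ring_scheme \<Rightarrow> ('a, 'b) module \<Rightarrow> bool" where
  "free_module A M \<longleftrightarrow> module A M \<and> (\<exists>B. is_module_basis A M B)"

text \<open>The record type of modules also has fields for a ring multiplication and unit. They play no
  role for modules and are left undefined where no natural value exists.\<close>

definition hom_module ::
    "('a, 'm) ring_scheme \<Rightarrow> ('a, 'b) module \<Rightarrow> ('a, 'c) module \<Rightarrow> ('a, 'b \<Rightarrow> 'c) module" where
  "hom_module A M N =
    \<lparr>carrier = mod_homs A M N, monoid.mult = undefined, monoid.one = undefined,
     ring.zero = (\<lambda>v\<in>carrier M. \<zero>\<^bsub>N\<^esub>), ring.add = (\<lambda>f g. \<lambda>v\<in>carrier M. f v \<oplus>\<^bsub>N\<^esub> g v),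
     module.smult = (\<lambda>a f. \<lambda>v\<in>carrier M. a \<odot>\<^bsub>N\<^esub> f v)\<rparr>"

definition self_module :: "('a, 'm) ring_scheme \<Rightarrow> ('a, 'a) module" where
  "self_module A =
    \<lparr>carrier = carrier A, monoid.mult = monoid.mult A, monoid.one = monoid.one A,
     ring.zero = ring.zero A, ring.add = ring.add A, module.smult = monoid.mult A\<rparr>"

definition dual_module :: "('a, 'm) ring_scheme \<Rightarrow> ('a, 'b) module \<Rightarrow> ('a, 'b \<Rightarrow> 'a) module" where
  "dual_module A M = hom_module A M (self_module A)"

definition quotient_module ::
    "('a, 'm) ring_scheme \<Rightarrow> ('a, 'b) module \<Rightarrow> 'b set \<Rightarrow> ('a, 'b set) module" where
  "quotient_module A M U =
    \<lparr>carrier = a_rcosets\<^bsub>M\<^esub> U, monoid.mult = undefined, monoid.one = undefined,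
     ring.zero = U, ring.add = set_add M,
     module.smult = (\<lambda>a C. \<Union>v\<in>C. U +>\<^bsub>M\<^esub> (a \<odot>\<^bsub>M\<^esub> v))\<rparr>"

definition cokernel ::
    "('a, 'm) ring_scheme \<Rightarrow> ('a, 'b) module \<Rightarrow> ('a, 'c) module \<Rightarrow> ('b \<Rightarrow> 'c) \<Rightarrow> ('a, 'c set) module"
  where "cokernel A M N f = quotient_module A N (f ` carrier M)"

definition free_mod :: "('a, 'm) ring_scheme \<Rightarrow> nat \<Rightarrow> ('a, 'a vec) module" where
  "free_mod A n =
    \<lparr>carrier = {v \<in> carrier_vec n. \<forall>i<n. v $ i \<in> carrier A},
     monoid.mult = undefined, monoid.one = undefined,
     ring.zero = vec n (\<lambda>i. \<zero>\<^bsub>A\<^esub>), ring.add = (\<lambda>v w. vec n (\<lambda>i. v $ i \<oplus>\<^bsub>A\<^esub> w $ i)),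
     module.smult = (\<lambda>a v. vec n (\<lambda>i. a \<otimes>\<^bsub>A\<^esub> v $ i))\<rparr>"

section \<open>Totally acyclic complexes\<close>

text \<open>A complex has modules \<open>F i\<close> and differentials \<open>d i\<close> from \<open>F i\<close> to \<open>F (i - 1)\<close>, for all
  integers \<open>i\<close>.\<close>

definition exact_complex :: "(int \<Rightarrow> ('a, 'b) module) \<Rightarrow> (int \<Rightarrow> 'b \<Rightarrow> 'b) \<Rightarrow> bool" where
  "exact_complex F d \<longleftrightarrow>
     (\<forall>i. d (i + 1) ` carrier (F (i + 1)) = {v \<in> carrier (F i). d i v = \<zero>\<^bsub>F (i - 1)\<^esub>})"

text \<open>The dual complex is reindexed so that its differentials again lower the index: in position
  \<open>i\<close> it has the dual of \<open>F (- i)\<close>.\<close>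

definition dual_complex ::
    "('a, 'm) ring_scheme \<Rightarrow> (int \<Rightarrow> ('a, 'b) module) \<Rightarrow> int \<Rightarrow> ('a, 'b \<Rightarrow> 'a) module" where
  "dual_complex A F i = dual_module A (F (- i))"

definition dual_differential ::
    "('a, 'm) ring_scheme \<Rightarrow> (int \<Rightarrow> ('a, 'b) module) \<Rightarrow> (int \<Rightarrow> 'b \<Rightarrow> 'b) \<Rightarrow>
      int \<Rightarrow> ('b \<Rightarrow> 'a) \<Rightarrow> ('b \<Rightarrow> 'a)" where
  "dual_differential A F d i =
     (\<lambda>\<phi>\<in>carrier (dual_complex A F i). \<lambda>v\<in>carrier (F (1 - i)). \<phi> (d (1 - i) v))"

definition totally_acyclic ::
    "('a, 'm) ring_scheme \<Rightarrow> (int \<Rightarrow> ('a, 'b) module) \<Rightarrow> (int \<Rightarrow> 'b \<Rightarrow> 'b) \<Rightarrow> bool" where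
  "totally_acyclic A F d \<longleftrightarrow>
     (\<forall>i. finitely_generated_module A (F i) \<and> free_module A (F i)) \<and>
     (\<forall>i. d i \<in> mod_homs A (F i) (F (i - 1))) \<and>
     exact_complex F d \<and>
     exact_complex (dual_complex A F) (dual_differential A F d)"

text \<open>Every finitely generated free module is isomorphic to some \<open>free_mod A n\<close>, so restricting
  the witnessing complex to modules with elements of type \<open>'a vec\<close> loses nothing.\<close>

definition totally_reflexive :: "('a, 'm) ring_scheme \<Rightarrow> ('a, 'b) module \<Rightarrow> bool" where
  "totally_reflexive A M \<longleftrightarrow> finitely_generated_module A M \<and>
     (\<exists>(F :: int \<Rightarrow> ('a, 'a vec) module) d.
        totally_acyclic A F d \<and> module_isomorphic A M (cokernel A (F 1) (F 0) (d 1)))"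

section \<open>Matrices over a ring\<close>

definition mats_over :: "('a, 'm) ring_scheme \<Rightarrow> nat \<Rightarrow> nat \<Rightarrow> 'a mat set" where
  "mats_over A m n = {D \<in> carrier_mat m n. elements_mat D \<subseteq> carrier A}"

definition mat_mult :: "('a, 'm) ring_scheme \<Rightarrow> 'a mat \<Rightarrow> 'a mat \<Rightarrow> 'a mat" where
  "mat_mult A D E = mat (dim_row D) (dim_col E)
     (\<lambda>(i, j). \<Oplus>\<^bsub>A\<^esub>l\<in>{..<dim_col D}. D $$ (i, l) \<otimes>\<^bsub>A\<^esub> E $$ (l, j))"

definition mat_smult :: "('a, 'm) ring_scheme \<Rightarrow> 'a \<Rightarrow> 'a mat \<Rightarrow> 'a mat" where
  "mat_smult A a D = map_mat (\<lambda>y. a \<otimes>\<^bsub>A\<^esub> y) D"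

definition mat_uminus :: "('a, 'm) ring_scheme \<Rightarrow> 'a mat \<Rightarrow> 'a mat" where
  "mat_uminus A D = map_mat (\<lambda>y. \<ominus>\<^bsub>A\<^esub> y) D"

definition mat_id :: "('a, 'm) ring_scheme \<Rightarrow> nat \<Rightarrow> 'a mat" where
  "mat_id A n = mat n n (\<lambda>(i, j). if i = j then \<one>\<^bsub>A\<^esub> else \<zero>\<^bsub>A\<^esub>)"

definition mat_map :: "('a, 'm) ring_scheme \<Rightarrow> 'a mat \<Rightarrow> 'a vec \<Rightarrow> 'a vec" where
  "mat_map A D = (\<lambda>v\<in>carrier (free_mod A (dim_col D)).
     vec (dim_row D) (\<lambda>i. \<Oplus>\<^bsub>A\<^esub>j\<in>{..<dim_col D}. D $$ (i, j) \<otimes>\<^bsub>A\<^esub> v $ j))"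

definition minimal_differentials ::
    "('a, 'm) ring_scheme \<Rightarrow> (nat \<Rightarrow> 'a set) \<Rightarrow> (int \<Rightarrow> 'a mat) \<Rightarrow> bool" where
  "minimal_differentials A G D \<longleftrightarrow> (\<forall>i. elements_mat (D i) \<subseteq> homogeneous_max_ideal A G)"

text \<open>The block columns have widths \<open>b i\<close> and \<open>b (i - 1)\<close>, the block rows heights \<open>b (i - 1)\<close>
  and \<open>b (i - 2)\<close>; a direct sum of free modules of ranks \<open>m\<close> and \<open>n\<close> is identified with the free
  module of rank \<open>m + n\<close>.\<close>

definition eps_mat ::
    "('a, 'm) ring_scheme \<Rightarrow> 'a \<Rightarrow> (int \<Rightarrow> nat) \<Rightarrow> (int \<Rightarrow> 'a mat) \<Rightarrow> (int \<Rightarrow> 'a mat) \<Rightarrow> int \<Rightarrow> 'a mat"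
  where
  "eps_mat A x b D M i =
    (if even i
     then four_block_mat (D i) (mat_smult A x (mat_id A (b (i - 1))))
                         (M i) (D (i - 1))
     else four_block_mat (D i) (mat_uminus A (mat_smult A x (mat_id A (b (i - 1)))))
                         (mat_uminus A (M i)) (D (i - 1)))"

end

theory Submission
  imports Defs
begin

text \<open>
  Write \<open>d\<close> for the lifted differentials and \<open>M\<close> for the matrices with \<open>d d = x M\<close>. The matrices
  \<open>\<epsilon>\<close> are those of a complex over \<open>S\<close> because \<open>x\<close> is cancellable: \<open>x d M = d d d = x M d\<close> gives
  \<open>d M = M d\<close>, and the remaining terms cancel by the alternating signs. It is exact because a kernel
  element \<open>(u, v)\<close> satisfies \<open>d u = \<plusminus> x v\<close>; so \<open>u\<close> is a cycle modulo \<open>x\<close>, hence \<open>u = d w + x t\<close>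
  since the complex over \<open>R\<close> is exact, and cancelling \<open>x\<close> in \<open>d u = x (M w + d t)\<close> shows that \<open>v\<close> is
  what it has to be for \<open>(u, v)\<close> to be the image of \<open>(w, \<plusminus> t)\<close>. This is
  \<open>block_kernel_eq_image\<close>.

  The dual complex of a complex of free modules is given by the transposed matrices
  (\<open>exact_dual_complex_iff\<close>). Transposition turns the matrices \<open>\<epsilon>\<close> into matrices of the same shape,
  built from the transposed \<open>d\<close> and \<open>M\<close>, once the two summands are exchanged. Exactness of the dual
  complex over \<open>S\<close> thus follows from that of the dual complex over \<open>R\<close> by the same computation
  (\<open>block_exact\<close>).

  For minimality, the lifts \<open>d\<close> have entries of positive degree because \<open>x\<close> has positive degree
  (\<open>lift_of_quotient_max_ideal\<close>); then \<open>x M = d d\<close> has entries of degree at least two, and since \<open>x\<close>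
  is regular of degree one, the entries of \<open>M\<close> have no constant term (\<open>degree_one_cancel\<close>).

  If some cokernel were free, the image of \<open>\<epsilon>\<close> would be a direct summand of a free module all of whose
  elements have entries of positive degree. Iterating the projection onto this summand pushes the
  entries into arbitrarily high degree, so the image is zero (\<open>minimal_free_cokernel_zero\<close>). Exactness
  of the complex and of its dual then spreads from this zero differential to all positions
  (\<open>minimal_exact_all_zero\<close>): a minimal matrix cannot be onto a nonzero free module. So all ranks
  vanish, contrary to the assumption that the complex over \<open>R\<close> is nonzero. As the
  entries of the differentials may mix degrees, the argument uses the degree filtration of \<open>S\<close>
  in place of homogeneous elements.
\<close>

section \<open>Free modules and matrices\<close>

lemma mem_free_mod:
  "v \<in> carrier (free_mod A n) \<longleftrightarrow> dim_vec v = n \<and> (\<forall>i<n. v $ i \<in> carrier A)"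
  by (auto simp: free_mod_def)

lemma free_mod_ops:
  "\<zero>\<^bsub>free_mod A n\<^esub> = vec n (\<lambda>i. \<zero>\<^bsub>A\<^esub>)"
  "v \<oplus>\<^bsub>free_mod A n\<^esub> w = vec n (\<lambda>i. v $ i \<oplus>\<^bsub>A\<^esub> w $ i)"
  "a \<odot>\<^bsub>free_mod A n\<^esub> v = vec n (\<lambda>i. a \<otimes>\<^bsub>A\<^esub> v $ i)"
  by (simp_all add: free_mod_def)

lemma mats_over_iff:
  "D \<in> mats_over A m n \<longleftrightarrow>
     dim_row D = m \<and> dim_col D = n \<and> (\<forall>i<m. \<forall>j<n. D $$ (i, j) \<in> carrier A)"
proof
  assume D: "D \<in> mats_over A m n"
  then have "D $$ (i, j) \<in> elements_mat D" if "i < m" "j < n" for i j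
    using that by (intro elements_matI) (auto simp: mats_over_def)
  with D show "dim_row D = m \<and> dim_col D = n \<and> (\<forall>i<m. \<forall>j<n. D $$ (i, j) \<in> carrier A)"
    by (auto simp: mats_over_def)
qed (auto simp: mats_over_def elements_mat_def)

lemma transpose_mats_over: "D \<in> mats_over A m n \<Longrightarrow> D\<^sup>T \<in> mats_over A n m"
  by (auto simp: mats_over_iff)

definition free_unit :: "('a, 'm) ring_scheme \<Rightarrow> nat \<Rightarrow> nat \<Rightarrow> 'a vec" where
  "free_unit A n j = vec n (\<lambda>i. if i = j then \<one>\<^bsub>A\<^esub> else \<zero>\<^bsub>A\<^esub>)"

lemma mod_homsD:
  assumes "f \<in> mod_homs A M N"
  shows mod_homs_closed: "v \<in> carrier M \<Longrightarrow> f v \<in> carrier N"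
    and mod_homs_add: "\<lbrakk> u \<in> carrier M; v \<in> carrier M \<rbrakk> \<Longrightarrow> f (u \<oplus>\<^bsub>M\<^esub> v) = f u \<oplus>\<^bsub>N\<^esub> f v"
    and mod_homs_smult: "\<lbrakk> a \<in> carrier A; v \<in> carrier M \<rbrakk> \<Longrightarrow> f (a \<odot>\<^bsub>M\<^esub> v) = a \<odot>\<^bsub>N\<^esub> f v"
  using assms by (auto simp: mod_homs_def)

lemma mod_homs_finsum:
  assumes f: "f \<in> mod_homs A M N" and M: "module A M" and N: "module A N"
    and "finite J" and "g \<in> J \<rightarrow> carrier M"
  shows "f (\<Oplus>\<^bsub>M\<^esub>j\<in>J. g j) = (\<Oplus>\<^bsub>N\<^esub>j\<in>J. f (g j))"
  using assms(4,5)
proof (induction J rule: finite_induct)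
  case empty
  interpret M: module A M by (rule M)
  interpret N: module A N by (rule N)
  have "f \<zero>\<^bsub>M\<^esub> = f (\<zero>\<^bsub>A\<^esub> \<odot>\<^bsub>M\<^esub> \<zero>\<^bsub>M\<^esub>)" by simp
  also have "\<dots> = \<zero>\<^bsub>N\<^esub>"
    using mod_homs_closed[OF f] by (subst mod_homs_smult[OF f]) auto
  finally show ?case by simp
next
  case (insert j J)
  interpret M: module A M by (rule M)
  interpret N: module A N by (rule N)
  have "(\<Oplus>\<^bsub>M\<^esub>j\<in>J. g j) \<in> carrier M"
    using insert.prems by (intro M.finsum_closed) auto
  then show ?case
    using insert mod_homs_add[OF f] mod_homs_closed[OF f] by (simp add: Pi_iff)
qed

lemma mod_homs_zero:
  assumes "f \<in> mod_homs A M N" "module A M" "module A N"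
  shows "f \<zero>\<^bsub>M\<^esub> = \<zero>\<^bsub>N\<^esub>"
proof -
  interpret M: module A M by fact
  interpret N: module A N by fact
  show ?thesis using mod_homs_finsum[OF assms, of "{}" "\<lambda>_. \<zero>\<^bsub>M\<^esub>"] by simp
qed

context cring
begin

lemma free_mod_module: "module R (free_mod R n)"
proof (rule moduleI)
  show "abelian_group (free_mod R n)"
  proof (rule abelian_groupI)
    fix u assume "u \<in> carrier (free_mod R n)"
    then show "\<exists>v\<in>carrier (free_mod R n). v \<oplus>\<^bsub>free_mod R n\<^esub> u = \<zero>\<^bsub>free_mod R n\<^esub>"
      by (intro bexI[of _ "vec n (\<lambda>i. \<ominus> (u $ i))"])
        (auto simp: mem_free_mod free_mod_ops l_neg)
  qed (auto simp: mem_free_mod free_mod_ops a_ac)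
qed (auto simp: mem_free_mod free_mod_ops is_cring l_distr r_distr m_assoc)

lemma self_module_module: "module R (self_module R)"
  by (rule moduleI) (auto intro!: abelian_groupI simp: self_module_def a_ac is_cring l_distr r_distr m_assoc
     intro: exI[of _ "\<ominus> _"] bexI[of _ "\<ominus> _"] l_neg)

lemma free_unit_closed [simp]: "free_unit R n j \<in> carrier (free_mod R n)"
  by (auto simp: free_unit_def mem_free_mod)

lemma free_mod_finsum_index:
  assumes "finite J" "g \<in> J \<rightarrow> carrier (free_mod R n)"
  shows "dim_vec (\<Oplus>\<^bsub>free_mod R n\<^esub>j\<in>J. g j) = n"
    and "i < n \<Longrightarrow> (\<Oplus>\<^bsub>free_mod R n\<^esub>j\<in>J. g j) $ i = (\<Oplus>j\<in>J. g j $ i)"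
proof -
  interpret M: module R "free_mod R n" by (rule free_mod_module)
  have "dim_vec (\<Oplus>\<^bsub>free_mod R n\<^esub>j\<in>J. g j) = n \<and>
    (i < n \<longrightarrow> (\<Oplus>\<^bsub>free_mod R n\<^esub>j\<in>J. g j) $ i = (\<Oplus>j\<in>J. g j $ i))"
    using assms
  proof (induction J rule: finite_induct)
    case (insert j J)
    then have "(\<lambda>j. g j $ i) \<in> J \<rightarrow> carrier R" "g j $ i \<in> carrier R" if "i < n"
      using that by (auto simp: mem_free_mod Pi_iff)
    moreover have "(\<Oplus>\<^bsub>free_mod R n\<^esub>j\<in>insert j J. g j)
        = g j \<oplus>\<^bsub>free_mod R n\<^esub> (\<Oplus>\<^bsub>free_mod R n\<^esub>j\<in>J. g j)"
      using insert by (intro M.finsum_insert) auto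
    ultimately show ?case using insert by (auto simp: free_mod_ops)
  qed (auto simp: free_mod_ops)
  then show "dim_vec (\<Oplus>\<^bsub>free_mod R n\<^esub>j\<in>J. g j) = n"
    "i < n \<Longrightarrow> (\<Oplus>\<^bsub>free_mod R n\<^esub>j\<in>J. g j) $ i = (\<Oplus>j\<in>J. g j $ i)" by auto
qed

lemma finsum_delta:
  assumes "i < (n::nat)" "f \<in> {..<n} \<rightarrow> carrier R"
  shows "(\<Oplus>j\<in>{..<n}. f j \<otimes> (if i = j then \<one> else \<zero>)) = f i"
proof -
  have "(\<Oplus>j\<in>{..<n}. f j \<otimes> (if i = j then \<one> else \<zero>)) = (\<Oplus>j\<in>{..<n}. if i = j then f j else \<zero>)"
    using assms by (intro finsum_cong') (auto simp: Pi_iff)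
  also have "\<dots> = f i" using assms by (intro finsum_singleton) auto
  finally show ?thesis .
qed

lemma free_mod_expansion:
  assumes "v \<in> carrier (free_mod R n)"
  shows "v = (\<Oplus>\<^bsub>free_mod R n\<^esub>j\<in>{..<n}. v $ j \<odot>\<^bsub>free_mod R n\<^esub> free_unit R n j)" (is "_ = ?s")
proof -
  interpret M: module R "free_mod R n" by (rule free_mod_module)
  have cl: "(\<lambda>j. v $ j \<odot>\<^bsub>free_mod R n\<^esub> free_unit R n j) \<in> {..<n} \<rightarrow> carrier (free_mod R n)"
    using assms by (auto simp: mem_free_mod[of v])
  show ?thesis
  proof (rule eq_vecI)
    fix i assume "i < dim_vec ?s"
    then have i: "i < n" using free_mod_finsum_index(1)[OF _ cl] by simp
    have "?s $ i = (\<Oplus>j\<in>{..<n}. v $ j \<otimes> (if i = j then \<one> else \<zero>))"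
      using i assms by (subst free_mod_finsum_index(2)[OF _ cl])
        (auto simp: free_mod_ops free_unit_def mem_free_mod intro!: finsum_cong')
    also have "\<dots> = v $ i" using assms i by (intro finsum_delta) (auto simp: mem_free_mod)
    finally show "v $ i = ?s $ i" by simp
  qed (use assms free_mod_finsum_index(1)[OF _ cl] in \<open>auto simp: mem_free_mod\<close>)
qed

lemma free_mod_hom_expansion:
  assumes f: "f \<in> mod_homs R (free_mod R n) N" and N: "module R N"
    and v: "v \<in> carrier (free_mod R n)"
  shows "f v = (\<Oplus>\<^bsub>N\<^esub>j\<in>{..<n}. v $ j \<odot>\<^bsub>N\<^esub> f (free_unit R n j))"
proof -
  interpret M: module R "free_mod R n" by (rule free_mod_module)
  interpret N: module R N by (rule N)
  have vj: "v $ j \<in> carrier R" if "j < n" for j using that v by (auto simp: mem_free_mod)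
  have "f v = f (\<Oplus>\<^bsub>free_mod R n\<^esub>j\<in>{..<n}. v $ j \<odot>\<^bsub>free_mod R n\<^esub> free_unit R n j)"
    using free_mod_expansion[OF v] by simp
  also have "\<dots> = (\<Oplus>\<^bsub>N\<^esub>j\<in>{..<n}. f (v $ j \<odot>\<^bsub>free_mod R n\<^esub> free_unit R n j))"
    using vj by (intro mod_homs_finsum[OF f free_mod_module N]) auto
  also have "\<dots> = (\<Oplus>\<^bsub>N\<^esub>j\<in>{..<n}. v $ j \<odot>\<^bsub>N\<^esub> f (free_unit R n j))"
    using vj by (intro N.finsum_cong') (auto simp: mod_homs_smult[OF f] mod_homs_closed[OF f])
  finally show ?thesis .
qed

lemma mat_map_dim [simp]:
  "v \<in> carrier (free_mod R (dim_col D)) \<Longrightarrow> dim_vec (mat_map R D v) = dim_row D"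
  by (simp add: mat_map_def)

lemma mat_map_index:
  "\<lbrakk> v \<in> carrier (free_mod R (dim_col D)); i < dim_row D \<rbrakk> \<Longrightarrow>
    mat_map R D v $ i = (\<Oplus>j\<in>{..<dim_col D}. D $$ (i, j) \<otimes> v $ j)"
  by (simp add: mat_map_def)

lemma mat_map_hom:
  assumes "D \<in> mats_over R m n"
  shows "mat_map R D \<in> mod_homs R (free_mod R n) (free_mod R m)"
proof -
  have cl: "D $$ (i, j) \<in> carrier R" if "i < m" "j < n" for i j
    using assms that by (auto simp: mats_over_iff)
  have dims: "dim_row D = m" "dim_col D = n" using assms by (auto simp: mats_over_iff)
  interpret M: module R "free_mod R n" by (rule free_mod_module)
  show ?thesis
    unfolding mod_homs_def
  proof (intro CollectI conjI ballI)
    show "mat_map R D \<in> carrier (free_mod R n) \<rightarrow>\<^sub>E carrier (free_mod R m)"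
      using dims cl by (auto simp: mat_map_def mem_free_mod intro!: finsum_closed)
  next
    fix u v assume uv: "u \<in> carrier (free_mod R n)" "v \<in> carrier (free_mod R n)"
    show "mat_map R D (u \<oplus>\<^bsub>free_mod R n\<^esub> v) = mat_map R D u \<oplus>\<^bsub>free_mod R m\<^esub> mat_map R D v"
    proof (rule eq_vecI)
      fix i assume "i < dim_vec (mat_map R D u \<oplus>\<^bsub>free_mod R m\<^esub> mat_map R D v)"
      then have i: "i < m" by (simp add: free_mod_ops)
      have "(\<Oplus>j\<in>{..<n}. D $$ (i, j) \<otimes> (u \<oplus>\<^bsub>free_mod R n\<^esub> v) $ j)
        = (\<Oplus>j\<in>{..<n}. D $$ (i, j) \<otimes> u $ j \<oplus> D $$ (i, j) \<otimes> v $ j)"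
        using uv i cl by (intro finsum_cong') (auto simp: free_mod_ops mem_free_mod r_distr)
      also have "\<dots> = (\<Oplus>j\<in>{..<n}. D $$ (i, j) \<otimes> u $ j) \<oplus> (\<Oplus>j\<in>{..<n}. D $$ (i, j) \<otimes> v $ j)"
        using uv i cl by (intro finsum_addf) (auto simp: mem_free_mod)
      finally show "mat_map R D (u \<oplus>\<^bsub>free_mod R n\<^esub> v) $ i
          = (mat_map R D u \<oplus>\<^bsub>free_mod R m\<^esub> mat_map R D v) $ i"
        using uv i dims by (simp add: mat_map_index) (simp add: free_mod_ops mat_map_index)
    qed (use uv dims in \<open>simp_all add: free_mod_ops(2)[of _ m]\<close>)
  next
    fix a v assume av: "a \<in> carrier R" "v \<in> carrier (free_mod R n)"
    show "mat_map R D (a \<odot>\<^bsub>free_mod R n\<^esub> v) = a \<odot>\<^bsub>free_mod R m\<^esub> mat_map R D v"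
    proof (rule eq_vecI)
      fix i assume "i < dim_vec (a \<odot>\<^bsub>free_mod R m\<^esub> mat_map R D v)"
      then have i: "i < m" by (simp add: free_mod_ops)
      have "(\<Oplus>j\<in>{..<n}. D $$ (i, j) \<otimes> (a \<odot>\<^bsub>free_mod R n\<^esub> v) $ j)
        = (\<Oplus>j\<in>{..<n}. a \<otimes> (D $$ (i, j) \<otimes> v $ j))"
        using av i cl by (intro finsum_cong') (auto simp: free_mod_ops mem_free_mod m_ac)
      also have "\<dots> = a \<otimes> (\<Oplus>j\<in>{..<n}. D $$ (i, j) \<otimes> v $ j)"
        using av i cl by (intro finsum_rdistr[symmetric]) (auto simp: mem_free_mod)
      finally show "mat_map R D (a \<odot>\<^bsub>free_mod R n\<^esub> v) $ i
          = (a \<odot>\<^bsub>free_mod R m\<^esub> mat_map R D v) $ i"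
        using av i dims by (simp add: mat_map_index) (simp add: free_mod_ops mat_map_index)
    qed (use av dims in \<open>simp_all add: free_mod_ops(3)[of _ m]\<close>)
  qed
qed

lemma mat_map_closed:
  "\<lbrakk> D \<in> mats_over R m n; v \<in> carrier (free_mod R n) \<rbrakk> \<Longrightarrow> mat_map R D v \<in> carrier (free_mod R m)"
  using mod_homs_closed[OF mat_map_hom] .

lemma mat_map_entry_closed:
  "\<lbrakk> D \<in> mats_over R m n; v \<in> carrier (free_mod R n); i < m \<rbrakk> \<Longrightarrow> mat_map R D v $ i \<in> carrier R"
  using mat_map_closed[of D m n v] by (simp add: mem_free_mod)

lemma mat_map_lincomb:
  assumes "D \<in> mats_over R m n" "v \<in> carrier (free_mod R n)" "w \<in> carrier (free_mod R n)"
    "a \<in> carrier R" "i < m"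
  shows "mat_map R D (vec n (\<lambda>j. v $ j \<oplus> a \<otimes> w $ j)) $ i
    = mat_map R D v $ i \<oplus> a \<otimes> mat_map R D w $ i"
proof -
  interpret M: module R "free_mod R n" by (rule free_mod_module)
  have "vec n (\<lambda>j. v $ j \<oplus> a \<otimes> w $ j) = v \<oplus>\<^bsub>free_mod R n\<^esub> (a \<odot>\<^bsub>free_mod R n\<^esub> w)"
    by (auto simp: free_mod_ops)
  then show ?thesis
    using assms
    by (simp add: mod_homs_add[OF mat_map_hom[OF assms(1)]] mod_homs_smult[OF mat_map_hom[OF assms(1)]])
      (simp add: free_mod_ops)
qed

lemma mat_map_scale:
  assumes "D \<in> mats_over R m n" "w \<in> carrier (free_mod R n)" "a \<in> carrier R" "i < m"
  shows "mat_map R D (vec n (\<lambda>j. a \<otimes> w $ j)) $ i = a \<otimes> mat_map R D w $ i"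
  using assms mod_homs_smult[OF mat_map_hom[OF assms(1)] assms(3,2)] by (simp add: free_mod_ops)

lemma finsum_swap:
  assumes "finite I" "finite J" "\<And>i j. i \<in> I \<Longrightarrow> j \<in> J \<Longrightarrow> f i j \<in> carrier R"
  shows "(\<Oplus>i\<in>I. \<Oplus>j\<in>J. f i j) = (\<Oplus>j\<in>J. \<Oplus>i\<in>I. f i j)"
  using assms(1,3)
proof (induction I rule: finite_induct)
  case (insert i I)
  have "(\<Oplus>i\<in>insert i I. \<Oplus>j\<in>J. f i j) = (\<Oplus>j\<in>J. f i j) \<oplus> (\<Oplus>i\<in>I. \<Oplus>j\<in>J. f i j)"
    using insert by (intro finsum_insert) (auto intro!: finsum_closed)
  also have "\<dots> = (\<Oplus>j\<in>J. f i j) \<oplus> (\<Oplus>j\<in>J. \<Oplus>i\<in>I. f i j)" using insert by simp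
  also have "\<dots> = (\<Oplus>j\<in>J. f i j \<oplus> (\<Oplus>i\<in>I. f i j))"
    using insert by (intro finsum_addf[symmetric]) (auto intro!: finsum_closed)
  also have "\<dots> = (\<Oplus>j\<in>J. \<Oplus>i\<in>insert i I. f i j)"
    using insert by (intro finsum_cong') (auto intro!: finsum_closed)
  finally show ?case .
qed simp

lemma mat_map_mult:
  assumes D: "D \<in> mats_over R l m" and E: "E \<in> mats_over R m n"
    and v: "v \<in> carrier (free_mod R n)"
  shows "mat_map R (mat_mult R D E) v = mat_map R D (mat_map R E v)"
proof (rule eq_vecI)
  have dims: "dim_row D = l" "dim_col D = m" "dim_row E = m" "dim_col E = n"
    "dim_row (mat_mult R D E) = l" "dim_col (mat_mult R D E) = n"
    using D E by (auto simp: mats_over_iff mat_mult_def)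
  have Ev: "mat_map R E v \<in> carrier (free_mod R m)" by (rule mat_map_closed[OF E v])
  have cl: "\<And>i j. i < l \<Longrightarrow> j < m \<Longrightarrow> D $$ (i, j) \<in> carrier R"
    "\<And>i j. i < m \<Longrightarrow> j < n \<Longrightarrow> E $$ (i, j) \<in> carrier R" "\<And>j. j < n \<Longrightarrow> v $ j \<in> carrier R"
    using D E v by (auto simp: mats_over_iff mem_free_mod)
  show "dim_vec (mat_map R (mat_mult R D E) v) = dim_vec (mat_map R D (mat_map R E v))"
    using dims Ev v by simp
  fix i assume "i < dim_vec (mat_map R D (mat_map R E v))"
  then have i: "i < l" using dims Ev by simp
  have "mat_map R (mat_mult R D E) v $ i
    = (\<Oplus>j\<in>{..<n}. (\<Oplus>p\<in>{..<m}. D $$ (i, p) \<otimes> E $$ (p, j)) \<otimes> v $ j)"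
    using dims v i cl by (subst mat_map_index) (auto simp: mat_mult_def intro!: finsum_cong')
  also have "\<dots> = (\<Oplus>j\<in>{..<n}. \<Oplus>p\<in>{..<m}. D $$ (i, p) \<otimes> E $$ (p, j) \<otimes> v $ j)"
    using i cl by (intro finsum_cong' finsum_ldistr) (auto intro!: finsum_closed)
  also have "\<dots> = (\<Oplus>p\<in>{..<m}. \<Oplus>j\<in>{..<n}. D $$ (i, p) \<otimes> E $$ (p, j) \<otimes> v $ j)"
    using i cl by (intro finsum_swap) auto
  also have "\<dots> = (\<Oplus>p\<in>{..<m}. D $$ (i, p) \<otimes> (\<Oplus>j\<in>{..<n}. E $$ (p, j) \<otimes> v $ j))"
    using i cl by (intro finsum_cong' refl, force)
      (subst finsum_rdistr, auto simp: m_assoc intro!: finsum_cong')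
  also have "\<dots> = mat_map R D (mat_map R E v) $ i"
    using dims v i cl Ev
    by (subst mat_map_index[of _ D]) (auto simp: mat_map_index intro!: finsum_cong')
  finally show "mat_map R (mat_mult R D E) v $ i = mat_map R D (mat_map R E v) $ i" .
qed

lemma transpose_mat_mult:
  assumes "D \<in> mats_over R l m" "E \<in> mats_over R m n"
  shows "(mat_mult R D E)\<^sup>T = mat_mult R E\<^sup>T D\<^sup>T"
  using assms by (intro eq_matI) (auto simp: mat_mult_def mats_over_iff m_comm intro!: finsum_cong')

lemma mat_map_smult:
  assumes D: "D \<in> mats_over R m n" and v: "v \<in> carrier (free_mod R n)" and a: "a \<in> carrier R"
    and i: "i < m"
  shows "mat_map R (mat_smult R a D) v $ i = a \<otimes> mat_map R D v $ i"
proof -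
  have dims: "dim_row D = m" "dim_col D = n" using D by (auto simp: mats_over_iff)
  have cl: "\<And>j. j < n \<Longrightarrow> D $$ (i, j) \<in> carrier R" "\<And>j. j < n \<Longrightarrow> v $ j \<in> carrier R"
    using D v i by (auto simp: mats_over_iff mem_free_mod)
  have "mat_map R (mat_smult R a D) v $ i = (\<Oplus>j\<in>{..<n}. a \<otimes> (D $$ (i, j) \<otimes> v $ j))"
    using dims v i a cl
    by (subst mat_map_index) (auto simp: mat_smult_def m_assoc intro!: finsum_cong')
  also have "\<dots> = a \<otimes> mat_map R D v $ i"
    using dims v i a cl by (simp add: mat_map_index) (subst finsum_rdistr, auto)
  finally show ?thesis .
qed

end

text \<open>Generators are often given as a family in which the same element may occur several times, as with
the cosets of the unit vectors. Adding the coefficients of equal members turns a combination of the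
family into one of its set of values.\<close>

lemma (in module) finsum_image_coefficients:
  assumes "finite J" "g \<in> J \<rightarrow> carrier M" "a \<in> J \<rightarrow> carrier R"
  shows "\<exists>c\<in>g ` J \<rightarrow> carrier R. (\<Oplus>\<^bsub>M\<^esub>j\<in>J. a j \<odot>\<^bsub>M\<^esub> g j) = (\<Oplus>\<^bsub>M\<^esub>w\<in>g ` J. c w \<odot>\<^bsub>M\<^esub> w)"
  using assms
proof (induction J rule: finite_induct)
  case (insert j J)
  have "g \<in> J \<rightarrow> carrier M" "a \<in> J \<rightarrow> carrier R" using insert.prems by auto
  then obtain c where c: "c \<in> g ` J \<rightarrow> carrier R"
    "(\<Oplus>\<^bsub>M\<^esub>j\<in>J. a j \<odot>\<^bsub>M\<^esub> g j) = (\<Oplus>\<^bsub>M\<^esub>w\<in>g ` J. c w \<odot>\<^bsub>M\<^esub> w)" using insert.IH by blast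
  have cl: "a j \<in> carrier R" "g j \<in> carrier M" "\<And>w. w \<in> g ` J \<Longrightarrow> w \<in> carrier M"
    "\<And>w. w \<in> g ` J \<Longrightarrow> c w \<in> carrier R"
    using insert.prems c by (auto simp: Pi_iff)
  have L: "(\<Oplus>\<^bsub>M\<^esub>j\<in>insert j J. a j \<odot>\<^bsub>M\<^esub> g j)
      = a j \<odot>\<^bsub>M\<^esub> g j \<oplus>\<^bsub>M\<^esub> (\<Oplus>\<^bsub>M\<^esub>w\<in>g ` J. c w \<odot>\<^bsub>M\<^esub> w)"
    using insert by (subst M.finsum_insert) (auto simp: Pi_iff c(2))
  show ?case
  proof (cases "g j \<in> g ` J")
    case True
    let ?c = "c(g j := a j \<oplus> c (g j))" and ?J = "g ` J - {g j}"
    have J: "g ` J = insert (g j) ?J" using True by blast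
    have cl': "(\<lambda>w. c w \<odot>\<^bsub>M\<^esub> w) \<in> ?J \<rightarrow> carrier M" using cl by auto
    have "(\<Oplus>\<^bsub>M\<^esub>w\<in>g ` J. c w \<odot>\<^bsub>M\<^esub> w) = c (g j) \<odot>\<^bsub>M\<^esub> g j \<oplus>\<^bsub>M\<^esub> (\<Oplus>\<^bsub>M\<^esub>w\<in>?J. c w \<odot>\<^bsub>M\<^esub> w)"
      using cl cl' True insert.hyps by (subst J, subst M.finsum_insert) auto
    moreover have "(\<Oplus>\<^bsub>M\<^esub>w\<in>g ` J. ?c w \<odot>\<^bsub>M\<^esub> w)
        = (a j \<oplus> c (g j)) \<odot>\<^bsub>M\<^esub> g j \<oplus>\<^bsub>M\<^esub> (\<Oplus>\<^bsub>M\<^esub>w\<in>?J. ?c w \<odot>\<^bsub>M\<^esub> w)"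
      using cl cl' True insert.hyps by (subst J, subst M.finsum_insert) auto
    moreover have "(\<Oplus>\<^bsub>M\<^esub>w\<in>?J. ?c w \<odot>\<^bsub>M\<^esub> w) = (\<Oplus>\<^bsub>M\<^esub>w\<in>?J. c w \<odot>\<^bsub>M\<^esub> w)"
      using cl' by (intro M.finsum_cong') auto
    ultimately have "a j \<odot>\<^bsub>M\<^esub> g j \<oplus>\<^bsub>M\<^esub> (\<Oplus>\<^bsub>M\<^esub>w\<in>g ` J. c w \<odot>\<^bsub>M\<^esub> w) = (\<Oplus>\<^bsub>M\<^esub>w\<in>g ` J. ?c w \<odot>\<^bsub>M\<^esub> w)"
      using cl True M.finsum_closed[OF cl'] by (simp add: smult_l_distr M.a_assoc)
    then show ?thesis
      unfolding L using True cl by (intro bexI[of _ ?c]) (auto simp: insert_absorb)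
  next
    case False
    let ?c = "c(g j := a j)"
    have "(\<Oplus>\<^bsub>M\<^esub>w\<in>g ` J. ?c w \<odot>\<^bsub>M\<^esub> w) = (\<Oplus>\<^bsub>M\<^esub>w\<in>g ` J. c w \<odot>\<^bsub>M\<^esub> w)"
    proof (rule M.finsum_cong')
      fix w assume w: "w \<in> g ` J"
      then have "w \<noteq> g j" using False by blast
      then show "?c w \<odot>\<^bsub>M\<^esub> w = c w \<odot>\<^bsub>M\<^esub> w" by simp
    qed (use cl in auto)
    moreover have "(\<lambda>w. ?c w \<odot>\<^bsub>M\<^esub> w) \<in> g ` J \<rightarrow> carrier M" using cl by auto
    moreover have "?c (g j) \<odot>\<^bsub>M\<^esub> g j \<in> carrier M" using cl by simp
    ultimately have "(\<Oplus>\<^bsub>M\<^esub>w\<in>g ` insert j J. ?c w \<odot>\<^bsub>M\<^esub> w) = a j \<odot>\<^bsub>M\<^esub> g j \<oplus>\<^bsub>M\<^esub> (\<Oplus>\<^bsub>M\<^esub>w\<in>g ` J. c w \<odot>\<^bsub>M\<^esub> w)"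
      using False insert.hyps M.finsum_insert[of "g ` J" "g j" "\<lambda>w. ?c w \<odot>\<^bsub>M\<^esub> w"]
      unfolding image_insert by simp
    then show ?thesis
      unfolding L using False cl by (intro bexI[of _ ?c]) auto
  qed
qed auto

lemma finitely_generated_moduleI:
  fixes R :: "('a, 'm) ring_scheme" (structure) and M :: "('a, 'b) module"
  assumes "module R M"
    and "finite J" "g \<in> J \<rightarrow> carrier M"
    and "\<And>m. m \<in> carrier M \<Longrightarrow> \<exists>a\<in>J \<rightarrow> carrier R. m = (\<Oplus>\<^bsub>M\<^esub>j\<in>J. a j \<odot>\<^bsub>M\<^esub> g j)"
  shows "finitely_generated_module R M"
proof -
  interpret module R M by fact
  show ?thesis
    unfolding finitely_generated_module_def
  proof (intro conjI exI[of _ "g ` J"] ballI)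
    fix m assume "m \<in> carrier M"
    with assms(4) obtain a where "a\<in>J \<rightarrow> carrier R" "m = (\<Oplus>\<^bsub>M\<^esub>j\<in>J. a j \<odot>\<^bsub>M\<^esub> g j)" by blast
    then show "\<exists>c\<in>g ` J \<rightarrow> carrier R. m = (\<Oplus>\<^bsub>M\<^esub>v\<in>g ` J. c v \<odot>\<^bsub>M\<^esub> v)"
      using finsum_image_coefficients[OF assms(2,3)] by simp
  qed (use assms in auto)
qed

context cring
begin

lemma free_mod_finitely_generated: "finitely_generated_module R (free_mod R n)"
proof -
  interpret M: module R "free_mod R n" by (rule free_mod_module)
  show ?thesis
  proof (rule finitely_generated_moduleI[OF free_mod_module, of "{..<n}" "free_unit R n"])
    fix v assume v: "v \<in> carrier (free_mod R n)"
    show "\<exists>a\<in>{..<n} \<rightarrow> carrier R.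
        v = (\<Oplus>\<^bsub>free_mod R n\<^esub>j\<in>{..<n}. a j \<odot>\<^bsub>free_mod R n\<^esub> free_unit R n j)"
      using v by (intro bexI[of _ "vec_index v"] free_mod_expansion[OF v]) (auto simp: mem_free_mod)
  qed auto
qed

lemma free_mod_free:
  assumes "\<one> \<noteq> \<zero>"
  shows "free_module R (free_mod R n)"
proof -
  let ?F = "free_mod R n" and ?e = "free_unit R n"
  let ?B = "?e ` {..<n}"
  interpret M: module R ?F by (rule free_mod_module)
  have inj: "inj_on ?e {..<n}"
  proof (rule inj_onI)
    fix i j assume "i \<in> {..<n}" "j \<in> {..<n}" "?e i = ?e j"
    then have "?e i $ i = ?e j $ i" "i < n" by auto
    then show "i = j" using assms by (auto simp: free_unit_def split: if_splits)
  qed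
  have idx: "(\<Oplus>\<^bsub>?F\<^esub>v\<in>{v\<in>?B. c v \<noteq> \<zero>}. c v \<odot>\<^bsub>?F\<^esub> v) = vec n (\<lambda>i. c (?e i))"
    if c: "c \<in> ?B \<rightarrow>\<^sub>E carrier R" for c
  proof -
    have cl: "\<And>j. j < n \<Longrightarrow> c (?e j) \<in> carrier R" using c by auto
    have v: "vec n (\<lambda>i. c (?e i)) \<in> carrier ?F" using cl by (auto simp: mem_free_mod)
    have "(\<Oplus>\<^bsub>?F\<^esub>v\<in>{v\<in>?B. c v \<noteq> \<zero>}. c v \<odot>\<^bsub>?F\<^esub> v) = (\<Oplus>\<^bsub>?F\<^esub>v\<in>?B. c v \<odot>\<^bsub>?F\<^esub> v)"
      using cl by (intro M.add.finprod_mono_neutral_cong_left) auto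
    also have "\<dots> = (\<Oplus>\<^bsub>?F\<^esub>j\<in>{..<n}. c (?e j) \<odot>\<^bsub>?F\<^esub> ?e j)"
      using cl inj by (intro M.finsum_reindex) auto
    also have "\<dots> = vec n (\<lambda>i. c (?e i))"
      by (subst free_mod_expansion[OF v]) (use cl in \<open>auto intro!: M.finsum_cong'\<close>)
    finally show ?thesis .
  qed
  have "is_module_basis R ?F ?B"
    unfolding is_module_basis_def
  proof (intro conjI ballI)
    show "?B \<subseteq> carrier ?F" by auto
    fix v assume v: "v \<in> carrier ?F"
    define c where "c = (\<lambda>w\<in>?B. v $ (the_inv_into {..<n} ?e w))"
    have ce: "c (?e j) = v $ j" if "j < n" for j
      using that inj by (simp add: c_def the_inv_into_f_f)
    show "\<exists>!c. c \<in> ?B \<rightarrow>\<^sub>E carrier R \<and> finite {v\<in>?B. c v \<noteq> \<zero>} \<and>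
      v = (\<Oplus>\<^bsub>?F\<^esub>v\<in>{v\<in>?B. c v \<noteq> \<zero>}. c v \<odot>\<^bsub>?F\<^esub> v)"
    proof (intro ex1I[of _ c] conjI; (elim conjE)?)
      show c: "c \<in> ?B \<rightarrow>\<^sub>E carrier R"
      proof (rule PiE_I)
        fix w assume "w \<in> ?B"
        then show "c w \<in> carrier R" using ce v by (auto simp: mem_free_mod)
      qed (simp add: c_def)
      show "v = (\<Oplus>\<^bsub>?F\<^esub>v\<in>{v\<in>?B. c v \<noteq> \<zero>}. c v \<odot>\<^bsub>?F\<^esub> v)"
        unfolding idx[OF c] using v by (intro eq_vecI) (auto simp: ce mem_free_mod)
      fix c' assume c': "c' \<in> ?B \<rightarrow>\<^sub>E carrier R"
        and "v = (\<Oplus>\<^bsub>?F\<^esub>v\<in>{v\<in>?B. c' v \<noteq> \<zero>}. c' v \<odot>\<^bsub>?F\<^esub> v)"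
      then have "v = vec n (\<lambda>i. c' (?e i))" using idx[OF c'] by simp
      then have "c' (?e j) = c (?e j)" if "j < n" for j using that ce by simp
      then show "c' = c" by (intro PiE_ext[OF c' c]) auto
    qed auto
  qed
  then show ?thesis
    unfolding free_module_def using free_mod_module by blast
qed

end

section \<open>Quotient modules\<close>

lemma (in module) submodule_abelian_subgroup:
  "submodule U R M \<Longrightarrow> abelian_subgroup U M"
  by (intro abelian_subgroupI3 additive_subgroup.intro submodule.axioms(1) M.abelian_group_axioms)

lemma quotient_smult:
  fixes R :: "('a, 'm) ring_scheme" (structure) and M :: "('a, 'b) module"
  assumes "module R M"
    and U: "submodule U R M" and "a \<in> carrier R" "v \<in> carrier M"
  shows "a \<odot>\<^bsub>quotient_module R M U\<^esub> (U +>\<^bsub>M\<^esub> v) = U +>\<^bsub>M\<^esub> (a \<odot>\<^bsub>M\<^esub> v)"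
proof -
  interpret module R M by fact
  interpret U: abelian_subgroup U M by (rule submodule_abelian_subgroup[OF U])
  have "U +>\<^bsub>M\<^esub> (a \<odot>\<^bsub>M\<^esub> w) = U +>\<^bsub>M\<^esub> (a \<odot>\<^bsub>M\<^esub> v)" if w: "w \<in> U +>\<^bsub>M\<^esub> v" for w
  proof -
    from w obtain u where u: "u \<in> U" "w = u \<oplus>\<^bsub>M\<^esub> v" by (auto simp: a_r_coset_def')
    then have "a \<odot>\<^bsub>M\<^esub> w = a \<odot>\<^bsub>M\<^esub> u \<oplus>\<^bsub>M\<^esub> a \<odot>\<^bsub>M\<^esub> v"
      using assms U.a_subset by (auto simp: smult_r_distr)
    moreover have "a \<odot>\<^bsub>M\<^esub> u \<in> U" using submoduleE(4)[OF U] u assms by auto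
    ultimately show ?thesis
      using assms U.a_repr_independence'[of "a \<odot>\<^bsub>M\<^esub> w" "a \<odot>\<^bsub>M\<^esub> v"]
      by (auto simp: a_r_coset_def')
  qed
  moreover have "v \<in> U +>\<^bsub>M\<^esub> v" using assms U.a_rcos_self by auto
  ultimately have "(\<Union>w\<in>U +>\<^bsub>M\<^esub> v. U +>\<^bsub>M\<^esub> (a \<odot>\<^bsub>M\<^esub> w)) = U +>\<^bsub>M\<^esub> (a \<odot>\<^bsub>M\<^esub> v)"
    by (intro SUP_eq_const) blast+
  then show ?thesis by (simp add: quotient_module_def)
qed

lemma quotient_module_module:
  fixes R :: "('a, 'm) ring_scheme" (structure) and M :: "('a, 'b) module"
  assumes "module R M"
    and U: "submodule U R M"
  shows "module R (quotient_module R M U)"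
proof -
  interpret module R M by fact
  let ?Q = "quotient_module R M U"
  interpret U: abelian_subgroup U M by (rule submodule_abelian_subgroup[OF U])
  have car: "C \<in> carrier ?Q \<longleftrightarrow> (\<exists>v\<in>carrier M. C = U +>\<^bsub>M\<^esub> v)" for C
    by (auto simp: quotient_module_def A_RCOSETS_def')
  have add: "(U +>\<^bsub>M\<^esub> v) \<oplus>\<^bsub>?Q\<^esub> (U +>\<^bsub>M\<^esub> w) = U +>\<^bsub>M\<^esub> (v \<oplus>\<^bsub>M\<^esub> w)"
    if "v \<in> carrier M" "w \<in> carrier M" for v w
    using that U.a_rcos_sum by (simp add: quotient_module_def)
  have zero: "\<zero>\<^bsub>?Q\<^esub> = U +>\<^bsub>M\<^esub> \<zero>\<^bsub>M\<^esub>"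
    using U.a_subset by (simp add: quotient_module_def)
  have ab: "abelian_group ?Q"
  proof (rule abelian_groupI)
    fix C assume "C \<in> carrier ?Q"
    then obtain v where v: "v \<in> carrier M" "C = U +>\<^bsub>M\<^esub> v" by (auto simp: car)
    then show "\<exists>C'\<in>carrier ?Q. C' \<oplus>\<^bsub>?Q\<^esub> C = \<zero>\<^bsub>?Q\<^esub>"
      by (intro bexI[of _ "U +>\<^bsub>M\<^esub> (\<ominus>\<^bsub>M\<^esub> v)"]) (auto simp: car add zero M.l_neg)
  qed (force simp: car add zero M.a_ac)+
  show ?thesis
    by (rule moduleI[OF is_cring ab])
      (force simp: car quotient_smult[OF module_axioms U] add smult_l_distr smult_r_distr smult_assoc1)+
qed

lemma coset_map_hom:
  fixes R :: "('a, 'm) ring_scheme" (structure) and M :: "('a, 'b) module"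
  assumes "module R M"
    and U: "submodule U R M"
  shows "(\<lambda>v\<in>carrier M. U +>\<^bsub>M\<^esub> v) \<in> mod_homs R M (quotient_module R M U)"
proof -
  interpret module R M by fact
  interpret U: abelian_subgroup U M by (rule submodule_abelian_subgroup[OF U])
  show ?thesis
    by (auto simp: mod_homs_def quotient_smult[OF module_axioms U] U.a_rcos_sum)
      (auto simp: quotient_module_def A_RCOSETS_def' U.a_rcos_sum)
qed

lemma quotient_module_finitely_generated:
  fixes R :: "('a, 'm) ring_scheme" (structure) and M :: "('a, 'b) module"
  assumes "module R M"
    and U: "submodule U R M"
    and "finite J" and g: "g \<in> J \<rightarrow> carrier M"
    and span: "\<And>m. m \<in> carrier M \<Longrightarrow> \<exists>a\<in>J \<rightarrow> carrier R. m = (\<Oplus>\<^bsub>M\<^esub>j\<in>J. a j \<odot>\<^bsub>M\<^esub> g j)"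
  shows "finitely_generated_module R (quotient_module R M U)"
proof -
  interpret module R M by fact
  let ?Q = "quotient_module R M U" and ?p = "\<lambda>v\<in>carrier M. U +>\<^bsub>M\<^esub> v"
  interpret Q: module R ?Q by (rule quotient_module_module[OF module_axioms U])
  note p = coset_map_hom[OF module_axioms U]
  show ?thesis
  proof (rule finitely_generated_moduleI[OF Q.module_axioms \<open>finite J\<close>, of "\<lambda>j. ?p (g j)"])
    show "(\<lambda>j. ?p (g j)) \<in> J \<rightarrow> carrier ?Q"
      using mod_homs_closed[OF p] g by (auto simp: Pi_iff)
    fix C assume "C \<in> carrier ?Q"
    then obtain m where m: "m \<in> carrier M" "C = ?p m"
      by (auto simp: quotient_module_def A_RCOSETS_def')
    from span[OF m(1)] obtain a where a: "a\<in>J \<rightarrow> carrier R" "m = (\<Oplus>\<^bsub>M\<^esub>j\<in>J. a j \<odot>\<^bsub>M\<^esub> g j)" by auto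
    have "C = (\<Oplus>\<^bsub>?Q\<^esub>j\<in>J. ?p (a j \<odot>\<^bsub>M\<^esub> g j))"
      unfolding m(2) a(2) using a(1) g
      by (intro mod_homs_finsum[OF p module_axioms Q.module_axioms \<open>finite J\<close>]) (auto simp: Pi_iff)
    also have "\<dots> = (\<Oplus>\<^bsub>?Q\<^esub>j\<in>J. a j \<odot>\<^bsub>?Q\<^esub> ?p (g j))"
    proof (rule Q.finsum_cong')
      show "(\<lambda>j. a j \<odot>\<^bsub>?Q\<^esub> ?p (g j)) \<in> J \<rightarrow> carrier ?Q"
        using a(1) g mod_homs_closed[OF p] by (auto simp: Pi_iff)
      fix j assume "j \<in> J"
      then show "?p (a j \<odot>\<^bsub>M\<^esub> g j) = a j \<odot>\<^bsub>?Q\<^esub> ?p (g j)"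
        using a(1) g by (intro mod_homs_smult[OF p]) (auto simp: Pi_iff)
    qed simp
    finally show "\<exists>a\<in>J \<rightarrow> carrier R. C = (\<Oplus>\<^bsub>?Q\<^esub>j\<in>J. a j \<odot>\<^bsub>?Q\<^esub> ?p (g j))" using a(1) by blast
  qed
qed

section \<open>Total acyclicity in terms of matrices\<close>

definition mat_exact :: "('a, 'm) ring_scheme \<Rightarrow> 'a mat \<Rightarrow> 'a mat \<Rightarrow> bool" where
  "mat_exact A D E \<longleftrightarrow> mat_map A E ` carrier (free_mod A (dim_col E)) =
     {v \<in> carrier (free_mod A (dim_col D)). mat_map A D v = \<zero>\<^bsub>free_mod A (dim_row D)\<^esub>}"

text \<open>The restriction to the free module makes the pairing an element of the dual module, whose members
are \<open>undefined\<close> elsewhere.\<close>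

definition functional :: "('a, 'm) ring_scheme \<Rightarrow> nat \<Rightarrow> 'a vec \<Rightarrow> 'a vec \<Rightarrow> 'a" where
  "functional A n w = (\<lambda>v\<in>carrier (free_mod A n). \<Oplus>\<^bsub>A\<^esub>j\<in>{..<n}. w $ j \<otimes>\<^bsub>A\<^esub> v $ j)"

context cring
begin

text \<open>Reading a functional as a matrix with one row reduces its linearity, and its behaviour under
composition with a matrix, to the corresponding facts about matrices.\<close>

lemma functional_row:
  assumes "w \<in> carrier (free_mod R n)" "v \<in> carrier (free_mod R n)"
  shows "mat 1 n (\<lambda>(_, j). w $ j) \<in> mats_over R 1 n"
    and "functional R n w v = mat_map R (mat 1 n (\<lambda>(_, j). w $ j)) v $ 0"
  using assms by (auto simp: functional_def mats_over_iff mem_free_mod mat_map_def intro!: finsum_cong')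

lemma functional_free_unit:
  assumes "w \<in> carrier (free_mod R n)" "j < n"
  shows "functional R n w (free_unit R n j) = w $ j"
proof -
  have "functional R n w (free_unit R n j) = (\<Oplus>i\<in>{..<n}. w $ i \<otimes> (if j = i then \<one> else \<zero>))"
    using assms by (auto simp: functional_def free_unit_def mem_free_mod intro!: finsum_cong')
  also have "\<dots> = w $ j" using assms by (intro finsum_delta) (auto simp: mem_free_mod)
  finally show ?thesis .
qed

lemma functional_inject:
  assumes "w \<in> carrier (free_mod R n)" "w' \<in> carrier (free_mod R n)"
    and "functional R n w = functional R n w'"
  shows "w = w'"
  using assms functional_free_unit[of _ n] by (intro eq_vecI) (auto simp: mem_free_mod, metis)

lemma dual_free_mod_carrier:
  "mod_homs R (free_mod R n) (self_module R) = functional R n ` carrier (free_mod R n)"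
proof (intro equalityI subsetI)
  fix \<phi> assume phi: "\<phi> \<in> mod_homs R (free_mod R n) (self_module R)"
  define w where "w = vec n (\<lambda>j. \<phi> (free_unit R n j))"
  have cl: "\<phi> v \<in> carrier R" if "v \<in> carrier (free_mod R n)" for v
    using mod_homs_closed[OF phi that] by (simp add: self_module_def)
  then have w: "w \<in> carrier (free_mod R n)" by (simp add: w_def mem_free_mod[of "vec _ _"])
  have "\<phi> = functional R n w"
  proof (rule extensionalityI)
    show "\<phi> \<in> extensional (carrier (free_mod R n))"
      using phi by (auto simp: mod_homs_def PiE_def)
    show "functional R n w \<in> extensional (carrier (free_mod R n))" by (simp add: functional_def)
    fix v assume v: "v \<in> carrier (free_mod R n)"
    have sums: "finsum (self_module R) f J = finsum R f J" for f and J :: "nat set"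
      by (simp add: finsum_def finprod_def self_module_def)
    show "\<phi> v = functional R n w v"
      unfolding free_mod_hom_expansion[OF phi self_module_module v] sums
      using v cl[OF free_unit_closed] by (auto simp: functional_def w_def self_module_def
          mem_free_mod[of v] m_comm intro!: finsum_cong' simp del: free_unit_closed)
  qed
  with w show "\<phi> \<in> functional R n ` carrier (free_mod R n)" by blast
next
  fix \<phi> assume "\<phi> \<in> functional R n ` carrier (free_mod R n)"
  then obtain w where w: "w \<in> carrier (free_mod R n)" and phi: "\<phi> = functional R n w" by blast
  let ?D = "mat 1 n (\<lambda>(_, j). w $ j)"
  interpret M: module R "free_mod R n" by (rule free_mod_module)
  note row = functional_row[OF w]
  have D: "?D \<in> mats_over R 1 n" using row(1) M.M.zero_closed by blast
  note h = mat_map_hom[OF D]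
  show "\<phi> \<in> mod_homs R (free_mod R n) (self_module R)"
    unfolding phi mod_homs_def
  proof (intro CollectI conjI ballI)
    show "functional R n w \<in> carrier (free_mod R n) \<rightarrow>\<^sub>E carrier (self_module R)"
      using row(2) mat_map_entry_closed[OF D] by (auto simp: self_module_def) (simp add: functional_def)
  next
    fix u v assume uv: "u \<in> carrier (free_mod R n)" "v \<in> carrier (free_mod R n)"
    then show "functional R n w (u \<oplus>\<^bsub>free_mod R n\<^esub> v)
        = functional R n w u \<oplus>\<^bsub>self_module R\<^esub> functional R n w v"
      unfolding row(2)[OF uv(1)] row(2)[OF uv(2)] row(2)[OF M.M.a_closed[OF uv]] mod_homs_add[OF h uv]
      by (simp add: self_module_def free_mod_ops)
  next
    fix a v assume av: "a \<in> carrier R" "v \<in> carrier (free_mod R n)"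
    then show "functional R n w (a \<odot>\<^bsub>free_mod R n\<^esub> v) = a \<odot>\<^bsub>self_module R\<^esub> functional R n w v"
      unfolding row(2)[OF av(2)] row(2)[OF M.smult_closed[OF av]] mod_homs_smult[OF h av]
      by (simp add: self_module_def free_mod_ops)
  qed
qed

lemma functional_mat_map:
  assumes D: "D \<in> mats_over R m n" and w: "w \<in> carrier (free_mod R m)"
    and v: "v \<in> carrier (free_mod R n)"
  shows "functional R m w (mat_map R D v) = functional R n (mat_map R D\<^sup>T w) v"
proof -
  let ?W = "mat 1 m (\<lambda>(_, j). w $ j)"
  note DT = transpose_mats_over[OF D]
  have Dv: "mat_map R D v \<in> carrier (free_mod R m)" by (rule mat_map_closed[OF D v])
  have Dw: "mat_map R D\<^sup>T w \<in> carrier (free_mod R n)" by (rule mat_map_closed[OF DT w])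
  note W = functional_row(1)[OF w Dv]
  have "mat_mult R ?W D = mat 1 n (\<lambda>(_, j). mat_map R D\<^sup>T w $ j)"
    using D w by (intro eq_matI)
      (auto simp: mat_mult_def mats_over_iff mat_map_index mem_free_mod m_comm intro!: finsum_cong')
  then show ?thesis
    by (simp only: functional_row(2)[OF w Dv] functional_row(2)[OF Dw v] mat_map_mult[OF W D v, symmetric])
qed

lemma free_mod_zero_closed: "\<zero>\<^bsub>free_mod R n\<^esub> \<in> carrier (free_mod R n)"
  by (simp add: mem_free_mod free_mod_ops)

lemma dual_differential_functional:
  assumes D: "D (1 - i) \<in> mats_over R (n (- i)) (n (1 - i))" and w: "w \<in> carrier (free_mod R (n (- i)))"
  shows "dual_differential R (\<lambda>i. free_mod R (n i)) (\<lambda>i. mat_map R (D i)) i (functional R (n (- i)) w)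
    = functional R (n (1 - i)) (mat_map R (D (1 - i))\<^sup>T w)"
proof -
  have "functional R (n (- i)) w \<in> carrier (dual_complex R (\<lambda>i. free_mod R (n i)) i)"
    using w by (simp add: dual_complex_def dual_module_def hom_module_def dual_free_mod_carrier)
  then show ?thesis
    using functional_mat_map[OF D w]
    by (auto simp: dual_differential_def functional_def fun_eq_iff restrict_def)
qed

text \<open>A functional on a free module is the pairing with a unique vector, and composing it with a
  matrix applies the transposed matrix to that vector; so the dual complex is the complex of the
  transposed matrices.\<close>

lemma exact_dual_complex_iff:
  assumes D: "\<And>i. D i \<in> mats_over R (n (i - 1)) (n i)"
  shows "exact_complex (dual_complex R (\<lambda>i. free_mod R (n i)))
      (dual_differential R (\<lambda>i. free_mod R (n i)) (\<lambda>i. mat_map R (D i)))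
    \<longleftrightarrow> (\<forall>j. mat_exact R (D (j + 1))\<^sup>T (D j)\<^sup>T)"
proof -
  let ?F = "\<lambda>i. free_mod R (n i)"
  let ?d = "dual_differential R ?F (\<lambda>i. mat_map R (D i))"
  have D1: "D (j + 1) \<in> mats_over R (n j) (n (j + 1))" for j using D[of "j + 1"] by simp
  have car: "carrier (dual_complex R ?F i) = functional R (n (- i)) ` carrier (?F (- i))" for i
    by (simp add: dual_complex_def dual_module_def hom_module_def dual_free_mod_carrier)
  have zero: "\<zero>\<^bsub>dual_complex R ?F i\<^esub> = functional R (n (- i)) \<zero>\<^bsub>?F (- i)\<^esub>" for i
    by (auto simp: dual_complex_def dual_module_def hom_module_def functional_def free_mod_ops
        self_module_def mem_free_mod fun_eq_iff restrict_def intro!: finsum_zero'[symmetric])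
  have "?d (- j + 1) ` carrier (dual_complex R ?F (- j + 1))
      = {\<phi> \<in> carrier (dual_complex R ?F (- j)). ?d (- j) \<phi> = \<zero>\<^bsub>dual_complex R ?F (- j - 1)\<^esub>}
    \<longleftrightarrow> mat_exact R (D (j + 1))\<^sup>T (D j)\<^sup>T" for j
  proof -
    have dims: "dim_row (D j) = n (j - 1)" "dim_col (D j) = n j"
      "dim_row (D (j + 1)) = n j" "dim_col (D (j + 1)) = n (j + 1)"
      using D[of j] D1[of j] by (auto simp: mats_over_iff)
    have d1: "?d (1 - j) (functional R (n (j - 1)) w) = functional R (n j) (mat_map R (D j)\<^sup>T w)"
      if "w \<in> carrier (?F (j - 1))" for w
      using dual_differential_functional[where D = D and n = n and i = "1 - j" and w = w] D[of j] that
      by simp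
    have d0: "?d (- j) (functional R (n j) w) = functional R (n (j + 1)) (mat_map R (D (j + 1))\<^sup>T w)"
      if "w \<in> carrier (?F j)" for w
      using dual_differential_functional[where D = D and n = n and i = "- j" and w = w] D1[of j] that
      by (simp add: add.commute)
    have cl: "mat_map R (D j)\<^sup>T w \<in> carrier (?F j)" if "w \<in> carrier (?F (j - 1))" for w
      using mat_map_closed[OF transpose_mats_over[OF D[of j]] that] .
    have cl1: "mat_map R (D (j + 1))\<^sup>T w \<in> carrier (?F (j + 1))" if "w \<in> carrier (?F j)" for w
      using mat_map_closed[OF transpose_mats_over[OF D1[of j]] that] .
    have inj: "inj_on (functional R (n j)) (carrier (?F j))"
      by (intro inj_onI functional_inject)
    have 1: "?d (- j + 1) ` carrier (dual_complex R ?F (- j + 1))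
      = functional R (n j) ` (mat_map R (D j)\<^sup>T ` carrier (?F (j - 1)))"
      unfolding car by (simp add: image_image d1 cong: image_cong)
    have "{\<phi> \<in> carrier (dual_complex R ?F (- j)). ?d (- j) \<phi> = \<zero>\<^bsub>dual_complex R ?F (- j - 1)\<^esub>}
      = functional R (n j) ` {w \<in> carrier (?F j).
          functional R (n (j + 1)) (mat_map R (D (j + 1))\<^sup>T w) = functional R (n (j + 1)) \<zero>\<^bsub>?F (j + 1)\<^esub>}"
      unfolding car zero by (auto simp: d0 add.commute)
    also have "\<dots> = functional R (n j) ` {w \<in> carrier (?F j). mat_map R (D (j + 1))\<^sup>T w = \<zero>\<^bsub>?F (j + 1)\<^esub>}"
      using functional_inject[OF cl1 free_mod_zero_closed] by (intro arg_cong2[where f = image]) auto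
    finally have 2: "{\<phi> \<in> carrier (dual_complex R ?F (- j)). ?d (- j) \<phi> = \<zero>\<^bsub>dual_complex R ?F (- j - 1)\<^esub>}
      = functional R (n j) ` {w \<in> carrier (?F j). mat_map R (D (j + 1))\<^sup>T w = \<zero>\<^bsub>?F (j + 1)\<^esub>}" .
    show ?thesis
      unfolding 1 2 mat_exact_def using dims cl inj
      by (subst inj_on_image_eq_iff[OF inj]) auto
  qed
  note eq = this
  show ?thesis
    unfolding exact_complex_def
  proof (intro iffI allI)
    fix j assume "\<forall>i. ?d (i + 1) ` carrier (dual_complex R ?F (i + 1)) =
      {v \<in> carrier (dual_complex R ?F i). ?d i v = \<zero>\<^bsub>dual_complex R ?F (i - 1)\<^esub>}"
    then show "mat_exact R (D (j + 1))\<^sup>T (D j)\<^sup>T" using eq[of j] by blast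
  next
    fix i assume "\<forall>j. mat_exact R (D (j + 1))\<^sup>T (D j)\<^sup>T"
    then have "mat_exact R (D (- i + 1))\<^sup>T (D (- i))\<^sup>T" by blast
    then show "?d (i + 1) ` carrier (dual_complex R ?F (i + 1)) =
      {v \<in> carrier (dual_complex R ?F i). ?d i v = \<zero>\<^bsub>dual_complex R ?F (i - 1)\<^esub>}"
      using eq[of "- i"] by simp
  qed
qed

lemma exact_complex_free_mod_iff:
  assumes D: "\<And>i. D i \<in> mats_over R (n (i - 1)) (n i)"
  shows "exact_complex (\<lambda>i. free_mod R (n i)) (\<lambda>i. mat_map R (D i))
    \<longleftrightarrow> (\<forall>j. mat_exact R (D j) (D (j + 1)))"
proof -
  have "dim_row (D j) = n (j - 1)" "dim_col (D j) = n j" for j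
    using D[of j] by (auto simp: mats_over_iff)
  then show ?thesis by (simp add: exact_complex_def mat_exact_def)
qed

lemma totally_acyclic_free_modI:
  assumes "\<one> \<noteq> \<zero>" and D: "\<And>i. D i \<in> mats_over R (n (i - 1)) (n i)"
    and "\<And>j. mat_exact R (D j) (D (j + 1))" "\<And>j. mat_exact R (D (j + 1))\<^sup>T (D j)\<^sup>T"
  shows "totally_acyclic R (\<lambda>i. free_mod R (n i)) (\<lambda>i. mat_map R (D i))"
  using assms mat_map_hom[of "D _", OF D] free_mod_finitely_generated free_mod_free
  by (simp add: totally_acyclic_def exact_dual_complex_iff[where D = D and n = n, OF D] exact_complex_free_mod_iff[where D = D and n = n, OF D])

lemma totally_acyclic_free_modD:
  assumes "totally_acyclic R (\<lambda>i. free_mod R (n i)) (\<lambda>i. mat_map R (D i))"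
    and D: "\<And>i. D i \<in> mats_over R (n (i - 1)) (n i)"
  shows "mat_exact R (D j) (D (j + 1))" "mat_exact R (D (j + 1))\<^sup>T (D j)\<^sup>T"
  using assms
  by (simp_all add: totally_acyclic_def exact_dual_complex_iff[where D = D and n = n, OF D] exact_complex_free_mod_iff[where D = D and n = n, OF D])

end

section \<open>Exactness of the block matrices\<close>

lemma free_mod_add_cases:
  assumes "y \<in> carrier (free_mod A (m + n))"
  obtains u v where "y = u @\<^sub>v v" "u \<in> carrier (free_mod A m)" "v \<in> carrier (free_mod A n)"
proof
  show "y = vec_first y m @\<^sub>v vec_last y n"
    using assms by (intro vec_first_last_append[symmetric] carrier_vecI) (simp add: mem_free_mod)
  show "vec_first y m \<in> carrier (free_mod A m)" "vec_last y n \<in> carrier (free_mod A n)"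
    using assms by (simp_all add: mem_free_mod vec_first_def vec_last_def)
qed

lemma eq_vec_function_iff: "dim_vec u = n \<Longrightarrow> u = vec n f \<longleftrightarrow> (\<forall>i<n. u $ i = f i)"
  by (auto simp: vec_eq_iff)

lemma free_mod_append_closed:
  "\<lbrakk> u \<in> carrier (free_mod A m); v \<in> carrier (free_mod A n) \<rbrakk> \<Longrightarrow>
    u @\<^sub>v v \<in> carrier (free_mod A (m + n))"
  by (auto simp: mem_free_mod)

context cring
begin

lemma finsum_lessThan_add:
  fixes m n :: nat
  assumes "f \<in> {..<m + n} \<rightarrow> carrier R"
  shows "(\<Oplus>j\<in>{..<m + n}. f j) = (\<Oplus>j\<in>{..<m}. f j) \<oplus> (\<Oplus>j\<in>{..<n}. f (m + j))"
  using assms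
proof (induction n)
  case 0
  have "(\<Oplus>j\<in>{..<m}. f j) \<in> carrier R" using 0 by (intro finsum_closed) auto
  then show ?case by simp
next
  case (Suc n)
  have cl: "\<And>j. j < m + Suc n \<Longrightarrow> f j \<in> carrier R" using Suc.prems by auto
  have 1: "(\<Oplus>j\<in>{..<m + Suc n}. f j) = f (m + n) \<oplus> (\<Oplus>j\<in>{..<m + n}. f j)"
    using cl by (simp add: lessThan_Suc Pi_iff)
  have 2: "(\<Oplus>j\<in>{..<Suc n}. f (m + j)) = f (m + n) \<oplus> (\<Oplus>j\<in>{..<n}. f (m + j))"
    using cl by (simp add: lessThan_Suc Pi_iff)
  have "(\<Oplus>j\<in>{..<m}. f j) \<in> carrier R" "(\<Oplus>j\<in>{..<n}. f (m + j)) \<in> carrier R" "f (m + n) \<in> carrier R"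
    using cl by (auto intro!: finsum_closed)
  moreover have "f \<in> {..<m + n} \<rightarrow> carrier R" using cl by auto
  ultimately show ?case unfolding 1 2 Suc.IH[OF \<open>f \<in> {..<m + n} \<rightarrow> carrier R\<close>] by (simp add: a_ac)
qed

lemma four_block_mats_over:
  assumes "A \<in> mats_over R r1 c1" "B \<in> mats_over R r1 c2" "C \<in> mats_over R r2 c1" "D \<in> mats_over R r2 c2"
  shows "four_block_mat A B C D \<in> mats_over R (r1 + r2) (c1 + c2)"
  using assms by (auto simp: mats_over_iff)

lemma mat_map_four_block:
  assumes "A \<in> mats_over R r1 c1" "B \<in> mats_over R r1 c2" "C \<in> mats_over R r2 c1" "D \<in> mats_over R r2 c2"
    and u: "u \<in> carrier (free_mod R c1)" and v: "v \<in> carrier (free_mod R c2)"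
  shows "mat_map R (four_block_mat A B C D) (u @\<^sub>v v) =
    vec r1 (\<lambda>i. mat_map R A u $ i \<oplus> mat_map R B v $ i) @\<^sub>v
    vec r2 (\<lambda>i. mat_map R C u $ i \<oplus> mat_map R D v $ i)"
proof (rule eq_vecI)
  let ?K = "four_block_mat A B C D"
  note K = four_block_mats_over[OF assms(1-4)]
  have dims: "dim_row A = r1" "dim_col A = c1" "dim_row B = r1" "dim_col B = c2"
    "dim_row C = r2" "dim_col C = c1" "dim_row D = r2" "dim_col D = c2"
    using assms by (auto simp: mats_over_iff)
  note uv = free_mod_append_closed[OF u v]
  show "dim_vec (mat_map R ?K (u @\<^sub>v v)) = dim_vec (vec r1 (\<lambda>i. mat_map R A u $ i \<oplus> mat_map R B v $ i) @\<^sub>v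
    vec r2 (\<lambda>i. mat_map R C u $ i \<oplus> mat_map R D v $ i))"
    using mat_map_closed[OF K uv] by (simp add: mem_free_mod)
  fix i assume "i < dim_vec (vec r1 (\<lambda>i. mat_map R A u $ i \<oplus> mat_map R B v $ i) @\<^sub>v
    vec r2 (\<lambda>i. mat_map R C u $ i \<oplus> mat_map R D v $ i))"
  then have i: "i < r1 + r2" by simp
  have cl: "\<And>j. j < c1 + c2 \<Longrightarrow> ?K $$ (i, j) \<in> carrier R" "\<And>j. j < c1 + c2 \<Longrightarrow> (u @\<^sub>v v) $ j \<in> carrier R"
    using K uv i unfolding mats_over_iff mem_free_mod by blast+
  have du: "dim_vec u = c1" "dim_vec v = c2" using u v by (auto simp: mem_free_mod)
  have "mat_map R ?K (u @\<^sub>v v) $ i = (\<Oplus>j\<in>{..<c1 + c2}. ?K $$ (i, j) \<otimes> (u @\<^sub>v v) $ j)"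
    using uv dims i by (subst mat_map_index) auto
  also have "\<dots> = (\<Oplus>j\<in>{..<c1}. ?K $$ (i, j) \<otimes> (u @\<^sub>v v) $ j)
      \<oplus> (\<Oplus>j\<in>{..<c2}. ?K $$ (i, c1 + j) \<otimes> (u @\<^sub>v v) $ (c1 + j))"
    using cl by (intro finsum_lessThan_add) auto
  also have "(\<Oplus>j\<in>{..<c1}. ?K $$ (i, j) \<otimes> (u @\<^sub>v v) $ j)
      = (\<Oplus>j\<in>{..<c1}. (if i < r1 then A $$ (i, j) else C $$ (i - r1, j)) \<otimes> u $ j)"
    using i dims du assms by (intro finsum_cong') (auto simp: mats_over_iff mem_free_mod)
  also have "(\<Oplus>j\<in>{..<c2}. ?K $$ (i, c1 + j) \<otimes> (u @\<^sub>v v) $ (c1 + j))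
      = (\<Oplus>j\<in>{..<c2}. (if i < r1 then B $$ (i, j) else D $$ (i - r1, j)) \<otimes> v $ j)"
    using i dims du assms by (intro finsum_cong') (auto simp: mats_over_iff mem_free_mod)
  finally show "mat_map R ?K (u @\<^sub>v v) $ i = (vec r1 (\<lambda>i. mat_map R A u $ i \<oplus> mat_map R B v $ i) @\<^sub>v
    vec r2 (\<lambda>i. mat_map R C u $ i \<oplus> mat_map R D v $ i)) $ i"
    using i dims u v by (auto simp: mat_map_index)
qed

lemma mat_exact_four_block_iff:
  assumes K: "A \<in> mats_over R r1 c1" "B \<in> mats_over R r1 c2" "C \<in> mats_over R r2 c1" "D \<in> mats_over R r2 c2"
    and K': "A' \<in> mats_over R c1 p1" "B' \<in> mats_over R c1 p2" "C' \<in> mats_over R c2 p1" "D' \<in> mats_over R c2 p2"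
  shows "mat_exact R (four_block_mat A B C D) (four_block_mat A' B' C' D') \<longleftrightarrow>
    (\<forall>u\<in>carrier (free_mod R c1). \<forall>v\<in>carrier (free_mod R c2).
      (\<exists>w\<in>carrier (free_mod R p1). \<exists>z\<in>carrier (free_mod R p2).
        (\<forall>i<c1. u $ i = mat_map R A' w $ i \<oplus> mat_map R B' z $ i) \<and>
        (\<forall>i<c2. v $ i = mat_map R C' w $ i \<oplus> mat_map R D' z $ i)) \<longleftrightarrow>
      (\<forall>i<r1. mat_map R A u $ i \<oplus> mat_map R B v $ i = \<zero>) \<and>
      (\<forall>i<r2. mat_map R C u $ i \<oplus> mat_map R D v $ i = \<zero>))"
    (is "_ = (\<forall>u\<in>?U. \<forall>v\<in>?V. ?im u v \<longleftrightarrow> ?ker u v)")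
proof -
  let ?K = "four_block_mat A B C D" and ?K' = "four_block_mat A' B' C' D'"
  have mK: "?K \<in> mats_over R (r1 + r2) (c1 + c2)" and mK': "?K' \<in> mats_over R (c1 + c2) (p1 + p2)"
    using four_block_mats_over[OF K] four_block_mats_over[OF K'] .
  let ?Z = "carrier (free_mod R (c1 + c2))"
  have im: "u @\<^sub>v v \<in> mat_map R ?K' ` carrier (free_mod R (p1 + p2)) \<longleftrightarrow> ?im u v"
    if uv: "u \<in> ?U" "v \<in> ?V" for u v
  proof -
    have dims: "dim_vec u = c1" "dim_vec v = c2" using uv unfolding mem_free_mod by blast+
    have split: "u @\<^sub>v v = mat_map R ?K' (w @\<^sub>v z) \<longleftrightarrow>
        (\<forall>i<c1. u $ i = mat_map R A' w $ i \<oplus> mat_map R B' z $ i) \<and>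
        (\<forall>i<c2. v $ i = mat_map R C' w $ i \<oplus> mat_map R D' z $ i)"
      if "w \<in> carrier (free_mod R p1)" "z \<in> carrier (free_mod R p2)" for w z
      unfolding mat_map_four_block[OF K' that] append_vec_eq[OF carrier_vecI[OF dims(1)] vec_carrier]
        eq_vec_function_iff[OF dims(1)] eq_vec_function_iff[OF dims(2)] by (rule refl)
    show ?thesis
    proof
      assume "u @\<^sub>v v \<in> mat_map R ?K' ` carrier (free_mod R (p1 + p2))"
      then obtain y where y: "y \<in> carrier (free_mod R (p1 + p2))" "u @\<^sub>v v = mat_map R ?K' y" by blast
      then obtain w z where "y = w @\<^sub>v z" "w \<in> carrier (free_mod R p1)" "z \<in> carrier (free_mod R p2)"
        using free_mod_add_cases by blast
      then show "?im u v" using split y(2) by blast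
    next
      assume "?im u v"
      then obtain w z where "w \<in> carrier (free_mod R p1)" "z \<in> carrier (free_mod R p2)"
        "u @\<^sub>v v = mat_map R ?K' (w @\<^sub>v z)" using split by blast
      then show "u @\<^sub>v v \<in> mat_map R ?K' ` carrier (free_mod R (p1 + p2))"
        using free_mod_append_closed by blast
    qed
  qed
  have zero: "\<zero>\<^bsub>free_mod R (r1 + r2)\<^esub> = vec r1 (\<lambda>i. \<zero>) @\<^sub>v vec r2 (\<lambda>i. \<zero>)"
    by (auto simp: free_mod_ops)
  have ker: "mat_map R ?K (u @\<^sub>v v) = \<zero>\<^bsub>free_mod R (r1 + r2)\<^esub> \<longleftrightarrow> ?ker u v"
    if uv: "u \<in> ?U" "v \<in> ?V" for u v
    unfolding mat_map_four_block[OF K uv] zero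
    by (subst append_vec_eq[of _ r1]) (auto simp: vec_eq_iff)
  have dims: "dim_row ?K = r1 + r2" "dim_col ?K = c1 + c2" "dim_col ?K' = p1 + p2"
    using mK mK' by (auto simp only: mats_over_iff)
  have set_eq: "I = {y \<in> Z. P y} \<longleftrightarrow> (\<forall>y\<in>Z. y \<in> I \<longleftrightarrow> P y)" if "I \<subseteq> Z"
    for I Z :: "'a vec set" and P using that by blast
  have "mat_exact R ?K ?K' \<longleftrightarrow> (\<forall>y\<in>?Z. y \<in> mat_map R ?K' ` carrier (free_mod R (p1 + p2)) \<longleftrightarrow>
      mat_map R ?K y = \<zero>\<^bsub>free_mod R (r1 + r2)\<^esub>)"
    unfolding mat_exact_def dims by (rule set_eq[OF image_subsetI[OF mat_map_closed[OF mK']]])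
  also have "\<dots> \<longleftrightarrow> (\<forall>u\<in>?U. \<forall>v\<in>?V. ?im u v \<longleftrightarrow> ?ker u v)" (is "?l = ?r")
  proof
    assume l: ?l
    show ?r
    proof (intro ballI)
      fix u v assume uv: "u \<in> ?U" "v \<in> ?V"
      show "?im u v \<longleftrightarrow> ?ker u v"
        using bspec[OF l free_mod_append_closed[OF uv]] unfolding im[OF uv] ker[OF uv] .
    qed
  next
    assume r: ?r
    show ?l
    proof
      fix y assume "y \<in> ?Z"
      then obtain u v where y: "y = u @\<^sub>v v" and uv: "u \<in> ?U" "v \<in> ?V" by (rule free_mod_add_cases)
      then show "y \<in> mat_map R ?K' ` carrier (free_mod R (p1 + p2)) \<longleftrightarrow>
          mat_map R ?K y = \<zero>\<^bsub>free_mod R (r1 + r2)\<^esub>"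
        unfolding y im[OF uv] ker[OF uv] using r uv by (elim ballE) blast+
    qed
  qed
  finally show ?thesis .
qed

lemma mat_smult_mats_over:
  "\<lbrakk> a \<in> carrier R; D \<in> mats_over R m n \<rbrakk> \<Longrightarrow> mat_smult R a D \<in> mats_over R m n"
  by (auto simp: mats_over_iff mat_smult_def)

lemma mat_id_mats_over: "mat_id R n \<in> mats_over R n n"
  by (auto simp: mats_over_iff mat_id_def)

lemma mat_map_id:
  assumes "v \<in> carrier (free_mod R n)"
  shows "mat_map R (mat_id R n) v = v"
proof (rule eq_vecI)
  fix i assume "i < dim_vec v"
  then have i: "i < n" using assms by (simp add: mem_free_mod)
  have "mat_map R (mat_id R n) v $ i = (\<Oplus>j\<in>{..<n}. v $ j \<otimes> (if i = j then \<one> else \<zero>))"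
    using i assms by (subst mat_map_index) (auto simp: mat_id_def mem_free_mod intro!: finsum_cong')
  also have "\<dots> = v $ i" using i assms by (intro finsum_delta) (auto simp: mem_free_mod)
  finally show "mat_map R (mat_id R n) v $ i = v $ i" .
qed (use assms in \<open>simp add: mat_id_def mat_map_def mem_free_mod\<close>)

lemma mat_map_scalar:
  assumes "v \<in> carrier (free_mod R n)" "a \<in> carrier R" "i < n"
  shows "mat_map R (mat_smult R a (mat_id R n)) v $ i = a \<otimes> v $ i"
  using mat_map_smult[OF mat_id_mats_over assms] mat_map_id[OF assms(1)] by simp

lemma transpose_mat_id: "(mat_id R n)\<^sup>T = mat_id R n"
  by (rule eq_matI) (auto simp: mat_id_def)

lemma transpose_mat_smult: "(mat_smult R a D)\<^sup>T = mat_smult R a D\<^sup>T"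
  by (rule eq_matI) (auto simp: mat_smult_def)

text \<open>Exactness of the reductions of \<open>D\<close> and \<open>E\<close> modulo \<open>x\<close> at their common free module, spelled out
in the ring itself. Only the inclusion of the kernel in the image is recorded: that the composite
vanishes modulo \<open>x\<close> will always come from an explicit factorization through \<open>x\<close>.\<close>

definition exact_modulo :: "'a \<Rightarrow> 'a mat \<Rightarrow> 'a mat \<Rightarrow> bool" where
  "exact_modulo x D E \<longleftrightarrow>
    (\<forall>u\<in>carrier (free_mod R (dim_col D)).
      (\<forall>l<dim_row D. \<exists>s\<in>carrier R. mat_map R D u $ l = x \<otimes> s) \<longrightarrow>
      (\<exists>w\<in>carrier (free_mod R (dim_col E)). \<exists>t\<in>carrier (free_mod R (dim_row E)).
        \<forall>j<dim_row E. u $ j = mat_map R E w $ j \<oplus> x \<otimes> t $ j))"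

text \<open>The heart of the exactness proof, with \<open>\<zeta>\<close> standing for the sign \<open>1\<close> or \<open>-1\<close>. If \<open>(u, v)\<close> is in
the kernel, the first equation says that \<open>D u\<close> is a multiple of \<open>x\<close>, so exactness modulo \<open>x\<close> gives
\<open>u = D' w + x t\<close>. Then \<open>D u = x (N' w + D t)\<close>, and cancelling \<open>x\<close> in the first equation determines
\<open>v\<close>; it is exactly the second component of the image of \<open>(w, -\<zeta> t)\<close>. In the other direction
the only point is
\<open>N D' = E N'\<close>, which holds because \<open>x\<close> times either side is \<open>E D D'\<close>.\<close>

lemma block_kernel_eq_image:
  assumes x: "x \<in> carrier R" and nzd: "\<And>s. \<lbrakk> s \<in> carrier R; x \<otimes> s = \<zero> \<rbrakk> \<Longrightarrow> s = \<zero>"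
    and sg: "\<zeta> \<in> carrier R" "\<zeta> \<otimes> \<zeta> = \<one>"
    and D: "D \<in> mats_over R b0 b1" and E: "E \<in> mats_over R c b0" and N: "N \<in> mats_over R c b1"
    and D': "D' \<in> mats_over R b1 b2" and N': "N' \<in> mats_over R b0 b2"
    and DD': "mat_mult R D D' = mat_smult R x N'" and ED: "mat_mult R E D = mat_smult R x N"
    and ex: "exact_modulo x D D'"
    and u: "u \<in> carrier (free_mod R b1)" and v: "v \<in> carrier (free_mod R b0)"
  shows "(\<exists>w\<in>carrier (free_mod R b2). \<exists>z\<in>carrier (free_mod R b1).
        (\<forall>j<b1. u $ j = mat_map R D' w $ j \<oplus> \<ominus> \<zeta> \<otimes> x \<otimes> z $ j) \<and>
        (\<forall>l<b0. v $ l = \<ominus> \<zeta> \<otimes> mat_map R N' w $ l \<oplus> mat_map R D z $ l)) \<longleftrightarrow>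
      (\<forall>l<b0. mat_map R D u $ l \<oplus> \<zeta> \<otimes> x \<otimes> v $ l = \<zero>) \<and>
      (\<forall>l<c. \<zeta> \<otimes> mat_map R N u $ l \<oplus> mat_map R E v $ l = \<zero>)"
proof -
  have DD'w: "mat_map R D (mat_map R D' w) $ l = x \<otimes> mat_map R N' w $ l"
    if "w \<in> carrier (free_mod R b2)" "l < b0" for w l
    using mat_map_mult[OF D D' that(1)] mat_map_smult[OF N' that(1) x that(2)] DD' by simp
  have EDw: "mat_map R E (mat_map R D w) $ l = x \<otimes> mat_map R N w $ l"
    if "w \<in> carrier (free_mod R b1)" "l < c" for w l
    using mat_map_mult[OF E D that(1)] mat_map_smult[OF N that(1) x that(2)] ED by simp
  have ms: "\<ominus> \<zeta> \<in> carrier R" "\<ominus> \<zeta> \<otimes> x \<in> carrier R" using sg x by auto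
  have ss: "\<zeta> \<otimes> (\<zeta> \<otimes> y) = y" if "y \<in> carrier R" for y
    using that sg by (simp add: m_assoc[symmetric])
  have entry: "\<And>j. j < b1 \<Longrightarrow> u $ j \<in> carrier R" "\<And>l. l < b0 \<Longrightarrow> v $ l \<in> carrier R"
    using u v by (auto simp: mem_free_mod)
  show ?thesis
  proof (intro iffI conjI allI impI; (elim bexE conjE)?)
    fix w z l
    assume w: "w \<in> carrier (free_mod R b2)" and z: "z \<in> carrier (free_mod R b1)"
      and uj: "\<forall>j<b1. u $ j = mat_map R D' w $ j \<oplus> \<ominus> \<zeta> \<otimes> x \<otimes> z $ j"
      and vl: "\<forall>l<b0. v $ l = \<ominus> \<zeta> \<otimes> mat_map R N' w $ l \<oplus> mat_map R D z $ l"
    have D'w: "mat_map R D' w \<in> carrier (free_mod R b1)" by (rule mat_map_closed[OF D' w])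
    have u_eq: "u = vec b1 (\<lambda>j. mat_map R D' w $ j \<oplus> \<ominus> \<zeta> \<otimes> x \<otimes> z $ j)"
      using uj u by (intro eq_vecI) (auto simp: mem_free_mod)
    assume l: "l < b0"
    have "mat_map R D u $ l = x \<otimes> mat_map R N' w $ l \<oplus> \<ominus> \<zeta> \<otimes> x \<otimes> mat_map R D z $ l"
      unfolding u_eq mat_map_lincomb[OF D D'w z ms(2) l] DD'w[OF w l] ..
    then show "mat_map R D u $ l \<oplus> \<zeta> \<otimes> x \<otimes> v $ l = \<zero>"
      using vl l mat_map_entry_closed[OF N' w l] mat_map_entry_closed[OF D z l] sg x
      by (simp add: r_distr l_minus r_minus m_ac ss) (simp add: a_ac r_neg r_neg1 r_neg2)
  next
    fix w z l
    assume w: "w \<in> carrier (free_mod R b2)" and z: "z \<in> carrier (free_mod R b1)"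
      and uj: "\<forall>j<b1. u $ j = mat_map R D' w $ j \<oplus> \<ominus> \<zeta> \<otimes> x \<otimes> z $ j"
      and vl: "\<forall>l<b0. v $ l = \<ominus> \<zeta> \<otimes> mat_map R N' w $ l \<oplus> mat_map R D z $ l"
    have D'w: "mat_map R D' w \<in> carrier (free_mod R b1)" by (rule mat_map_closed[OF D' w])
    have N'w: "mat_map R N' w \<in> carrier (free_mod R b0)" by (rule mat_map_closed[OF N' w])
    have Dz: "mat_map R D z \<in> carrier (free_mod R b0)" by (rule mat_map_closed[OF D z])
    have u_eq: "u = vec b1 (\<lambda>j. mat_map R D' w $ j \<oplus> \<ominus> \<zeta> \<otimes> x \<otimes> z $ j)"
      using uj u by (intro eq_vecI) (auto simp: mem_free_mod)
    have v_eq: "v = vec b0 (\<lambda>l. mat_map R D z $ l \<oplus> \<ominus> \<zeta> \<otimes> mat_map R N' w $ l)"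
      using vl v ms mat_map_entry_closed[OF N' w] mat_map_entry_closed[OF D z]
      by (intro eq_vecI) (auto simp: mem_free_mod a_comm)
    assume l: "l < c"
    let ?p = "mat_map R N (mat_map R D' w) $ l" and ?q = "mat_map R E (mat_map R N' w) $ l"
      and ?r = "mat_map R N z $ l"
    have cl: "?p \<in> carrier R" "?q \<in> carrier R" "?r \<in> carrier R"
      using mat_map_entry_closed[OF N D'w l] mat_map_entry_closed[OF E N'w l] mat_map_entry_closed[OF N z l] .
    \<comment> \<open>Both \<open>x N D' w\<close> and \<open>x E N' w\<close> are \<open>E D D' w\<close>.\<close>
    have "mat_map R D (mat_map R D' w) = vec b0 (\<lambda>l. x \<otimes> mat_map R N' w $ l)"
      using mat_map_closed[OF D D'w] DD'w[OF w] by (intro eq_vecI) (auto simp: mem_free_mod)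
    then have "x \<otimes> ?p = x \<otimes> ?q"
      using EDw[OF D'w l] mat_map_scale[OF E N'w x l] by simp
    then have "x \<otimes> (?p \<ominus> ?q) = \<zero>" using cl x by (simp add: minus_eq r_distr r_minus r_neg)
    then have "?p \<ominus> ?q = \<zero>" using nzd minus_closed[OF cl(1,2)] by blast
    then have pq: "?p = ?q" using cl by simp
    have "mat_map R N u $ l = ?q \<oplus> \<ominus> \<zeta> \<otimes> x \<otimes> ?r"
      unfolding u_eq mat_map_lincomb[OF N D'w z ms(2) l] pq ..
    moreover have "mat_map R E v $ l = x \<otimes> ?r \<oplus> \<ominus> \<zeta> \<otimes> ?q"
      unfolding v_eq mat_map_lincomb[OF E Dz N'w ms(1) l] EDw[OF z l] ..
    ultimately show "\<zeta> \<otimes> mat_map R N u $ l \<oplus> mat_map R E v $ l = \<zero>"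
      using cl sg x by (simp add: r_distr l_minus r_minus m_ac ss) (simp add: a_ac r_neg r_neg1 r_neg2)
  next
    assume ker: "\<forall>l<b0. mat_map R D u $ l \<oplus> \<zeta> \<otimes> x \<otimes> v $ l = \<zero>"
    have "\<exists>s\<in>carrier R. mat_map R D u $ l = x \<otimes> s" if l: "l < b0" for l
    proof (rule bexI[of _ "\<ominus> \<zeta> \<otimes> v $ l"])
      have "mat_map R D u $ l = \<ominus> (\<zeta> \<otimes> x \<otimes> v $ l)"
        using ker l mat_map_entry_closed[OF D u l] entry sg x by (intro minus_equality[symmetric]) auto
      then show "mat_map R D u $ l = x \<otimes> (\<ominus> \<zeta> \<otimes> v $ l)"
        using entry l sg x by (simp add: l_minus r_minus m_ac)
    qed (use entry l ms in auto)
    then obtain w t where w: "w \<in> carrier (free_mod R b2)" and t: "t \<in> carrier (free_mod R b1)"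
      and uj: "\<And>j. j < b1 \<Longrightarrow> u $ j = mat_map R D' w $ j \<oplus> x \<otimes> t $ j"
      using ex u D D' unfolding exact_modulo_def mats_over_iff by metis
    have D'w: "mat_map R D' w \<in> carrier (free_mod R b1)" by (rule mat_map_closed[OF D' w])
    have u_eq: "u = vec b1 (\<lambda>j. mat_map R D' w $ j \<oplus> x \<otimes> t $ j)"
      using uj u by (intro eq_vecI) (auto simp: mem_free_mod)
    have tj: "t $ j \<in> carrier R" if "j < b1" for j using t that by (simp add: mem_free_mod)
    \<comment> \<open>The sign is its own inverse, so that \<open>x t = - \<zeta> x z\<close>.\<close>
    define z where "z = vec b1 (\<lambda>j. \<ominus> \<zeta> \<otimes> t $ j)"
    have z: "z \<in> carrier (free_mod R b1)" using tj ms by (auto simp: z_def mem_free_mod)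
    show "\<exists>w\<in>carrier (free_mod R b2). \<exists>z\<in>carrier (free_mod R b1).
        (\<forall>j<b1. u $ j = mat_map R D' w $ j \<oplus> \<ominus> \<zeta> \<otimes> x \<otimes> z $ j) \<and>
        (\<forall>l<b0. v $ l = \<ominus> \<zeta> \<otimes> mat_map R N' w $ l \<oplus> mat_map R D z $ l)"
    proof (intro bexI[OF _ w] bexI[OF _ z] conjI allI impI)
      fix j assume "j < b1"
      then show "u $ j = mat_map R D' w $ j \<oplus> \<ominus> \<zeta> \<otimes> x \<otimes> z $ j"
        using uj tj sg x by (simp add: z_def l_minus r_minus m_ac ss)
    next
      fix l assume l: "l < b0"
      let ?n = "mat_map R N' w $ l" and ?d = "mat_map R D t $ l"
      have cl: "?n \<in> carrier R" "?d \<in> carrier R" "v $ l \<in> carrier R"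
        using mat_map_entry_closed[OF N' w l] mat_map_entry_closed[OF D t l] entry l by auto
      have "mat_map R D u $ l = x \<otimes> ?n \<oplus> x \<otimes> ?d"
        unfolding u_eq mat_map_lincomb[OF D D'w t x l] DD'w[OF w l] ..
      then have "x \<otimes> ?n \<oplus> x \<otimes> ?d \<oplus> \<zeta> \<otimes> x \<otimes> v $ l = \<zero>" using ker l by metis
      then have "x \<otimes> (?n \<oplus> ?d \<oplus> \<zeta> \<otimes> v $ l) = \<zero>"
        using cl sg x by (simp add: r_distr m_ac a_ac)
      then have "\<zeta> \<otimes> v $ l \<oplus> (?n \<oplus> ?d) = \<zero>"
        using nzd[of "?n \<oplus> ?d \<oplus> \<zeta> \<otimes> v $ l"] cl sg by (simp add: a_comm)
      then have "\<zeta> \<otimes> v $ l = \<ominus> (?n \<oplus> ?d)"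
        using cl sg by (intro minus_equality[symmetric]) auto
      then have "\<zeta> \<otimes> (\<zeta> \<otimes> v $ l) = \<zeta> \<otimes> \<ominus> (?n \<oplus> ?d)" by simp
      then have "v $ l = \<ominus> \<zeta> \<otimes> ?n \<oplus> \<ominus> \<zeta> \<otimes> ?d"
        using cl sg by (simp add: ss r_distr r_minus l_minus minus_add)
      then show "v $ l = \<ominus> \<zeta> \<otimes> ?n \<oplus> mat_map R D z $ l"
        unfolding z_def mat_map_scale[OF D t ms(1) l] .
    qed
  qed
qed

text \<open>The differentials for even and for odd index, unified by a sign parameter.\<close>

definition block :: "'a \<Rightarrow> 'a \<Rightarrow> 'a mat \<Rightarrow> 'a mat \<Rightarrow> 'a mat \<Rightarrow> 'a mat" where
  "block x \<zeta> D N E =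
    four_block_mat D (mat_smult R (\<zeta> \<otimes> x) (mat_id R (dim_row D))) (mat_smult R \<zeta> N) E"

text \<open>The transpose of a block matrix is, after exchanging the two summands, again such a block matrix: it
is built from the transposed entries, the roles of \<open>D'\<close> and \<open>E\<close> are exchanged, and so are the two
signs. The dual statement is therefore another instance of the same computation of kernels.\<close>

lemma block_exact:
  assumes x: "x \<in> carrier R" and nzd: "\<And>s. \<lbrakk> s \<in> carrier R; x \<otimes> s = \<zero> \<rbrakk> \<Longrightarrow> s = \<zero>"
    and sg: "\<zeta> \<in> carrier R" "\<zeta> \<otimes> \<zeta> = \<one>"
    and D: "D \<in> mats_over R b0 b1" and E: "E \<in> mats_over R c b0" and N: "N \<in> mats_over R c b1"
    and D': "D' \<in> mats_over R b1 b2" and N': "N' \<in> mats_over R b0 b2"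
    and DD': "mat_mult R D D' = mat_smult R x N'" and ED: "mat_mult R E D = mat_smult R x N"
  shows "exact_modulo x D D' \<Longrightarrow> mat_exact R (block x \<zeta> D N E) (block x (\<ominus> \<zeta>) D' N' D)"
    and "exact_modulo x D\<^sup>T E\<^sup>T \<Longrightarrow> mat_exact R (block x (\<ominus> \<zeta>) D' N' D)\<^sup>T (block x \<zeta> D N E)\<^sup>T"
proof -
  have dims: "dim_row D = b0" "dim_row D' = b1" using D D' by (auto simp: mats_over_iff)
  have ms: "\<ominus> \<zeta> \<in> carrier R" "\<ominus> \<zeta> \<otimes> x \<in> carrier R" "\<zeta> \<otimes> x \<in> carrier R" "\<ominus> \<zeta> \<otimes> \<ominus> \<zeta> = \<one>" "\<ominus> (\<ominus> \<zeta>) = \<zeta>"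
    using sg x by (auto simp: l_minus r_minus)
  note S = mat_smult_mats_over and I = mat_id_mats_over
  {
    assume ex: "exact_modulo x D D'"
    show "mat_exact R (block x \<zeta> D N E) (block x (\<ominus> \<zeta>) D' N' D)"
      unfolding block_def dims
    proof (subst mat_exact_four_block_iff[OF D S[OF ms(3) I] S[OF sg(1) N] E
          D' S[OF ms(2) I] S[OF ms(1) N'] D], intro ballI)
      fix u v assume uv: "u \<in> carrier (free_mod R b1)" "v \<in> carrier (free_mod R b0)"
      show "(\<exists>w\<in>carrier (free_mod R b2). \<exists>z\<in>carrier (free_mod R b1).
          (\<forall>i<b1. u $ i = mat_map R D' w $ i \<oplus> mat_map R (mat_smult R (\<ominus> \<zeta> \<otimes> x) (mat_id R b1)) z $ i) \<and>
          (\<forall>i<b0. v $ i = mat_map R (mat_smult R (\<ominus> \<zeta>) N') w $ i \<oplus> mat_map R D z $ i)) =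
        ((\<forall>i<b0. mat_map R D u $ i \<oplus> mat_map R (mat_smult R (\<zeta> \<otimes> x) (mat_id R b0)) v $ i = \<zero>) \<and>
          (\<forall>i<c. mat_map R (mat_smult R \<zeta> N) u $ i \<oplus> mat_map R E v $ i = \<zero>))"
        using block_kernel_eq_image[OF x nzd sg D E N D' N' DD' ED ex uv] uv ms sg
        by (simp add: mat_map_scalar mat_map_smult[OF N] mat_map_smult[OF N'] cong: conj_cong bex_cong)
    qed
  }
  {
    assume ex: "exact_modulo x D\<^sup>T E\<^sup>T"
    have DE: "mat_mult R D\<^sup>T E\<^sup>T = mat_smult R x N\<^sup>T"
      using transpose_mat_mult[OF E D] ED by (simp add: transpose_mat_smult)
    have D'D: "mat_mult R D'\<^sup>T D\<^sup>T = mat_smult R x N'\<^sup>T"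
      using transpose_mat_mult[OF D D'] DD' by (simp add: transpose_mat_smult)
    note T = transpose_mats_over
    have tr: "(block x \<tau> A B C)\<^sup>T =
        four_block_mat A\<^sup>T (mat_smult R \<tau> B\<^sup>T) (mat_smult R (\<tau> \<otimes> x) (mat_id R a0)) C\<^sup>T"
      if m: "A \<in> mats_over R a0 a1" "B \<in> mats_over R a2 a1" "C \<in> mats_over R a2 a0" for \<tau> A B C a0 a1 a2
    proof -
      have "A \<in> carrier_mat a0 a1" "mat_smult R (\<tau> \<otimes> x) (mat_id R a0) \<in> carrier_mat a0 a0"
        "mat_smult R \<tau> B \<in> carrier_mat a2 a1" "C \<in> carrier_mat a2 a0" "dim_row A = a0"
        using m by (auto simp: mats_over_def mat_smult_def mat_id_def)
      then show ?thesis
        unfolding block_def by (simp add: transpose_four_block_mat transpose_mat_id transpose_mat_smult)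
    qed
    show "mat_exact R (block x (\<ominus> \<zeta>) D' N' D)\<^sup>T (block x \<zeta> D N E)\<^sup>T"
      unfolding tr[OF D' N' D] tr[OF D N E]
    proof (subst mat_exact_four_block_iff[OF T[OF D'] S[OF ms(1) T[OF N']] S[OF ms(2) I] T[OF D]
          T[OF D] S[OF sg(1) T[OF N]] S[OF ms(3) I] T[OF E]], intro ballI)
      fix p q assume pq: "p \<in> carrier (free_mod R b1)" "q \<in> carrier (free_mod R b0)"
      note core = block_kernel_eq_image[OF x nzd ms(1,4) T[OF D] T[OF D'] T[OF N'] T[OF E] T[OF N]
          DE D'D ex pq(2,1)]
      have cl: "\<And>z i. z \<in> carrier (free_mod R b0) \<Longrightarrow> i < b1 \<Longrightarrow> mat_map R D\<^sup>T z $ i \<in> carrier R"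
        "\<And>z i. z \<in> carrier (free_mod R b1) \<Longrightarrow> i < b2 \<Longrightarrow> mat_map R D'\<^sup>T z $ i \<in> carrier R"
        "\<And>z i. z \<in> carrier (free_mod R b0) \<Longrightarrow> i < b2 \<Longrightarrow> mat_map R N'\<^sup>T z $ i \<in> carrier R"
        "\<And>z i. z \<in> carrier (free_mod R c) \<Longrightarrow> i < b0 \<Longrightarrow> mat_map R E\<^sup>T z $ i \<in> carrier R"
        "\<And>z i. z \<in> carrier (free_mod R c) \<Longrightarrow> i < b1 \<Longrightarrow> mat_map R N\<^sup>T z $ i \<in> carrier R"
        "\<And>z n i. z \<in> carrier (free_mod R n) \<Longrightarrow> i < n \<Longrightarrow> z $ i \<in> carrier R"
        using T[OF D] T[OF D'] T[OF N'] T[OF E] T[OF N] by (auto intro: mat_map_entry_closed simp: mem_free_mod)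
      have swap: "(\<forall>j<b0. q $ j = mat_map R E\<^sup>T w $ j \<oplus> \<ominus> (\<ominus> \<zeta>) \<otimes> x \<otimes> z $ j) \<and>
          (\<forall>l<b1. p $ l = \<ominus> (\<ominus> \<zeta>) \<otimes> mat_map R N\<^sup>T w $ l \<oplus> mat_map R D\<^sup>T z $ l) \<longleftrightarrow>
          (\<forall>i<b1. p $ i = mat_map R D\<^sup>T z $ i \<oplus> mat_map R (mat_smult R \<zeta> N\<^sup>T) w $ i) \<and>
          (\<forall>i<b0. q $ i = mat_map R (mat_smult R (\<zeta> \<otimes> x) (mat_id R b0)) z $ i \<oplus> mat_map R E\<^sup>T w $ i)"
        if "w \<in> carrier (free_mod R c)" "z \<in> carrier (free_mod R b0)" for w z
        using that ms sg cl
        by (simp add: mat_map_scalar mat_map_smult[OF T[OF N]] a_comm conj_commute cong: conj_cong)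
      have im: "(\<exists>w\<in>carrier (free_mod R c). \<exists>z\<in>carrier (free_mod R b0).
          (\<forall>j<b0. q $ j = mat_map R E\<^sup>T w $ j \<oplus> \<ominus> (\<ominus> \<zeta>) \<otimes> x \<otimes> z $ j) \<and>
          (\<forall>l<b1. p $ l = \<ominus> (\<ominus> \<zeta>) \<otimes> mat_map R N\<^sup>T w $ l \<oplus> mat_map R D\<^sup>T z $ l)) \<longleftrightarrow>
        (\<exists>w\<in>carrier (free_mod R b0). \<exists>z\<in>carrier (free_mod R c).
          (\<forall>i<b1. p $ i = mat_map R D\<^sup>T w $ i \<oplus> mat_map R (mat_smult R \<zeta> N\<^sup>T) z $ i) \<and>
          (\<forall>i<b0. q $ i = mat_map R (mat_smult R (\<zeta> \<otimes> x) (mat_id R b0)) w $ i \<oplus> mat_map R E\<^sup>T z $ i))"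
        using swap by blast
      have ker: "(\<forall>l<b1. mat_map R D\<^sup>T q $ l \<oplus> \<ominus> \<zeta> \<otimes> x \<otimes> p $ l = \<zero>) \<and>
          (\<forall>l<b2. \<ominus> \<zeta> \<otimes> mat_map R N'\<^sup>T q $ l \<oplus> mat_map R D'\<^sup>T p $ l = \<zero>) \<longleftrightarrow>
        (\<forall>i<b2. mat_map R D'\<^sup>T p $ i \<oplus> mat_map R (mat_smult R (\<ominus> \<zeta>) N'\<^sup>T) q $ i = \<zero>) \<and>
          (\<forall>i<b1. mat_map R (mat_smult R (\<ominus> \<zeta> \<otimes> x) (mat_id R b1)) p $ i \<oplus> mat_map R D\<^sup>T q $ i = \<zero>)"
        using pq ms sg cl
        by (simp add: mat_map_scalar mat_map_smult[OF T[OF N']] a_comm conj_commute cong: conj_cong)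
      show "(\<exists>w\<in>carrier (free_mod R b0). \<exists>z\<in>carrier (free_mod R c).
          (\<forall>i<b1. p $ i = mat_map R D\<^sup>T w $ i \<oplus> mat_map R (mat_smult R \<zeta> N\<^sup>T) z $ i) \<and>
          (\<forall>i<b0. q $ i = mat_map R (mat_smult R (\<zeta> \<otimes> x) (mat_id R b0)) w $ i \<oplus> mat_map R E\<^sup>T z $ i)) =
        ((\<forall>i<b2. mat_map R D'\<^sup>T p $ i \<oplus> mat_map R (mat_smult R (\<ominus> \<zeta>) N'\<^sup>T) q $ i = \<zero>) \<and>
          (\<forall>i<b1. mat_map R (mat_smult R (\<ominus> \<zeta> \<otimes> x) (mat_id R b1)) p $ i \<oplus> mat_map R D\<^sup>T q $ i = \<zero>))"
        by (rule trans[OF im[symmetric] trans[OF core ker]])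
    qed
  }
qed

end

section \<open>Degree filtration of a graded ring\<close>

text \<open>The elements whose homogeneous components below degree \<open>n\<close> vanish. Any finite homogeneous
decomposition may serve as a witness, which avoids choosing the decomposition by its uniqueness;
uniqueness enters only where two decompositions are compared.\<close>

definition degree_ge :: "('a, 'm) ring_scheme \<Rightarrow> (nat \<Rightarrow> 'a set) \<Rightarrow> nat \<Rightarrow> 'a set" where
  "degree_ge A G n = {a. \<exists>f N. (\<forall>i. f i \<in> G i) \<and> (\<forall>i<n. f i = \<zero>\<^bsub>A\<^esub>) \<and> a = (\<Oplus>\<^bsub>A\<^esub>i\<in>{..<N}. f i)}"

context graded_ring
begin

lemma component_carrier: "a \<in> G n \<Longrightarrow> a \<in> carrier A"
  using additive_subgroup.a_subset[OF comp_subgroup] by blast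

lemma component_zero: "\<zero> \<in> G n"
  using additive_subgroup.zero_closed[OF comp_subgroup] .

lemma component_add: "\<lbrakk> a \<in> G n; b \<in> G n \<rbrakk> \<Longrightarrow> a \<oplus> b \<in> G n"
  using additive_subgroup.a_closed[OF comp_subgroup] .

lemma component_minus: "a \<in> G n \<Longrightarrow> \<ominus> a \<in> G n"
  using group.subgroupE(3)[OF a_group additive_subgroup.a_subgroup[OF comp_subgroup]] by (simp add: a_inv_def)

lemma decomposition_unique:
  assumes "\<And>i. f i \<in> G i" "\<And>i. g i \<in> G i" "\<And>i. N \<le> i \<Longrightarrow> f i = \<zero>" "\<And>i. N \<le> i \<Longrightarrow> g i = \<zero>"
    and eq: "(\<Oplus>i\<in>{..<N}. f i) = (\<Oplus>i\<in>{..<N}. g i)"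
  shows "f = g"
proof -
  have supp: "finite {i. h i \<noteq> \<zero>} \<and> (\<Oplus>i\<in>{..<N}. h i) = (\<Oplus>i\<in>{i. h i \<noteq> \<zero>}. h i)"
    if h: "\<And>i. h i \<in> G i" "\<And>i. N \<le> i \<Longrightarrow> h i = \<zero>" for h
  proof -
    have sub: "{i. h i \<noteq> \<zero>} \<subseteq> {..<N}" using h(2) by (auto simp: not_le[symmetric])
    moreover have "(\<Oplus>i\<in>{i. h i \<noteq> \<zero>}. h i) = (\<Oplus>i\<in>{..<N}. h i)"
      using sub component_carrier[OF h(1)] by (intro add.finprod_mono_neutral_cong_left) auto
    ultimately show ?thesis using finite_subset by auto
  qed
  have "(\<Oplus>i\<in>{..<N}. f i) \<in> carrier A" using component_carrier assms(1) by (intro finsum_closed) blast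
  from direct_sum[OF this]
  show ?thesis using supp[of f] supp[of g] assms by (metis (no_types, lifting))
qed

lemma decomposition_exists:
  assumes "a \<in> carrier A"
  shows "\<exists>f N. (\<forall>i. f i \<in> G i) \<and> (\<forall>i\<ge>N. f i = \<zero>) \<and> a = (\<Oplus>i\<in>{..<N}. f i)"
proof -
  from direct_sum[OF assms] obtain f where f: "\<forall>n. f n \<in> G n" "finite {n. f n \<noteq> \<zero>}"
    "a = (\<Oplus>n\<in>{n. f n \<noteq> \<zero>}. f n)" by blast
  then obtain N where N: "{n. f n \<noteq> \<zero>} \<subseteq> {..<N}"
    using finite_nat_iff_bounded by blast
  have "a = (\<Oplus>i\<in>{..<N}. f i)"
    unfolding f(3) using N f(1) component_carrier by (intro add.finprod_mono_neutral_cong_left) auto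
  moreover have "\<forall>i\<ge>N. f i = \<zero>" using N by (auto simp: not_less[symmetric])
  ultimately show ?thesis using f(1) by blast
qed

lemma finsum_pad:
  assumes f: "\<And>i. f i \<in> G i" and NK: "N \<le> K"
  shows "(\<Oplus>i\<in>{..<N}. f i) = (\<Oplus>i\<in>{..<K}. if i < N then f i else \<zero>)"
  using component_carrier[OF f] NK by (intro add.finprod_mono_neutral_cong_left) auto

lemma degree_geI:
  "\<lbrakk> \<And>i. f i \<in> G i; \<And>i. i < n \<Longrightarrow> f i = \<zero>; a = (\<Oplus>i\<in>{..<N}. f i) \<rbrakk> \<Longrightarrow> a \<in> degree_ge A G n"
  unfolding degree_ge_def by blast

lemma degree_geE:
  assumes "a \<in> degree_ge A G n"
  obtains f N where "\<And>i. f i \<in> G i" "\<And>i. i < n \<Longrightarrow> f i = \<zero>" "\<And>i. N \<le> i \<Longrightarrow> f i = \<zero>"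
    "a = (\<Oplus>i\<in>{..<N}. f i)"
proof -
  from assms obtain f N where f: "\<And>i. f i \<in> G i" "\<And>i. i < n \<Longrightarrow> f i = \<zero>"
    "a = (\<Oplus>i\<in>{..<N}. f i)" unfolding degree_ge_def by blast
  show ?thesis
  proof (rule that[of "\<lambda>i. if i < N then f i else \<zero>" N])
    show "a = (\<Oplus>i\<in>{..<N}. if i < N then f i else \<zero>)" using finsum_pad[OF f(1), of N N] f(3) by simp
  qed (use f component_zero in auto)
qed

lemma degree_ge_carrier: "a \<in> degree_ge A G n \<Longrightarrow> a \<in> carrier A"
  using component_carrier by (elim degree_geE) (auto intro!: finsum_closed)

lemma carrier_degree_ge: "a \<in> carrier A \<Longrightarrow> a \<in> degree_ge A G 0"
  using decomposition_exists by (auto simp: degree_ge_def)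

lemma degree_ge_zero: "\<zero> \<in> degree_ge A G n"
  by (rule degree_geI[of "\<lambda>_. \<zero>" _ _ 0]) (auto simp: component_zero)

lemma degree_ge_add:
  assumes "a \<in> degree_ge A G n" "b \<in> degree_ge A G n"
  shows "a \<oplus> b \<in> degree_ge A G n"
proof -
  obtain f M where f: "\<And>i. f i \<in> G i" "\<And>i. i < n \<Longrightarrow> f i = \<zero>" "\<And>i. M \<le> i \<Longrightarrow> f i = \<zero>"
    "a = (\<Oplus>i\<in>{..<M}. f i)" using assms(1) by (elim degree_geE) blast
  obtain g N where g: "\<And>i. g i \<in> G i" "\<And>i. i < n \<Longrightarrow> g i = \<zero>" "\<And>i. N \<le> i \<Longrightarrow> g i = \<zero>"
    "b = (\<Oplus>i\<in>{..<N}. g i)" using assms(2) by (elim degree_geE) blast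
  let ?K = "max M N"
  note cl = component_carrier[OF f(1)] component_carrier[OF g(1)]
  have "a = (\<Oplus>i\<in>{..<?K}. f i)" unfolding f(4)
    using cl f(3) by (intro add.finprod_mono_neutral_cong_left) (auto simp: not_less)
  moreover have "b = (\<Oplus>i\<in>{..<?K}. g i)" unfolding g(4)
    using cl g(3) by (intro add.finprod_mono_neutral_cong_left) (auto simp: not_less)
  ultimately have "a \<oplus> b = (\<Oplus>i\<in>{..<?K}. f i \<oplus> g i)"
    using cl by (simp add: finsum_addf)
  then show ?thesis
    using f(1,2) g(1,2) by (intro degree_geI[of "\<lambda>i. f i \<oplus> g i"]) (auto simp: component_add)
qed

lemma degree_ge_minus:
  assumes "a \<in> degree_ge A G n"
  shows "\<ominus> a \<in> degree_ge A G n"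
proof -
  obtain f M where f: "\<And>i. f i \<in> G i" "\<And>i. i < n \<Longrightarrow> f i = \<zero>" "\<And>i. M \<le> i \<Longrightarrow> f i = \<zero>"
    "a = (\<Oplus>i\<in>{..<M}. f i)" using assms by (elim degree_geE) blast
  note cl = component_carrier[OF f(1)]
  have "a \<oplus> (\<Oplus>i\<in>{..<M}. \<ominus> f i) = \<zero>"
    unfolding f(4) using cl by (subst finsum_addf[symmetric]) (auto simp: r_neg)
  then have "\<ominus> a = (\<Oplus>i\<in>{..<M}. \<ominus> f i)"
    using cl f(4) by (intro minus_equality) (auto simp: a_comm intro!: finsum_closed)
  then show ?thesis
    using f(1,2) by (intro degree_geI[of "\<lambda>i. \<ominus> f i"]) (auto simp: component_minus)
qed

lemma degree_ge_finsum:
  assumes "finite J" "\<And>j. j \<in> J \<Longrightarrow> h j \<in> degree_ge A G n"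
  shows "(\<Oplus>j\<in>J. h j) \<in> degree_ge A G n"
  using assms
proof (induction J rule: finite_induct)
  case (insert j J)
  then have "(\<Oplus>j\<in>insert j J. h j) = h j \<oplus> (\<Oplus>j\<in>J. h j)"
    using degree_ge_carrier by (intro finsum_insert) auto
  then show ?case using insert degree_ge_add by simp
qed (simp add: degree_ge_zero)

lemma component_degree_ge:
  assumes "a \<in> G m" "n \<le> m"
  shows "a \<in> degree_ge A G n"
proof (rule degree_geI[of "\<lambda>i. if m = i then a else \<zero>" _ _ "Suc m"])
  have "(\<Oplus>i\<in>{..<Suc m}. if m = i then a else \<zero>) = a"
    using component_carrier[OF assms(1)] by (intro finsum_singleton) auto
  then show "a = (\<Oplus>i\<in>{..<Suc m}. if m = i then a else \<zero>)" by simp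
qed (use assms component_zero in auto)

lemma degree_ge_mult:
  assumes "a \<in> degree_ge A G m" "b \<in> degree_ge A G n"
  shows "a \<otimes> b \<in> degree_ge A G (m + n)"
proof -
  obtain f M where f: "\<And>i. f i \<in> G i" "\<And>i. i < m \<Longrightarrow> f i = \<zero>" "\<And>i. M \<le> i \<Longrightarrow> f i = \<zero>"
    "a = (\<Oplus>i\<in>{..<M}. f i)" using assms(1) by (elim degree_geE) blast
  obtain g N where g: "\<And>i. g i \<in> G i" "\<And>i. i < n \<Longrightarrow> g i = \<zero>" "\<And>i. N \<le> i \<Longrightarrow> g i = \<zero>"
    "b = (\<Oplus>i\<in>{..<N}. g i)" using assms(2) by (elim degree_geE) blast
  note cl = component_carrier[OF f(1)] component_carrier[OF g(1)]
  have prod: "f i \<otimes> g j \<in> degree_ge A G (m + n)" for i j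
  proof (cases "i < m \<or> j < n")
    case True
    then show ?thesis using f(2) g(2) cl degree_ge_zero by auto
  next
    case False
    then show ?thesis using comp_mult[OF f(1) g(1)] by (intro component_degree_ge) auto
  qed
  have b: "b \<in> carrier A" using degree_ge_carrier[OF assms(2)] .
  have "a \<otimes> b = (\<Oplus>i\<in>{..<M}. f i \<otimes> b)"
    unfolding f(4) using cl b by (intro finsum_ldistr) auto
  also have "\<dots> = (\<Oplus>i\<in>{..<M}. \<Oplus>j\<in>{..<N}. f i \<otimes> g j)"
    unfolding g(4) using cl by (intro finsum_cong' finsum_rdistr) (auto intro!: finsum_closed)
  also have "\<dots> \<in> degree_ge A G (m + n)"
    by (intro degree_ge_finsum prod) auto
  finally show ?thesis .
qed

text \<open>An element that lies in every step has a decomposition supported below some \<open>N\<close> and another one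
supported from \<open>N\<close> on; by uniqueness they agree, so both are zero.\<close>

lemma degree_ge_separated:
  assumes "\<And>n. a \<in> degree_ge A G n"
  shows "a = \<zero>"
proof -
  obtain f N where f: "\<And>i. f i \<in> G i" "\<And>i. N \<le> i \<Longrightarrow> f i = \<zero>" "a = (\<Oplus>i\<in>{..<N}. f i)"
    using assms[of 0] by (elim degree_geE) blast
  obtain g M where g: "\<And>i. g i \<in> G i" "\<And>i. i < N \<Longrightarrow> g i = \<zero>" "\<And>i. M \<le> i \<Longrightarrow> g i = \<zero>"
    "a = (\<Oplus>i\<in>{..<M}. g i)" using assms[of N] by (elim degree_geE) blast
  let ?K = "max M N"
  note cl = component_carrier[OF f(1)] component_carrier[OF g(1)]
  have "a = (\<Oplus>i\<in>{..<?K}. f i)" unfolding f(3)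
    using cl f(2) by (intro add.finprod_mono_neutral_cong_left) (auto simp: not_less)
  moreover have "a = (\<Oplus>i\<in>{..<?K}. g i)" unfolding g(4)
    using cl g(3) by (intro add.finprod_mono_neutral_cong_left) (auto simp: not_less)
  ultimately have "f = g"
    using f g by (intro decomposition_unique[of f g ?K]) auto
  then have "f i = \<zero>" for i using f(2)[of i] g(2)[of i] by (cases "N \<le> i") auto
  then show ?thesis using f(3) by simp
qed

lemma component_Int_degree_ge:
  assumes "a \<in> G m" "a \<in> degree_ge A G n" "m < n"
  shows "a = \<zero>"
proof -
  obtain g M where g: "\<And>i. g i \<in> G i" "\<And>i. i < n \<Longrightarrow> g i = \<zero>" "\<And>i. M \<le> i \<Longrightarrow> g i = \<zero>"
    "a = (\<Oplus>i\<in>{..<M}. g i)" using assms(2) by (elim degree_geE) blast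
  let ?f = "\<lambda>i. if m = i then a else \<zero>" and ?K = "max M (Suc m)"
  note cl = component_carrier[OF g(1)] component_carrier[OF assms(1)]
  have "a = (\<Oplus>i\<in>{..<?K}. g i)" unfolding g(4)
    using cl g(3) by (intro add.finprod_mono_neutral_cong_left) (auto simp: not_less)
  moreover have "(\<Oplus>i\<in>{..<?K}. ?f i) = a"
    using cl by (intro finsum_singleton) auto
  ultimately have "?f = g"
    using g assms component_zero by (intro decomposition_unique[of ?f g ?K]) auto
  then have "?f m = g m" by (rule fun_cong)
  then show ?thesis using g(2) assms(3) by simp
qed

lemma degree_ge_Suc_decomposition:
  assumes "a \<in> degree_ge A G n"
  obtains c a' where "c \<in> G n" "a' \<in> degree_ge A G (Suc n)" "a = c \<oplus> a'"
proof -
  obtain f N where f: "\<And>i. f i \<in> G i" "\<And>i. i < n \<Longrightarrow> f i = \<zero>" "\<And>i. N \<le> i \<Longrightarrow> f i = \<zero>"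
    "a = (\<Oplus>i\<in>{..<N}. f i)" using assms by (elim degree_geE) blast
  let ?a' = "\<Oplus>i\<in>{..<N}. if n = i then \<zero> else f i"
  note cl = component_carrier[OF f(1)]
  have sum: "f n = (\<Oplus>i\<in>{..<N}. if n = i then f i else \<zero>)"
  proof (cases "n < N")
    case True
    then show ?thesis using cl by (intro finsum_singleton[symmetric]) auto
  next
    case False
    then have "f n = \<zero>" using f(3) by simp
    moreover have "(\<Oplus>i\<in>{..<N}. if n = i then f i else \<zero>) = (\<Oplus>i\<in>{..<N}. \<zero>)"
      using False by (intro finsum_cong') auto
    ultimately show ?thesis by simp
  qed
  have "f n \<oplus> ?a' = (\<Oplus>i\<in>{..<N}. (if n = i then f i else \<zero>) \<oplus> (if n = i then \<zero> else f i))"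
    unfolding sum using cl by (intro finsum_addf[symmetric]) auto
  also have "\<dots> = a" unfolding f(4) using cl by (intro finsum_cong') auto
  finally have "a = f n \<oplus> ?a'" by simp
  moreover have "?a' \<in> degree_ge A G (Suc n)"
    using f(1,2) component_zero by (intro degree_geI[of "\<lambda>i. if n = i then \<zero> else f i" _ _ N]) auto
  ultimately show ?thesis using that f(1) by blast
qed

text \<open>If \<open>c\<close> is the degree-zero component of \<open>a\<close>, then \<open>x c\<close> is the degree-one component of \<open>x a\<close>, so it
vanishes, and \<open>x\<close> can be cancelled.\<close>

lemma degree_one_cancel:
  assumes x: "x \<in> G 1" and nzd: "\<And>s. \<lbrakk> s \<in> carrier A; x \<otimes> s = \<zero> \<rbrakk> \<Longrightarrow> s = \<zero>"
    and a: "a \<in> carrier A" and xa: "x \<otimes> a \<in> degree_ge A G 2"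
  shows "a \<in> degree_ge A G 1"
proof -
  obtain c a' where c: "c \<in> G 0" and a': "a' \<in> degree_ge A G 1" and eq: "a = c \<oplus> a'"
    using carrier_degree_ge[OF a] by (rule degree_ge_Suc_decomposition) auto
  have cl: "c \<in> carrier A" "a' \<in> carrier A" "x \<in> carrier A"
    using component_carrier degree_ge_carrier c a' x by auto
  have "x \<otimes> a' \<in> degree_ge A G 2"
    using degree_ge_mult[OF component_degree_ge[OF x] a', of 1] by (simp add: numeral_2_eq_2)
  then have "x \<otimes> a \<oplus> \<ominus> (x \<otimes> a') \<in> degree_ge A G 2" using xa degree_ge_add degree_ge_minus by blast
  moreover have "x \<otimes> a \<oplus> \<ominus> (x \<otimes> a') = x \<otimes> c"
    unfolding eq using cl by (simp add: r_distr a_assoc r_neg)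
  ultimately have "x \<otimes> c \<in> degree_ge A G 2" by simp
  moreover have "x \<otimes> c \<in> G 1" using comp_mult[OF x c] by simp
  ultimately have "x \<otimes> c = \<zero>" using component_Int_degree_ge by force
  then have "c = \<zero>" using nzd cl by blast
  then show ?thesis using eq a' cl by simp
qed

lemma degree_ge_ideal: "ideal (degree_ge A G n) A"
proof (rule idealI)
  show "ring A" by (rule ring_axioms)
  show "subgroup (degree_ge A G n) (add_monoid A)"
    using degree_ge_carrier degree_ge_zero[of n] degree_ge_add degree_ge_minus
    by (intro add.subgroupI) (auto simp: a_inv_def[symmetric])
  fix a s assume "a \<in> degree_ge A G n" "s \<in> carrier A"
  then show "s \<otimes> a \<in> degree_ge A G n" "a \<otimes> s \<in> degree_ge A G n"
    using degree_ge_mult[OF carrier_degree_ge, of s a n] degree_ge_mult[OF _ carrier_degree_ge, of a n s] by auto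
qed

lemma homogeneous_max_ideal_eq: "homogeneous_max_ideal A G = degree_ge A G 1"
proof
  have sub: "(\<Union>n\<in>{1..}. G n) \<subseteq> carrier A" using component_carrier by blast
  show "homogeneous_max_ideal A G \<subseteq> degree_ge A G 1"
    unfolding homogeneous_max_ideal_def
    by (rule genideal_minimal[OF degree_ge_ideal]) (auto intro: component_degree_ge)
  interpret I: ideal "homogeneous_max_ideal A G" A
    unfolding homogeneous_max_ideal_def by (rule genideal_ideal[OF sub])
  have gen: "(\<Union>n\<in>{1..}. G n) \<subseteq> homogeneous_max_ideal A G"
    unfolding homogeneous_max_ideal_def by (rule genideal_self[OF sub])
  show "degree_ge A G 1 \<subseteq> homogeneous_max_ideal A G"
  proof
    fix a assume "a \<in> degree_ge A G 1"
    then obtain f N where f: "\<And>i. f i \<in> G i" "\<And>i. i < 1 \<Longrightarrow> f i = \<zero>" "a = (\<Oplus>i\<in>{..<N}. f i)"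
      by (elim degree_geE) blast
    have mem: "f i \<in> homogeneous_max_ideal A G" for i
    proof (cases "i < 1")
      case False
      then have "f i \<in> (\<Union>n\<in>{1..}. G n)" using f(1)[of i] by (intro UN_I[of i]) auto
      then show ?thesis using gen by blast
    qed (simp add: f(2))
    have "(\<Oplus>i\<in>{..<K}. f i) \<in> homogeneous_max_ideal A G" for K
    proof (induction K)
      case (Suc K)
      have "(\<Oplus>i\<in>{..<Suc K}. f i) = f K \<oplus> (\<Oplus>i\<in>{..<K}. f i)"
        unfolding lessThan_Suc using component_carrier[OF f(1)] by (intro finsum_insert) auto
      then show ?case using Suc mem I.a_closed by simp
    qed simp
    then show "a \<in> homogeneous_max_ideal A G" using f(3) by simp
  qed
qed

end

lemma (in standard_graded_ring) one_not_zero: "\<one> \<noteq> \<zero>"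
  using subfieldE[OF subfield_k] by auto

lemma (in standard_graded_ring) one_not_degree_ge: "\<one> \<notin> degree_ge A G 1"
proof
  assume "\<one> \<in> degree_ge A G 1"
  moreover have "\<one> \<in> G 0"
    using subringE(3)[OF subfieldE(1)[OF subfield_k]] comp_0 by simp
  ultimately show False using component_Int_degree_ge one_not_zero by force
qed

section \<open>Lifting from the quotient ring\<close>

text \<open>Stated for an arbitrary homomorphism of commutative rings; the case of interest is reduction
modulo \<open>x\<close>.\<close>

lemma (in ring_hom_cring) mat_map_hom_image:
  assumes D: "D \<in> mats_over R m n" and v: "v \<in> carrier (free_mod R n)"
  shows "mat_map S (map_mat h D) (map_vec h v) = map_vec h (mat_map R D v)"
proof (rule eq_vecI)
  have dims: "dim_row D = m" "dim_col D = n" using D by (auto simp: mats_over_iff)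
  have hv: "map_vec h v \<in> carrier (free_mod S n)" using v by (auto simp: mem_free_mod)
  have Dv: "dim_vec (mat_map R D v) = m" using dims v by simp
  show "dim_vec (mat_map S (map_mat h D) (map_vec h v)) = dim_vec (map_vec h (mat_map R D v))"
    using hv dims Dv by (simp add: S.mat_map_dim)
  fix i assume "i < dim_vec (map_vec h (mat_map R D v))"
  then have i: "i < m" using Dv by simp
  have cl: "\<And>j. j < n \<Longrightarrow> D $$ (i, j) \<in> carrier R" "\<And>j. j < n \<Longrightarrow> v $ j \<in> carrier R" "dim_vec v = n"
    using D v i by (auto simp: mats_over_iff mem_free_mod)
  have "map_vec h (mat_map R D v) $ i = h (\<Oplus>j\<in>{..<n}. D $$ (i, j) \<otimes> v $ j)"
    using dims v i Dv by (simp add: R.mat_map_index)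
  also have "\<dots> = (\<Oplus>\<^bsub>S\<^esub>j\<in>{..<n}. map_mat h D $$ (i, j) \<otimes>\<^bsub>S\<^esub> map_vec h v $ j)"
    using cl i dims by (subst hom_finsum) (auto intro!: S.finsum_cong')
  also have "\<dots> = mat_map S (map_mat h D) (map_vec h v) $ i"
    using hv dims i by (simp add: S.mat_map_index)
  finally show "mat_map S (map_mat h D) (map_vec h v) $ i = map_vec h (mat_map R D v) $ i" by simp
qed

context cring
begin

lemma exact_modulo_of_quotient:
  assumes x: "x \<in> carrier R" and D: "D \<in> mats_over R l m" and E: "E \<in> mats_over R m n"
    and ex: "mat_exact (R Quot (PIdl x)) (map_mat (\<lambda>s. PIdl x +> s) D) (map_mat (\<lambda>s. PIdl x +> s) E)"
  shows "exact_modulo x D E"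
proof -
  let ?I = "PIdl x" and ?Q = "R Quot (PIdl x)" and ?p = "\<lambda>s. PIdl x +> s"
  have I: "ideal ?I R" by (rule cgenideal_ideal[OF x])
  interpret h: ring_hom_cring R ?Q ?p by (rule ideal.rcos_ring_hom_cring[OF I is_cring])
  have I_sub: "abelian_subgroup ?I R"
    by (intro abelian_subgroupI3 ideal.axioms(1)[OF I] abelian_group_axioms)
  have mem_I: "s \<in> ?I \<longleftrightarrow> (\<exists>t\<in>carrier R. s = x \<otimes> t)" for s
    using x by (auto simp: cgenideal_def m_comm)
  have dims: "dim_row D = l" "dim_col D = m" "dim_row E = m" "dim_col E = n"
    using D E by (auto simp: mats_over_iff)
  have zeroQ: "\<zero>\<^bsub>?Q\<^esub> = ?I" unfolding FactRing_def by simp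
  have surj: "\<exists>s\<in>carrier R. C = ?p s" if "C \<in> carrier ?Q" for C
    using that unfolding FactRing_def A_RCOSETS_def' partial_object.simps by blast
  show ?thesis
    unfolding exact_modulo_def dims
  proof (intro ballI impI)
    fix u assume u: "u \<in> carrier (free_mod R m)"
      and Du: "\<forall>i<l. \<exists>s\<in>carrier R. mat_map R D u $ i = x \<otimes> s"
    have Duc: "mat_map R D u \<in> carrier (free_mod R l)" by (rule mat_map_closed[OF D u])
    have pu: "map_vec ?p u \<in> carrier (free_mod ?Q m)" using u by (auto simp: mem_free_mod)
    have "?p (mat_map R D u $ i) = \<zero>\<^bsub>?Q\<^esub>" if "i < l" for i
      using Du that abelian_subgroup.a_rcos_const[OF I_sub] mem_I unfolding zeroQ by metis
    then have "mat_map ?Q (map_mat ?p D) (map_vec ?p u) = \<zero>\<^bsub>free_mod ?Q l\<^esub>"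
      unfolding h.mat_map_hom_image[OF D u]
      using Duc by (intro eq_vecI) (auto simp: free_mod_ops mem_free_mod)
    then have "map_vec ?p u \<in> mat_map ?Q (map_mat ?p E) ` carrier (free_mod ?Q n)"
      using ex pu dims unfolding mat_exact_def by auto
    then obtain w' where w': "w' \<in> carrier (free_mod ?Q n)" "map_vec ?p u = mat_map ?Q (map_mat ?p E) w'"
      by blast
    have "\<forall>j. \<exists>s. j < n \<longrightarrow> s \<in> carrier R \<and> w' $ j = ?p s"
      using surj w'(1) unfolding mem_free_mod by blast
    then obtain f where f: "\<And>j. j < n \<Longrightarrow> f j \<in> carrier R \<and> w' $ j = ?p (f j)" by metis
    define w where "w = vec n f"
    have w: "w \<in> carrier (free_mod R n)" using f by (auto simp: w_def mem_free_mod)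
    have "w' = map_vec ?p w" using w'(1) f by (intro eq_vecI) (auto simp: w_def mem_free_mod)
    then have eq: "map_vec ?p u = map_vec ?p (mat_map R E w)"
      using w'(2) h.mat_map_hom_image[OF E w] by simp
    have Ew: "mat_map R E w \<in> carrier (free_mod R m)" by (rule mat_map_closed[OF E w])
    have "\<exists>t\<in>carrier R. u $ j \<ominus> mat_map R E w $ j = x \<otimes> t" if j: "j < m" for j
    proof -
      have "?p (u $ j) = ?p (mat_map R E w $ j)"
        using arg_cong[OF eq, of "\<lambda>v. v $ j"] j u Ew by (auto simp: mem_free_mod)
      then have "u $ j \<ominus> mat_map R E w $ j \<in> ?I"
        using quotient_eq_iff_same_a_r_cos[OF I] u Ew j by (auto simp: mem_free_mod)
      then show ?thesis using mem_I by blast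
    qed
    then obtain t where t: "\<And>j. j < m \<Longrightarrow> t j \<in> carrier R \<and> u $ j \<ominus> mat_map R E w $ j = x \<otimes> t j" by metis
    show "\<exists>w\<in>carrier (free_mod R n). \<exists>t\<in>carrier (free_mod R m). \<forall>j<m. u $ j = mat_map R E w $ j \<oplus> x \<otimes> t $ j"
    proof (intro bexI[OF _ w] bexI[of _ "vec m t"] allI impI)
      show "vec m t \<in> carrier (free_mod R m)" using t by (auto simp: mem_free_mod)
      fix j assume j: "j < m"
      have cl: "u $ j \<in> carrier R" "mat_map R E w $ j \<in> carrier R" using u Ew j by (auto simp: mem_free_mod)
      have "mat_map R E w $ j \<oplus> x \<otimes> t j = mat_map R E w $ j \<oplus> (u $ j \<ominus> mat_map R E w $ j)"
        using t[OF j] by simp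
      also have "\<dots> = u $ j" using cl by (simp add: minus_eq a_lcomm r_neg)
      finally show "u $ j = mat_map R E w $ j \<oplus> x \<otimes> vec m t $ j" using j by simp
    qed
  qed
qed

end

context graded_ring
begin

text \<open>The image in the quotient of the ideal of elements of positive degree is an ideal that contains the
generators of the maximal ideal of the quotient. Hence \<open>a\<close> differs from an element of positive
degree by a multiple of \<open>x\<close>, which is itself of positive degree.\<close>

lemma lift_of_quotient_max_ideal:
  assumes x: "x \<in> degree_ge A G 1" and a: "a \<in> carrier A"
    and max: "PIdl x +> a \<in> homogeneous_max_ideal (A Quot (PIdl x)) (quotient_grading A (PIdl x) G)"
  shows "a \<in> degree_ge A G 1"
proof -
  let ?I = "PIdl x" and ?J = "degree_ge A G 1"
  note J = degree_ge_ideal[of 1]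
  interpret J: ideal ?J A by (rule J)
  have I: "ideal ?I A" by (rule cgenideal_ideal[OF degree_ge_carrier[OF x]])
  interpret Q: ring "A Quot ?I" by (rule ideal.quotient_is_ring[OF I])
  have "homogeneous_max_ideal (A Quot ?I) (quotient_grading A ?I G) \<subseteq> (+>) ?I ` ?J"
    unfolding homogeneous_max_ideal_def
  proof (rule Q.genideal_minimal[OF ring_ideal_imp_quot_ideal[OF I J]])
    show "(\<Union>n\<in>{1..}. quotient_grading A ?I G n) \<subseteq> (+>) ?I ` ?J"
      using component_degree_ge by (auto simp: quotient_grading_def)
  qed
  then obtain c where c: "c \<in> ?J" "?I +> a = ?I +> c" using max by blast
  then have "a \<ominus> c \<in> ?I"
    using quotient_eq_iff_same_a_r_cos[OF I a] degree_ge_carrier by blast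
  then have "a \<ominus> c \<in> ?J" using cgenideal_minimal[OF J x] by blast
  then have "(a \<ominus> c) \<oplus> c \<in> ?J" using c(1) J.a_closed by blast
  moreover have "(a \<ominus> c) \<oplus> c = a" using a degree_ge_carrier[OF c(1)] by (simp add: minus_eq a_assoc l_neg)
  ultimately show ?thesis by simp
qed

lemma mat_mult_degree_ge:
  assumes "D \<in> mats_over A l m" "E \<in> mats_over A m n"
    and "elements_mat D \<subseteq> degree_ge A G p" "elements_mat E \<subseteq> degree_ge A G q"
    and "i < l" "j < n"
  shows "mat_mult A D E $$ (i, j) \<in> degree_ge A G (p + q)"
proof -
  have "mat_mult A D E $$ (i, j) = (\<Oplus>r\<in>{..<m}. D $$ (i, r) \<otimes> E $$ (r, j))"
    using assms by (simp add: mat_mult_def mats_over_iff)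
  also have "\<dots> \<in> degree_ge A G (p + q)"
  proof (rule degree_ge_finsum)
    fix r assume "r \<in> {..<m}"
    then have "D $$ (i, r) \<in> elements_mat D" "E $$ (r, j) \<in> elements_mat E"
      using assms by (auto simp: mats_over_def intro!: elements_matI)
    then show "D $$ (i, r) \<otimes> E $$ (r, j) \<in> degree_ge A G (p + q)"
      using assms(3,4) degree_ge_mult by blast
  qed simp
  finally show ?thesis .
qed

lemma mat_map_degree_ge:
  assumes D: "D \<in> mats_over A m n" "elements_mat D \<subseteq> degree_ge A G p"
    and v: "v \<in> carrier (free_mod A n)" and i: "i < m"
  shows "mat_map A D v $ i \<in> degree_ge A G p"
proof -
  have "mat_map A D v $ i = (\<Oplus>j\<in>{..<n}. D $$ (i, j) \<otimes> v $ j)"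
    using D v i by (simp add: mat_map_index mats_over_iff)
  also have "\<dots> \<in> degree_ge A G p"
  proof (rule degree_ge_finsum)
    fix j assume "j \<in> {..<n}"
    then have "D $$ (i, j) \<in> elements_mat D" "v $ j \<in> carrier A"
      using D v i by (auto simp: mats_over_def mem_free_mod intro!: elements_matI)
    then show "D $$ (i, j) \<otimes> v $ j \<in> degree_ge A G p"
      using D(2) ideal.I_r_closed[OF degree_ge_ideal] by blast
  qed simp
  finally show ?thesis .
qed

end

section \<open>Minimal matrices with free cokernel\<close>

context cring
begin

lemma mat_map_image_submodule:
  assumes D: "D \<in> mats_over R m n"
  shows "submodule (mat_map R D ` carrier (free_mod R n)) R (free_mod R m)"
proof -
  interpret M: module R "free_mod R n" by (rule free_mod_module)
  interpret N: module R "free_mod R m" by (rule free_mod_module)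
  note h = mat_map_hom[OF D]
  show ?thesis
  proof (rule N.submoduleI)
    show "mat_map R D ` carrier (free_mod R n) \<subseteq> carrier (free_mod R m)"
      using mod_homs_closed[OF h] by blast
    show "\<zero>\<^bsub>free_mod R m\<^esub> \<in> mat_map R D ` carrier (free_mod R n)"
      using mod_homs_zero[OF h free_mod_module free_mod_module] free_mod_zero_closed by (metis imageI)
    show smult: "a \<odot>\<^bsub>free_mod R m\<^esub> y \<in> mat_map R D ` carrier (free_mod R n)"
      if "a \<in> carrier R" "y \<in> mat_map R D ` carrier (free_mod R n)" for a y
    proof -
      from that(2) obtain v where v: "v \<in> carrier (free_mod R n)" "y = mat_map R D v" by blast
      have "a \<odot>\<^bsub>free_mod R m\<^esub> y = mat_map R D (a \<odot>\<^bsub>free_mod R n\<^esub> v)"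
        using mod_homs_smult[OF h that(1) v(1)] v(2) by simp
      then show ?thesis using M.smult_closed[OF that(1) v(1)] by blast
    qed
    show "y \<oplus>\<^bsub>free_mod R m\<^esub> z \<in> mat_map R D ` carrier (free_mod R n)"
      if "y \<in> mat_map R D ` carrier (free_mod R n)" "z \<in> mat_map R D ` carrier (free_mod R n)" for y z
    proof -
      from that obtain v w where vw: "v \<in> carrier (free_mod R n)" "y = mat_map R D v"
        "w \<in> carrier (free_mod R n)" "z = mat_map R D w" by blast
      have "y \<oplus>\<^bsub>free_mod R m\<^esub> z = mat_map R D (v \<oplus>\<^bsub>free_mod R n\<^esub> w)"
        using mod_homs_add[OF h vw(1,3)] vw(2,4) by simp
      then show ?thesis using M.M.a_closed[OF vw(1,3)] by blast
    qed
    fix y assume y: "y \<in> mat_map R D ` carrier (free_mod R n)"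
    then have yc: "y \<in> carrier (free_mod R m)" using mod_homs_closed[OF h] by blast
    have "\<ominus>\<^bsub>free_mod R m\<^esub> y = (\<ominus> \<one>) \<odot>\<^bsub>free_mod R m\<^esub> y"
      using N.smult_l_minus[OF one_closed yc] N.smult_one[OF yc] by simp
    then show "\<ominus>\<^bsub>free_mod R m\<^esub> y \<in> mat_map R D ` carrier (free_mod R n)"
      using smult[OF _ y, of "\<ominus> \<one>"] by simp
  qed
qed

end

text \<open>Coordinates with respect to a basis are functions on the whole basis, and the sum that they describe
runs over their support only. Extending \<open>a\<close> by zero gives coordinates of the zero element, to be
compared with the zero function.\<close>

lemma basis_coefficients_zero:
  fixes R :: "('a, 'm) ring_scheme" (structure) and M :: "('a, 'b) module"
  assumes M: "module R M" and B: "is_module_basis R M B" and T: "finite T" "T \<subseteq> B"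
    and a: "a \<in> T \<rightarrow> carrier R" and sum: "(\<Oplus>\<^bsub>M\<^esub>b\<in>T. a b \<odot>\<^bsub>M\<^esub> b) = \<zero>\<^bsub>M\<^esub>" and b: "b \<in> T"
  shows "a b = \<zero>"
proof -
  interpret module R M by (rule M)
  have BM: "B \<subseteq> carrier M" using B by (simp add: is_module_basis_def)
  let ?P = "\<lambda>c. c \<in> B \<rightarrow>\<^sub>E carrier R \<and> finite {v\<in>B. c v \<noteq> \<zero>} \<and>
        \<zero>\<^bsub>M\<^esub> = (\<Oplus>\<^bsub>M\<^esub>v\<in>{v\<in>B. c v \<noteq> \<zero>}. c v \<odot>\<^bsub>M\<^esub> v)"
  let ?c = "\<lambda>v\<in>B. if v \<in> T then a v else \<zero>" and ?z = "\<lambda>v\<in>B. \<zero>"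
  have "\<exists>!c. ?P c" using B M.zero_closed unfolding is_module_basis_def by blast
  moreover have "?P ?z" by simp
  moreover have "?P ?c"
  proof (intro conjI)
    show "?c \<in> B \<rightarrow>\<^sub>E carrier R" using a by auto
    have sub: "{v\<in>B. ?c v \<noteq> \<zero>} \<subseteq> T" by (auto split: if_splits)
    then show "finite {v\<in>B. ?c v \<noteq> \<zero>}" using T(1) finite_subset by blast
    have "(\<Oplus>\<^bsub>M\<^esub>v\<in>{v\<in>B. ?c v \<noteq> \<zero>}. ?c v \<odot>\<^bsub>M\<^esub> v) = (\<Oplus>\<^bsub>M\<^esub>b\<in>T. a b \<odot>\<^bsub>M\<^esub> b)"
    proof (rule M.add.finprod_mono_neutral_cong_left[OF T(1) sub])
      fix v assume v: "v \<in> T - {v\<in>B. ?c v \<noteq> \<zero>}"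
      then have "a v = \<zero>" "v \<in> carrier M" using T(2) BM by (auto split: if_splits)
      then show "a v \<odot>\<^bsub>M\<^esub> v = \<zero>\<^bsub>M\<^esub>" by simp
    next
      fix v assume "v \<in> {v\<in>B. ?c v \<noteq> \<zero>}"
      then show "?c v \<odot>\<^bsub>M\<^esub> v = a v \<odot>\<^bsub>M\<^esub> v" by (auto split: if_splits)
    qed (use a T BM in \<open>auto simp: Pi_iff\<close>)
    then show "\<zero>\<^bsub>M\<^esub> = (\<Oplus>\<^bsub>M\<^esub>v\<in>{v\<in>B. ?c v \<noteq> \<zero>}. ?c v \<odot>\<^bsub>M\<^esub> v)" using sum by simp
  qed
  ultimately have "?c = ?z" by blast
  then have "?c b = ?z b" by (rule fun_cong)
  then show ?thesis using b T(2) by (auto split: if_splits)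
qed

lemma basis_expansion:
  fixes R :: "('a, 'm) ring_scheme" (structure) and M :: "('a, 'b) module"
  assumes "is_module_basis R M B" and "m \<in> carrier M"
  obtains c where "c \<in> B \<rightarrow> carrier R" "finite {v\<in>B. c v \<noteq> \<zero>}"
    "m = (\<Oplus>\<^bsub>M\<^esub>v\<in>{v\<in>B. c v \<noteq> \<zero>}. c v \<odot>\<^bsub>M\<^esub> v)"
proof -
  from assms obtain c where c: "c \<in> B \<rightarrow>\<^sub>E carrier R" "finite {v\<in>B. c v \<noteq> \<zero>}"
    "m = (\<Oplus>\<^bsub>M\<^esub>v\<in>{v\<in>B. c v \<noteq> \<zero>}. c v \<odot>\<^bsub>M\<^esub> v)" unfolding is_module_basis_def by blast
  then have "c \<in> B \<rightarrow> carrier R" by (auto simp: PiE_def)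
  then show thesis using c(2,3) by (rule that)
qed

text \<open>A free quotient splits off, so \<open>U\<close> is a direct summand of the free module; the projection to \<open>U\<close>
is recorded by the images \<open>p j\<close> of the unit vectors. To obtain it without first showing that
coordinates are linear, lift the finitely many basis elements that occur in the cosets of the unit
vectors, let \<open>s j\<close> be the resulting lift of the coset of the \<open>j\<close>-th unit vector \<open>e j\<close>, and put
\<open>p j = e j - s j\<close>. For \<open>v\<close> in \<open>U\<close> the coordinates of its coset vanish, which says that the
combination of the \<open>s j\<close> with coefficients \<open>v j\<close> is zero.\<close>

lemma (in cring) free_quotient_splitting:
  assumes U: "submodule U R (free_mod R m)" and free: "free_module R (quotient_module R (free_mod R m) U)"
  shows "\<exists>p. (\<forall>j<m. p j \<in> U) \<and> (\<forall>v\<in>U. \<forall>l<m. v $ l = (\<Oplus>j\<in>{..<m}. v $ j \<otimes> p j $ l))"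
proof -
  let ?F = "free_mod R m" and ?e = "free_unit R m"
  let ?Q = "quotient_module R ?F U"
  interpret F: module R ?F by (rule free_mod_module)
  interpret Q: module R ?Q by (rule quotient_module_module[OF free_mod_module U])
  interpret U: abelian_subgroup U ?F by (rule F.submodule_abelian_subgroup[OF U])
  define \<pi> where "\<pi> = (\<lambda>v\<in>carrier ?F. U +>\<^bsub>?F\<^esub> v)"
  have pi: "\<pi> \<in> mod_homs R ?F ?Q" unfolding \<pi>_def by (rule coset_map_hom[OF free_mod_module U])
  have pic: "\<pi> v \<in> carrier ?Q" if "v \<in> carrier ?F" for v using mod_homs_closed[OF pi that] .
  have pi_surj: "\<exists>v\<in>carrier ?F. \<pi> v = C" if "C \<in> carrier ?Q" for C
    using that by (auto simp: \<pi>_def quotient_module_def A_RCOSETS_def')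
  have pi_zero: "\<pi> v = \<zero>\<^bsub>?Q\<^esub> \<longleftrightarrow> v \<in> U" if "v \<in> carrier ?F" for v
  proof -
    have "U +>\<^bsub>?F\<^esub> v = U \<longleftrightarrow> v \<in> U"
      using U.a_rcos_self[OF that] U.a_rcos_const by blast
    then show ?thesis using that by (simp add: \<pi>_def quotient_module_def)
  qed
  obtain B where B: "is_module_basis R ?Q B" using free unfolding free_module_def by blast
  have BQ: "B \<subseteq> carrier ?Q" using B by (simp add: is_module_basis_def)
  have "\<forall>j. \<exists>c. c \<in> B \<rightarrow> carrier R \<and> finite {b\<in>B. c b \<noteq> \<zero>} \<and>
      \<pi> (?e j) = (\<Oplus>\<^bsub>?Q\<^esub>b\<in>{b\<in>B. c b \<noteq> \<zero>}. c b \<odot>\<^bsub>?Q\<^esub> b)"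
  proof
    fix j
    show "\<exists>c. c \<in> B \<rightarrow> carrier R \<and> finite {b\<in>B. c b \<noteq> \<zero>} \<and>
      \<pi> (?e j) = (\<Oplus>\<^bsub>?Q\<^esub>b\<in>{b\<in>B. c b \<noteq> \<zero>}. c b \<odot>\<^bsub>?Q\<^esub> b)"
      by (rule basis_expansion[OF B pic[OF free_unit_closed[of m j]]]) (intro exI conjI)
  qed
  from choice[OF this] obtain cf where cf: "\<forall>j. cf j \<in> B \<rightarrow> carrier R \<and>
      finite {b\<in>B. cf j b \<noteq> \<zero>} \<and> \<pi> (?e j) = (\<Oplus>\<^bsub>?Q\<^esub>b\<in>{b\<in>B. cf j b \<noteq> \<zero>}. cf j b \<odot>\<^bsub>?Q\<^esub> b)" ..
  have cf1: "cf j \<in> B \<rightarrow> carrier R" for j by (rule cf[rule_format, THEN conjunct1])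
  have cf2: "finite {b\<in>B. cf j b \<noteq> \<zero>}" for j by (rule cf[rule_format, THEN conjunct2, THEN conjunct1])
  have cf3: "\<pi> (?e j) = (\<Oplus>\<^bsub>?Q\<^esub>b\<in>{b\<in>B. cf j b \<noteq> \<zero>}. cf j b \<odot>\<^bsub>?Q\<^esub> b)" for j
    by (rule cf[rule_format, THEN conjunct2, THEN conjunct2])
  define T where "T = (\<Union>j\<in>{..<m}. {b\<in>B. cf j b \<noteq> \<zero>})"
  have T: "finite T" "T \<subseteq> B" using cf2 by (auto simp: T_def)
  have cfc: "cf j b \<in> carrier R" if "b \<in> T" for j b using cf1 that T(2) by (auto simp: Pi_iff)
  have TQ: "b \<in> carrier ?Q" if "b \<in> T" for b using that T(2) BQ by blast
  have pe: "\<pi> (?e j) = (\<Oplus>\<^bsub>?Q\<^esub>b\<in>T. cf j b \<odot>\<^bsub>?Q\<^esub> b)" if "j < m" for j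
    unfolding cf3[of j]
  proof (rule Q.add.finprod_mono_neutral_cong_left[OF T(1)])
    show "{b\<in>B. cf j b \<noteq> \<zero>} \<subseteq> T" using that by (auto simp: T_def)
    fix b assume b: "b \<in> T - {b\<in>B. cf j b \<noteq> \<zero>}"
    then have "cf j b = \<zero>" "b \<in> carrier ?Q" using T(2) BQ by auto
    then show "cf j b \<odot>\<^bsub>?Q\<^esub> b = \<zero>\<^bsub>?Q\<^esub>" by simp
  qed (use cfc TQ in auto)
  have "\<forall>b\<in>T. \<exists>v. v \<in> carrier ?F \<and> \<pi> v = b" using pi_surj TQ by blast
  then obtain lf where lf: "\<And>b. b \<in> T \<Longrightarrow> lf b \<in> carrier ?F" "\<And>b. b \<in> T \<Longrightarrow> \<pi> (lf b) = b" by metis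
  have lfc: "lf b $ l \<in> carrier R" if "b \<in> T" "l < m" for b l using lf(1)[OF that(1)] that(2) by (simp add: mem_free_mod)
  define s where "s j = (\<Oplus>\<^bsub>?F\<^esub>b\<in>T. cf j b \<odot>\<^bsub>?F\<^esub> lf b)" for j
  have clF: "(\<lambda>b. cf j b \<odot>\<^bsub>?F\<^esub> lf b) \<in> T \<rightarrow> carrier ?F" for j using cfc lf(1) by auto
  have s: "s j \<in> carrier ?F" for j unfolding s_def by (rule F.M.finsum_closed[OF clF])
  have ps: "\<pi> (s j) = \<pi> (?e j)" if "j < m" for j
  proof -
    have "\<pi> (s j) = (\<Oplus>\<^bsub>?Q\<^esub>b\<in>T. \<pi> (cf j b \<odot>\<^bsub>?F\<^esub> lf b))"
      unfolding s_def by (rule mod_homs_finsum[OF pi free_mod_module Q.module_axioms T(1) clF])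
    also have "\<dots> = (\<Oplus>\<^bsub>?Q\<^esub>b\<in>T. cf j b \<odot>\<^bsub>?Q\<^esub> b)"
      using cfc lf TQ by (intro Q.M.finsum_cong') (auto simp: mod_homs_smult[OF pi])
    finally show ?thesis using pe[OF that] by simp
  qed
  define p where "p j = ?e j \<ominus>\<^bsub>?F\<^esub> s j" for j
  have minus: "\<ominus>\<^bsub>?F\<^esub> v = (\<ominus> \<one>) \<odot>\<^bsub>?F\<^esub> v" if "v \<in> carrier ?F" for v
    using F.smult_l_minus[OF one_closed that] F.smult_one[OF that] by simp
  have p_eq: "p j = ?e j \<oplus>\<^bsub>?F\<^esub> ((\<ominus> \<one>) \<odot>\<^bsub>?F\<^esub> s j)" for j
    unfolding p_def a_minus_def minus[OF s] ..
  have p: "p j \<in> carrier ?F" for j unfolding p_eq using s by (intro F.M.a_closed F.smult_closed) auto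
  have pU: "p j \<in> U" if "j < m" for j
  proof -
    have "\<pi> (p j) = \<pi> (?e j) \<oplus>\<^bsub>?Q\<^esub> (\<ominus> \<one>) \<odot>\<^bsub>?Q\<^esub> \<pi> (s j)"
      unfolding p_eq using s by (simp add: mod_homs_add[OF pi] mod_homs_smult[OF pi])
    also have "\<dots> = \<zero>\<^bsub>?Q\<^esub>"
      unfolding ps[OF that] using pic[OF free_unit_closed, of j]
      by (simp add: Q.smult_l_minus Q.M.r_neg)
    finally show ?thesis using pi_zero[OF p] by simp
  qed
  have s_index: "s j $ l = (\<Oplus>b\<in>T. cf j b \<otimes> lf b $ l)" if "l < m" for j l
    unfolding s_def using that
    by (simp add: free_mod_finsum_index(2)[OF T(1) clF]) (simp add: free_mod_ops)
  have split: "v $ l = (\<Oplus>j\<in>{..<m}. v $ j \<otimes> p j $ l)" if v: "v \<in> U" and l: "l < m" for v l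
  proof -
    have vF: "v \<in> carrier ?F" using v U.a_subset by blast
    have vj: "v $ j \<in> carrier R" if "j < m" for j using vF that by (simp add: mem_free_mod)
    have "\<zero>\<^bsub>?Q\<^esub> = \<pi> v" using pi_zero[OF vF] v by simp
    also have "\<dots> = (\<Oplus>\<^bsub>?Q\<^esub>j\<in>{..<m}. v $ j \<odot>\<^bsub>?Q\<^esub> \<pi> (?e j))"
      by (rule free_mod_hom_expansion[OF pi Q.module_axioms vF])
    also have "\<dots> = (\<Oplus>\<^bsub>?Q\<^esub>j\<in>{..<m}. \<pi> (v $ j \<odot>\<^bsub>?F\<^esub> s j))"
      using vj s pic by (intro Q.M.finsum_cong') (auto simp: ps mod_homs_smult[OF pi])
    also have "\<dots> = \<pi> (\<Oplus>\<^bsub>?F\<^esub>j\<in>{..<m}. v $ j \<odot>\<^bsub>?F\<^esub> s j)"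
      using vj s by (intro mod_homs_finsum[OF pi free_mod_module Q.module_axioms, symmetric]) auto
    also have "(\<Oplus>\<^bsub>?F\<^esub>j\<in>{..<m}. v $ j \<odot>\<^bsub>?F\<^esub> s j) = (\<Oplus>\<^bsub>?F\<^esub>b\<in>T. (\<Oplus>j\<in>{..<m}. v $ j \<otimes> cf j b) \<odot>\<^bsub>?F\<^esub> lf b)"
      (is "?L = ?R")
    proof (rule eq_vecI)
      have cL: "(\<lambda>j. v $ j \<odot>\<^bsub>?F\<^esub> s j) \<in> {..<m} \<rightarrow> carrier ?F" using vj s by auto
      have cR: "(\<lambda>b. (\<Oplus>j\<in>{..<m}. v $ j \<otimes> cf j b) \<odot>\<^bsub>?F\<^esub> lf b) \<in> T \<rightarrow> carrier ?F"
        using vj cfc lf by (auto intro!: F.smult_closed finsum_closed)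
      show "dim_vec ?L = dim_vec ?R"
        using free_mod_finsum_index(1)[OF _ cL] free_mod_finsum_index(1)[OF T(1) cR] by simp
      fix l assume "l < dim_vec ?R"
      then have l: "l < m" using free_mod_finsum_index(1)[OF T(1) cR] by simp
      have "?L $ l = (\<Oplus>j\<in>{..<m}. v $ j \<otimes> s j $ l)"
        using l by (simp add: free_mod_finsum_index(2)[OF _ cL]) (simp add: free_mod_ops)
      also have "\<dots> = (\<Oplus>j\<in>{..<m}. \<Oplus>b\<in>T. v $ j \<otimes> (cf j b \<otimes> lf b $ l))"
        using l vj cfc lfc T(1)
        by (intro finsum_cong') (auto simp: s_index finsum_rdistr intro!: finsum_closed)
      also have "\<dots> = (\<Oplus>b\<in>T. \<Oplus>j\<in>{..<m}. v $ j \<otimes> (cf j b \<otimes> lf b $ l))"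
        using vj cfc lfc l T(1) by (intro finsum_swap) auto
      also have "\<dots> = (\<Oplus>b\<in>T. (\<Oplus>j\<in>{..<m}. v $ j \<otimes> cf j b) \<otimes> lf b $ l)"
        using l vj cfc lfc by (intro finsum_cong') (auto simp: finsum_ldistr m_assoc intro!: finsum_closed finsum_cong')
      also have "\<dots> = ?R $ l"
        using l by (simp add: free_mod_finsum_index(2)[OF T(1) cR]) (simp add: free_mod_ops)
      finally show "?L $ l = ?R $ l" .
    qed
    also have "\<pi> ?R = (\<Oplus>\<^bsub>?Q\<^esub>b\<in>T. \<pi> ((\<Oplus>j\<in>{..<m}. v $ j \<otimes> cf j b) \<odot>\<^bsub>?F\<^esub> lf b))"
      using vj cfc lf by (intro mod_homs_finsum[OF pi free_mod_module Q.module_axioms T(1)])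
        (auto intro!: F.smult_closed finsum_closed)
    also have "\<dots> = (\<Oplus>\<^bsub>?Q\<^esub>b\<in>T. (\<Oplus>j\<in>{..<m}. v $ j \<otimes> cf j b) \<odot>\<^bsub>?Q\<^esub> b)"
    proof (rule Q.M.finsum_cong')
      have c: "(\<Oplus>j\<in>{..<m}. v $ j \<otimes> cf j b) \<in> carrier R" if "b \<in> T" for b
        using vj cfc that by (intro finsum_closed) auto
      show "(\<lambda>b. (\<Oplus>j\<in>{..<m}. v $ j \<otimes> cf j b) \<odot>\<^bsub>?Q\<^esub> b) \<in> T \<rightarrow> carrier ?Q"
        using c TQ by auto
      fix b assume "b \<in> T"
      then show "\<pi> ((\<Oplus>j\<in>{..<m}. v $ j \<otimes> cf j b) \<odot>\<^bsub>?F\<^esub> lf b) = (\<Oplus>j\<in>{..<m}. v $ j \<otimes> cf j b) \<odot>\<^bsub>?Q\<^esub> b"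
        using c lf by (simp add: mod_homs_smult[OF pi])
    qed simp
    finally have rel: "(\<Oplus>\<^bsub>?Q\<^esub>b\<in>T. (\<Oplus>j\<in>{..<m}. v $ j \<otimes> cf j b) \<odot>\<^bsub>?Q\<^esub> b) = \<zero>\<^bsub>?Q\<^esub>" by simp
    have coef: "(\<Oplus>j\<in>{..<m}. v $ j \<otimes> cf j b) = \<zero>" if "b \<in> T" for b
      using vj cfc by (intro basis_coefficients_zero[OF Q.module_axioms B T _ rel that]) (auto intro!: finsum_closed)
    have vs: "(\<Oplus>j\<in>{..<m}. v $ j \<otimes> s j $ l) = \<zero>"
    proof -
      have "(\<Oplus>j\<in>{..<m}. v $ j \<otimes> s j $ l) = (\<Oplus>j\<in>{..<m}. \<Oplus>b\<in>T. v $ j \<otimes> (cf j b \<otimes> lf b $ l))"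
        using l vj cfc lfc T(1)
        by (intro finsum_cong') (auto simp: s_index finsum_rdistr intro!: finsum_closed)
      also have "\<dots> = (\<Oplus>b\<in>T. \<Oplus>j\<in>{..<m}. v $ j \<otimes> (cf j b \<otimes> lf b $ l))"
        using vj cfc lfc l T(1) by (intro finsum_swap) auto
      also have "\<dots> = (\<Oplus>b\<in>T. (\<Oplus>j\<in>{..<m}. v $ j \<otimes> cf j b) \<otimes> lf b $ l)"
        using l vj cfc lfc by (intro finsum_cong') (auto simp: finsum_ldistr m_assoc intro!: finsum_closed finsum_cong')
      also have "\<dots> = \<zero>" using coef lfc l by (intro finsum_zero') simp
      finally show ?thesis .
    qed
    have sc: "s j $ l \<in> carrier R" for j using s[of j] l by (simp add: mem_free_mod)
    have "(\<Oplus>j\<in>{..<m}. v $ j \<otimes> p j $ l)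
        = (\<Oplus>j\<in>{..<m}. v $ j \<otimes> (if l = j then \<one> else \<zero>) \<oplus> (\<ominus> \<one>) \<otimes> (v $ j \<otimes> s j $ l))"
      using l vj sc by (intro finsum_cong')
        (auto simp: p_eq free_mod_ops free_unit_def r_distr l_minus r_minus)
    also have "\<dots> = (\<Oplus>j\<in>{..<m}. v $ j \<otimes> (if l = j then \<one> else \<zero>))
        \<oplus> (\<Oplus>j\<in>{..<m}. (\<ominus> \<one>) \<otimes> (v $ j \<otimes> s j $ l))"
      using vj sc by (intro finsum_addf) auto
    also have "(\<Oplus>j\<in>{..<m}. v $ j \<otimes> (if l = j then \<one> else \<zero>)) = v $ l"
      using vj l by (intro finsum_delta) auto
    also have "(\<Oplus>j\<in>{..<m}. (\<ominus> \<one>) \<otimes> (v $ j \<otimes> s j $ l)) = (\<ominus> \<one>) \<otimes> (\<Oplus>j\<in>{..<m}. v $ j \<otimes> s j $ l)"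
      using vj sc by (intro finsum_rdistr[symmetric]) auto
    also have "v $ l \<oplus> \<dots> = v $ l" unfolding vs using vj l by simp
    finally show ?thesis by simp
  qed
  show ?thesis using pU split by blast
qed

text \<open>The image \<open>U\<close> of a minimal matrix consists of vectors with entries of positive degree. If the
cokernel is free, every \<open>u\<close> in \<open>U\<close> is the combination of vectors \<open>p j\<close> of \<open>U\<close> with the entries of
\<open>u\<close> as coefficients, so that entries in filtration step \<open>q\<close> automatically lie in step \<open>q + 1\<close>.
Hence they lie in all steps and vanish: separatedness of the filtration takes the place of
Nakayama's lemma, also when the entries of the matrix mix degrees.\<close>

lemma (in graded_ring) minimal_free_cokernel_zero:
  assumes D: "D \<in> mats_over A m n" and min: "elements_mat D \<subseteq> degree_ge A G 1"
    and free: "free_module A (cokernel A (free_mod A n) (free_mod A m) (mat_map A D))"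
    and v: "v \<in> carrier (free_mod A n)"
  shows "mat_map A D v = \<zero>\<^bsub>free_mod A m\<^esub>"
proof -
  let ?U = "mat_map A D ` carrier (free_mod A n)"
  from free_quotient_splitting[OF mat_map_image_submodule[OF D] free[unfolded cokernel_def]]
  obtain p where p: "\<And>j. j < m \<Longrightarrow> p j \<in> ?U"
    "\<And>u l. \<lbrakk> u \<in> ?U; l < m \<rbrakk> \<Longrightarrow> u $ l = (\<Oplus>j\<in>{..<m}. u $ j \<otimes> p j $ l)" by blast
  have p1: "p j $ l \<in> degree_ge A G 1" if jl: "j < m" "l < m" for j l
  proof -
    obtain w where w: "w \<in> carrier (free_mod A n)" "p j = mat_map A D w" using p(1)[OF jl(1)] by (elim imageE)
    show ?thesis unfolding w(2) by (rule mat_map_degree_ge[OF D min w(1) jl(2)])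
  qed
  let ?u = "mat_map A D v"
  have u: "?u \<in> ?U" "?u \<in> carrier (free_mod A m)" using v mat_map_closed[OF D] by auto
  have "\<forall>l<m. ?u $ l \<in> degree_ge A G q" for q
  proof (induction q)
    case 0
    then show ?case using u(2) carrier_degree_ge by (auto simp: mem_free_mod)
  next
    case (Suc q)
    show ?case
    proof (intro allI impI)
      fix l assume l: "l < m"
      have "(\<Oplus>j\<in>{..<m}. ?u $ j \<otimes> p j $ l) \<in> degree_ge A G (q + 1)"
        using Suc l p1 by (intro degree_ge_finsum degree_ge_mult) auto
      then show "?u $ l \<in> degree_ge A G (Suc q)" unfolding p(2)[OF u(1) l, symmetric] by simp
    qed
  qed
  then have "?u $ l = \<zero>" if "l < m" for l using degree_ge_separated that by blast
  then show ?thesis using u(2) by (intro eq_vecI) (auto simp: mem_free_mod free_mod_ops)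
qed

section \<open>The lifted complex\<close>

lemma elements_mat_subset_iff:
  "elements_mat D \<subseteq> V \<longleftrightarrow> (\<forall>i<dim_row D. \<forall>j<dim_col D. D $$ (i, j) \<in> V)"
proof
  assume "elements_mat D \<subseteq> V"
  then show "\<forall>i<dim_row D. \<forall>j<dim_col D. D $$ (i, j) \<in> V"
    using elements_matI[of D "dim_row D" "dim_col D"] by blast
qed (auto simp: elements_mat_def)

context standard_graded_ring
begin

text \<open>If a minimal matrix were onto a nonzero free module, a unit vector would have entries of positive
degree.\<close>

lemma minimal_image_carrier:
  assumes E: "E \<in> mats_over A m n" and min: "elements_mat E \<subseteq> degree_ge A G 1"
    and surj: "mat_map A E ` carrier (free_mod A n) = carrier (free_mod A m)"
  shows "m = 0"
proof (rule ccontr)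
  assume "m \<noteq> 0"
  then have m: "0 < m" by simp
  from surj free_unit_closed[of m 0] obtain v where v: "v \<in> carrier (free_mod A n)"
    "free_unit A m 0 = mat_map A E v" by blast
  have "free_unit A m 0 $ 0 \<in> degree_ge A G 1"
    unfolding v(2) by (rule mat_map_degree_ge[OF E min v(1) m])
  then show False using m one_not_degree_ge by (simp add: free_unit_def)
qed

lemma minimal_exact_zero:
  assumes D: "D \<in> mats_over A l m" and E: "E \<in> mats_over A m n"
    and min: "elements_mat E \<subseteq> degree_ge A G 1" and ex: "mat_exact A D E"
    and D0: "\<And>v. v \<in> carrier (free_mod A m) \<Longrightarrow> mat_map A D v = \<zero>\<^bsub>free_mod A l\<^esub>"
  shows "m = 0"
proof (rule minimal_image_carrier[OF E min])
  have "dim_row D = l" "dim_col D = m" "dim_col E = n" using D E by (auto simp: mats_over_iff)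
  then show "mat_map A E ` carrier (free_mod A n) = carrier (free_mod A m)"
    using ex D0 unfolding mat_exact_def by auto
qed

text \<open>A zero module in the complex makes the differential from its left neighbour zero, so exactness there
forces the next differential, which is minimal, to be onto; hence the left neighbour vanishes too.
The dual complex carries the same argument to the right.\<close>

lemma minimal_exact_all_zero:
  fixes n :: "int \<Rightarrow> nat"
  assumes D: "\<And>i. D i \<in> mats_over A (n (i - 1)) (n i)"
    and min: "\<And>i. elements_mat (D i) \<subseteq> degree_ge A G 1"
    and ex: "\<And>j. mat_exact A (D j) (D (j + 1))" and ext: "\<And>j. mat_exact A (D (j + 1))\<^sup>T (D j)\<^sup>T"
    and i: "n i = 0"
  shows "n j = 0"
proof -
  have D1: "D (j + 1) \<in> mats_over A (n j) (n (j + 1))" for j using D[of "j + 1"] by simp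
  have to_zero: "mat_map A E v = \<zero>\<^bsub>free_mod A 0\<^esub>" if "E \<in> mats_over A 0 m" "v \<in> carrier (free_mod A m)" for E m v
    using mat_map_closed[OF that] by (auto simp: mem_free_mod free_mod_ops)
  have up: "n (j + 1) = 0" if "n j = 0" for j
  proof (rule minimal_exact_zero[OF D1 D1 min ex])
    show "mat_map A (D (j + 1)) v = \<zero>\<^bsub>free_mod A (n j)\<^esub>" if "v \<in> carrier (free_mod A (n (j + 1)))" for v
      using to_zero D1[of j] that \<open>n j = 0\<close> by simp
  qed
  have minT: "elements_mat (D j)\<^sup>T \<subseteq> degree_ge A G 1" for j
    using min[of j] by (auto simp: elements_mat_subset_iff)
  have down: "n (j - 1) = 0" if "n j = 0" for j
  proof (rule minimal_exact_zero[OF transpose_mats_over[OF D[of j]] transpose_mats_over[OF D[of "j - 1"]] minT])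
    show "mat_exact A (D j)\<^sup>T (D (j - 1))\<^sup>T" using ext[of "j - 1"] by simp
    show "mat_map A (D j)\<^sup>T v = \<zero>\<^bsub>free_mod A (n j)\<^esub>" if "v \<in> carrier (free_mod A (n (j - 1)))" for v
      using to_zero[of "(D j)\<^sup>T"] transpose_mats_over[OF D[of j]] that \<open>n j = 0\<close> by simp
  qed
  show ?thesis
    by (induction j rule: int_induct[where k = i]) (use i up down in auto)
qed

end

lemma module_isomorphic_refl:
  assumes "module A M"
  shows "module_isomorphic A M M"
proof -
  interpret module A M by fact
  have "(\<lambda>v\<in>carrier M. v) \<in> mod_homs A M M" by (auto simp: mod_homs_def)
  moreover have "bij_betw (\<lambda>v\<in>carrier M. v) (carrier M) (carrier M)"
    by (auto simp: bij_betw_def inj_on_def)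
  ultimately show ?thesis unfolding module_isomorphic_def by blast
qed

text \<open>Total reflexivity asks for the differential between positions \<open>1\<close> and \<open>0\<close>; shifting the complex
moves any differential there.\<close>

lemma (in cring) cokernel_totally_reflexive:
  fixes n :: "int \<Rightarrow> nat"
  assumes one: "\<one> \<noteq> \<zero>" and D: "\<And>i. D i \<in> mats_over R (n (i - 1)) (n i)"
    and ex: "\<And>j. mat_exact R (D j) (D (j + 1))" and ext: "\<And>j. mat_exact R (D (j + 1))\<^sup>T (D j)\<^sup>T"
  shows "totally_reflexive R (cokernel R (free_mod R (n i)) (free_mod R (n (i - 1))) (mat_map R (D i)))"
proof -
  let ?F = "free_mod R (n (i - 1))"
  interpret M: module R ?F by (rule free_mod_module)
  note U = mat_map_image_submodule[OF D[of i]]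
  have "totally_acyclic R (\<lambda>j. free_mod R (n (j + (i - 1)))) (\<lambda>j. mat_map R (D (j + (i - 1))))"
  proof (rule totally_acyclic_free_modI[where n = "\<lambda>j. n (j + (i - 1))" and D = "\<lambda>j. D (j + (i - 1))", OF one])
    fix j
    have j: "j + 1 + (i - 1) = (j + (i - 1)) + 1" "j - 1 + (i - 1) = j + (i - 1) - 1" by simp_all
    show "D (j + (i - 1)) \<in> mats_over R (n (j - 1 + (i - 1))) (n (j + (i - 1)))"
      unfolding j by (rule D)
    show "mat_exact R (D (j + (i - 1))) (D (j + 1 + (i - 1)))" unfolding j by (rule ex)
    show "mat_exact R (D (j + 1 + (i - 1)))\<^sup>T (D (j + (i - 1)))\<^sup>T" unfolding j by (rule ext)
  qed
  moreover have "module_isomorphic R (cokernel R (free_mod R (n i)) ?F (mat_map R (D i)))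
      (cokernel R (free_mod R (n (1 + (i - 1)))) (free_mod R (n (0 + (i - 1)))) (mat_map R (D (1 + (i - 1)))))"
    unfolding cokernel_def
    using module_isomorphic_refl[OF quotient_module_module[OF free_mod_module U]] by simp
  moreover have "finitely_generated_module R (cokernel R (free_mod R (n i)) ?F (mat_map R (D i)))"
    unfolding cokernel_def
  proof (rule quotient_module_finitely_generated[OF free_mod_module U])
    show "free_unit R (n (i - 1)) \<in> {..<n (i - 1)} \<rightarrow> carrier ?F" by simp
    fix v assume v: "v \<in> carrier ?F"
    show "\<exists>a\<in>{..<n (i - 1)} \<rightarrow> carrier R. v = (\<Oplus>\<^bsub>?F\<^esub>j\<in>{..<n (i - 1)}. a j \<odot>\<^bsub>?F\<^esub> free_unit R (n (i - 1)) j)"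
      using v by (intro bexI[of _ "vec_index v"] free_mod_expansion[OF v]) (auto simp: mem_free_mod)
  qed simp
  ultimately show ?thesis unfolding totally_reflexive_def by blast
qed

definition eps_sign :: "('a, 'm) ring_scheme \<Rightarrow> int \<Rightarrow> 'a" where
  "eps_sign A i = (if even i then \<one>\<^bsub>A\<^esub> else \<ominus>\<^bsub>A\<^esub> \<one>\<^bsub>A\<^esub>)"

lemma (in cring) eps_mat_block:
  assumes "x \<in> carrier R" "\<delta>' i \<in> mats_over R (b (i - 1)) (b i)" "M i \<in> mats_over R (b (i - 2)) (b i)"
  shows "eps_mat R x b \<delta>' M i = block x (eps_sign R i) (\<delta>' i) (M i) (\<delta>' (i - 1))"
proof -
  have "mat_smult R \<one> (M i) = M i" "mat_smult R (\<ominus> \<one>) (M i) = mat_uminus R (M i)"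
    using assms(3) by (auto intro!: eq_matI simp: mat_smult_def mat_uminus_def mats_over_iff l_minus)
  moreover have "mat_uminus R (mat_smult R x (mat_id R c)) = mat_smult R (\<ominus> \<one> \<otimes> x) (mat_id R c)" for c
    using assms(1) by (auto intro!: eq_matI simp: mat_smult_def mat_uminus_def mat_id_def l_minus)
  moreover have "dim_row (\<delta>' i) = b (i - 1)" using assms(2) by (simp add: mats_over_iff)
  ultimately show ?thesis using assms(1) by (simp add: eps_mat_def block_def eps_sign_def)
qed

lemma (in graded_ring) block_degree_ge:
  assumes D: "D \<in> mats_over A b0 b1" and E: "E \<in> mats_over A c b0" and N: "N \<in> mats_over A c b1"
    and "\<zeta> \<in> carrier A" "x \<in> degree_ge A G n"
    and "elements_mat D \<subseteq> degree_ge A G n" "elements_mat E \<subseteq> degree_ge A G n" "elements_mat N \<subseteq> degree_ge A G n"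
  shows "elements_mat (block x \<zeta> D N E) \<subseteq> degree_ge A G n"
proof -
  interpret J: ideal "degree_ge A G n" A by (rule degree_ge_ideal)
  have "\<zeta> \<otimes> x \<in> degree_ge A G n" using assms J.I_l_closed by blast
  then have "\<zeta> \<otimes> x \<otimes> (if i = j then \<one> else \<zero>) \<in> degree_ge A G n" for i j :: nat
    using J.I_r_closed by simp
  moreover have "\<And>i j. i < c \<Longrightarrow> j < b1 \<Longrightarrow> \<zeta> \<otimes> N $$ (i, j) \<in> degree_ge A G n"
    using assms J.I_l_closed by (auto simp: elements_mat_subset_iff mats_over_iff)
  ultimately show ?thesis
    using assms by (auto simp: elements_mat_subset_iff mats_over_iff block_def mat_smult_def mat_id_def)
qed

theorem mainTheorem2:
  fixes S :: "('a, 'm) ring_scheme"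
    and R :: "'a set ring"
    and k :: "'a set"
    and G :: "nat \<Rightarrow> 'a set"
    and x :: 'a
    and b :: "int \<Rightarrow> nat"
    and \<delta> :: "int \<Rightarrow> 'a set mat"
    and \<delta>' M :: "int \<Rightarrow> 'a mat"
  assumes "standard_graded_ring S k G"
    and "x \<in> G 1"
    and "\<forall>s\<in>carrier S. x \<otimes>\<^bsub>S\<^esub> s = \<zero>\<^bsub>S\<^esub> \<longrightarrow> s = \<zero>\<^bsub>S\<^esub>"
    and "R = S Quot (PIdl\<^bsub>S\<^esub> x)"
    and "\<forall>i. \<delta> i \<in> mats_over R (b (i - 1)) (b i)"
    and "totally_acyclic R (\<lambda>i. free_mod R (b i)) (\<lambda>i. mat_map R (\<delta> i))"
    and "minimal_differentials R (quotient_grading S (PIdl\<^bsub>S\<^esub> x) G) \<delta>"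
    and "\<exists>i. carrier (free_mod R (b i)) \<noteq> {\<zero>\<^bsub>free_mod R (b i)\<^esub>}"
    and "\<forall>i. \<delta>' i \<in> mats_over S (b (i - 1)) (b i)"
    and "\<forall>i. map_mat (\<lambda>s. PIdl\<^bsub>S\<^esub> x +>\<^bsub>S\<^esub> s) (\<delta>' i) = \<delta> i"
    and "\<forall>i. M i \<in> mats_over S (b (i - 2)) (b i)"
    and "\<forall>i. mat_mult S (\<delta>' i) (\<delta>' (i + 1)) = mat_smult S x (M (i + 1))"
  shows "totally_acyclic S (\<lambda>i. free_mod S (b i + b (i - 1)))
           (\<lambda>i. mat_map S (eps_mat S x b \<delta>' M i))
       \<and> minimal_differentials S G (eps_mat S x b \<delta>' M)
       \<and> (\<forall>i. let C = cokernel S (free_mod S (b i + b (i - 1))) (free_mod S (b (i - 1) + b (i - 2)))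
                        (mat_map S (eps_mat S x b \<delta>' M i))
              in \<not> free_module S C \<and> totally_reflexive S C)"
proof -
  interpret S: standard_graded_ring S k G by (rule assms(1))
  let ?I = "PIdl\<^bsub>S\<^esub> x" and ?p = "\<lambda>s. PIdl\<^bsub>S\<^esub> x +>\<^bsub>S\<^esub> s" and ?\<epsilon> = "eps_mat S x b \<delta>' M"
  let ?J = "degree_ge S G 1"
  have x: "x \<in> carrier S" using S.component_carrier assms(2) .
  have xJ: "x \<in> ?J" using S.component_degree_ge[OF assms(2)] by simp
  have nzd: "s = \<zero>\<^bsub>S\<^esub>" if "s \<in> carrier S" "x \<otimes>\<^bsub>S\<^esub> s = \<zero>\<^bsub>S\<^esub>" for s using assms(3) that by blast
  have I: "ideal ?I S" by (rule S.cgenideal_ideal[OF x])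
  interpret R: cring R unfolding assms(4) by (rule ideal.quotient_is_cring[OF I S.is_cring])
  have \<delta>: "\<delta> i \<in> mats_over R (b (i - 1)) (b i)" for i using assms(5) by blast
  have \<delta>': "\<delta>' i \<in> mats_over S (b (i - 1)) (b i)" for i using assms(9) by blast
  have lift: "map_mat ?p (\<delta>' i) = \<delta> i" for i using assms(10) by blast
  have M: "M i \<in> mats_over S (b (i - 2)) (b i)" for i using assms(11) by blast
  have \<delta>'1: "\<delta>' (i + 1) \<in> mats_over S (b i) (b (i + 1))" for i using \<delta>'[of "i + 1"] by simp
  have \<delta>'m: "\<delta>' (i - 1) \<in> mats_over S (b (i - 2)) (b (i - 1))" for i using \<delta>'[of "i - 1"] by simp
  have M1: "M (i + 1) \<in> mats_over S (b (i - 1)) (b (i + 1))" for i using M[of "i + 1"] by simp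
  have sq1: "mat_mult S (\<delta>' i) (\<delta>' (i + 1)) = mat_smult S x (M (i + 1))" for i using assms(12) by blast
  have sq: "mat_mult S (\<delta>' (i - 1)) (\<delta>' i) = mat_smult S x (M i)" for i using sq1[of "i - 1"] by simp

  note ta = R.totally_acyclic_free_modD[where n = b and D = \<delta>, OF assms(6) \<delta>]
  have mod1: "S.exact_modulo x (\<delta>' i) (\<delta>' (i + 1))" for i
    using ta(1)[of i] by (intro S.exact_modulo_of_quotient[OF x \<delta>' \<delta>'1]) (simp add: lift assms(4))
  have mod2: "S.exact_modulo x (\<delta>' i)\<^sup>T (\<delta>' (i - 1))\<^sup>T" for i
    using ta(2)[of "i - 1"] lift
    by (intro S.exact_modulo_of_quotient[OF x transpose_mats_over[OF \<delta>'] transpose_mats_over[OF \<delta>'m]])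
      (simp add: map_mat_transpose[symmetric] assms(4))

  have sign: "eps_sign S i \<in> carrier S" "eps_sign S i \<otimes>\<^bsub>S\<^esub> eps_sign S i = \<one>\<^bsub>S\<^esub>"
    "eps_sign S (i + 1) = \<ominus>\<^bsub>S\<^esub> eps_sign S i" for i
    by (auto simp: eps_sign_def S.l_minus S.r_minus)
  have eps: "?\<epsilon> i = S.block x (eps_sign S i) (\<delta>' i) (M i) (\<delta>' (i - 1))" for i
    by (rule S.eps_mat_block[where b = b and \<delta>' = \<delta>' and M = M and i = i, OF x \<delta>' M])
  have eps1: "?\<epsilon> (i + 1) = S.block x (\<ominus>\<^bsub>S\<^esub> eps_sign S i) (\<delta>' (i + 1)) (M (i + 1)) (\<delta>' i)" for i
    using eps[of "i + 1"] unfolding sign(3) by simp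
  note block = S.block_exact[OF x nzd sign(1,2) \<delta>' \<delta>'m M \<delta>'1 M1 sq1 sq]
  have ex: "mat_exact S (?\<epsilon> i) (?\<epsilon> (i + 1))" for i
    unfolding eps1 unfolding eps[of i] by (rule block(1)[OF _ _ mod1])
  have ext: "mat_exact S (?\<epsilon> (i + 1))\<^sup>T (?\<epsilon> i)\<^sup>T" for i
    unfolding eps1 unfolding eps[of i] by (rule block(2)[OF _ _ mod2])
  have eps_mats: "?\<epsilon> i \<in> mats_over S (b (i - 1) + b (i - 2)) (b i + b (i - 1))" for i
    using \<delta>'[of i] \<delta>'m[of i] M[of i]
    unfolding eps S.block_def
    by (intro S.four_block_mats_over S.mat_smult_mats_over)
      (auto simp: S.mat_id_mats_over sign x mats_over_iff mat_id_def)
  have eps_mats': "?\<epsilon> i \<in> mats_over S (b (i - 1) + b (i - 1 - 1)) (b i + b (i - 1))" for i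
    using eps_mats[of i] by simp

  have \<delta>'_min: "elements_mat (\<delta>' i) \<subseteq> ?J" for i
    unfolding elements_mat_subset_iff
  proof (intro allI impI)
    fix l j assume l: "l < dim_row (\<delta>' i)" and j: "j < dim_col (\<delta>' i)"
    have "\<delta> i $$ (l, j) \<in> homogeneous_max_ideal R (quotient_grading S ?I G)"
      using assms(7) l j unfolding minimal_differentials_def elements_mat_subset_iff lift[symmetric] by auto
    moreover have "\<delta> i $$ (l, j) = ?p (\<delta>' i $$ (l, j))" using l j unfolding lift[symmetric] by simp
    moreover have "\<delta>' i $$ (l, j) \<in> carrier S" using \<delta>'[of i] l j by (auto simp: mats_over_iff)
    ultimately show "\<delta>' i $$ (l, j) \<in> ?J"
      using S.lift_of_quotient_max_ideal[OF xJ] unfolding assms(4) by simp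
  qed
  \<comment> \<open>Products of two lifted differentials have entries of degree at least two, and \<open>x\<close> has degree one.\<close>
  have M_min: "elements_mat (M i) \<subseteq> ?J" for i
    unfolding elements_mat_subset_iff
  proof (intro allI impI)
    fix l j assume "l < dim_row (M i)" "j < dim_col (M i)"
    then have lj: "l < b (i - 2)" "j < b i" and c: "M i $$ (l, j) \<in> carrier S"
      using M[of i] by (auto simp: mats_over_iff)
    have "mat_mult S (\<delta>' (i - 1)) (\<delta>' i) $$ (l, j) \<in> degree_ge S G (1 + 1)"
      by (rule S.mat_mult_degree_ge[OF \<delta>'m \<delta>' \<delta>'_min \<delta>'_min lj])
    then have "x \<otimes>\<^bsub>S\<^esub> M i $$ (l, j) \<in> degree_ge S G 2"
      unfolding sq using lj M[of i] by (simp add: mat_smult_def mats_over_iff numeral_2_eq_2)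
    then show "M i $$ (l, j) \<in> ?J" by (intro S.degree_one_cancel[OF assms(2) nzd c])
  qed
  have eps_min: "elements_mat (?\<epsilon> i) \<subseteq> ?J" for i
    unfolding eps by (rule S.block_degree_ge[OF \<delta>' \<delta>'m M sign(1) xJ \<delta>'_min \<delta>'_min M_min])

  have acyclic: "totally_acyclic S (\<lambda>i. free_mod S (b i + b (i - 1))) (\<lambda>i. mat_map S (?\<epsilon> i))"
    by (rule S.totally_acyclic_free_modI[where n = "\<lambda>i. b i + b (i - 1)" and D = ?\<epsilon>,
          OF S.one_not_zero eps_mats' ex ext])
  have minimal: "minimal_differentials S G ?\<epsilon>"
    using eps_min by (simp add: minimal_differentials_def S.homogeneous_max_ideal_eq)
  have "\<not> free_module S (cokernel S (free_mod S (b i + b (i - 1))) (free_mod S (b (i - 1) + b (i - 2)))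
      (mat_map S (?\<epsilon> i)))" for i
  proof
    assume free: "free_module S (cokernel S (free_mod S (b i + b (i - 1)))
      (free_mod S (b (i - 1) + b (i - 2))) (mat_map S (?\<epsilon> i)))"
    \<comment> \<open>A free cokernel makes the differential zero, so the next one is onto its kernel, the whole module.\<close>
    have "b i + b (i - 1) = 0"
      by (rule S.minimal_exact_zero[OF eps_mats _ eps_min ex[of i]])
        (use eps_mats[of "i + 1"] S.minimal_free_cokernel_zero[OF eps_mats eps_min free] in auto)
    then have "b j + b (j - 1) = 0" for j
      by (rule S.minimal_exact_all_zero[where n = "\<lambda>i. b i + b (i - 1)" and D = ?\<epsilon>,
            OF eps_mats' eps_min ex ext])
    then have "b j = 0" for j by simp
    then have "carrier (free_mod R (b j)) = {\<zero>\<^bsub>free_mod R (b j)\<^esub>}" for j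
      by (auto simp: mem_free_mod free_mod_ops)
    then show False using assms(8) by blast
  qed
  moreover have "totally_reflexive S (cokernel S (free_mod S (b i + b (i - 1)))
      (free_mod S (b (i - 1) + b (i - 2))) (mat_map S (?\<epsilon> i)))" for i
    using S.cokernel_totally_reflexive[where n = "\<lambda>i. b i + b (i - 1)" and D = ?\<epsilon> and i = i,
        OF S.one_not_zero eps_mats' ex ext] by simp
  ultimately show ?thesis using acyclic minimal by (simp add: Let_def)
qed

end
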